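(* Let $\{(X_i,Y_i)\}_{i\ge 1}$ be i.i.d. copies of a bivariate random vector $(X,Y)$ with continuous marginal distribution functions and copula $C$. Assume $C=C^t$ and that $C$ has continuous first-order partial derivatives. Let $T_n=n\int_{[0,1]^2}|C_n(u,v)-C_n(v,u)|\,du\,dv$ (the test statistic with $p=1$). Then, as $n\to\infty$, $$\frac{T_n}{\sqrt n}=\sqrt n\int_{[0,1]^2}|C_n(u,v)-C_n(v,u)|\,du\,dv\;\xrightarrow{\;\mathcal D\;}\;\mathcal L_C:=\int_{[0,1]^2}|\mathbb G_C(u,v)-\mathbb G_C(v,u)|\,du\,dv,$$ where $\xrightarrow{\mathcal D}$ denotes convergence in distribution.
   Context: The copula $C$ of $(X,Y)$ is the (unique) distribution function on $[0,1]^2$ with uniform marginals such that $P(X\le x,Y\le y)=C(F_X(x),F_Y(y))$; its transpose is $C^t(u,v)=C(v,u)$. For a sample of size $n$, the pseudo-observations are $\hat U_i=\mathrm{rank}(X_i)/(n+1)$ and $\hat V_i=\mathrm{rank}(Y_i)/(n+1)$ (ranks among $X_1,\dots,X_n$ and $Y_1,\dots,Y_n$ respectively), and the empirical copula is $C_n(u,v)=\frac1n\sum_{i=1}^n\mathbf 1(\hat U_i\le u,\hat V_i\le v)$. The process $\mathbb G_C$ is the centred Gaussian process on $[0,1]^2$, with almost surely continuous sample paths, that is the weak limit in $\ell^\infty([0,1]^2)$ of the empirical copula process $\mathbb G_n(u,v)=\sqrt n\,(C_n(u,v)-C(u,v))$ (this weak convergence, under continuity of the first-order partial derivatives of $C$,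 is a known result of Fermanian, Radulović and Wegkamp). Explicitly, $\mathbb G_C(u,v)=\mathbb B_C(u,v)-\partial_1C(u,v)\,\mathbb B_C(u,1)-\partial_2C(u,v)\,\mathbb B_C(1,v)$, where $\mathbb B_C$ is a centred Gaussian process with covariance $E[\mathbb B_C(u,v)\mathbb B_C(u',v')]=C(\min(u,u'),\min(v,v'))-C(u,v)C(u',v')$. *)

theory Defs
  imports "HOL-Probability.Probability"
begin

abbreviation unit_square :: "(real \<times> real) set" where
  "unit_square \<equiv> {0..1} \<times> {0..1}"

section \<open>Copulas\<close>

text \<open>A copula is only constrained on the unit square; its values elsewhere are irrelevant and
  are never used below.\<close>

definition copula :: "(real \<Rightarrow> real \<Rightarrow> real) \<Rightarrow> bool" where
  "copula C \<longleftrightarrow> (\<exists>\<mu> :: (real \<times> real) measure.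
     prob_space \<mu> \<and> sets \<mu> = sets borel \<and>
     distr \<mu> borel fst = uniform_measure lborel {0..1} \<and>
     distr \<mu> borel snd = uniform_measure lborel {0..1} \<and>
     (\<forall>u\<in>{0..1}. \<forall>v\<in>{0..1}. C u v = measure \<mu> ({..u} \<times> {..v})))"

definition copula_of ::
    "'a measure \<Rightarrow> ('a \<Rightarrow> real) \<Rightarrow> ('a \<Rightarrow> real) \<Rightarrow> (real \<Rightarrow> real \<Rightarrow> real) \<Rightarrow> bool" where
  "copula_of M X Y C \<longleftrightarrow> copula C \<and>
     (\<forall>x y. measure M {\<omega> \<in> space M. X \<omega> \<le> x \<and> Y \<omega> \<le> y} =
            C (cdf (distr M borel X) x) (cdf (distr M borel Y) y))"

definition copula_transpose :: "(real \<Rightarrow> real \<Rightarrow> real) \<Rightarrow> real \<Rightarrow> real \<Rightarrow> real" where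
  "copula_transpose C u v = C v u"

text \<open>Partial derivatives are relative to the unit interval, hence one-sided on the boundary of
  the unit square.\<close>

definition partial1 :: "(real \<Rightarrow> real \<Rightarrow> real) \<Rightarrow> real \<Rightarrow> real \<Rightarrow> real" where
  "partial1 C u v = vector_derivative (\<lambda>s. C s v) (at u within {0..1})"

definition partial2 :: "(real \<Rightarrow> real \<Rightarrow> real) \<Rightarrow> real \<Rightarrow> real \<Rightarrow> real" where
  "partial2 C u v = vector_derivative (\<lambda>t. C u t) (at v within {0..1})"

definition continuous_partials :: "(real \<Rightarrow> real \<Rightarrow> real) \<Rightarrow> bool" where
  "continuous_partials C \<longleftrightarrow>
     (\<forall>u\<in>{0..1}. \<forall>v\<in>{0..1}.
        ((\<lambda>s. C s v) has_real_derivative partial1 C u v) (at u within {0..1}) \<and>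
        ((\<lambda>t. C u t) has_real_derivative partial2 C u v) (at v within {0..1})) \<and>
     continuous_on unit_square (\<lambda>(u, v). partial1 C u v) \<and>
     continuous_on unit_square (\<lambda>(u, v). partial2 C u v)"

section \<open>Empirical copula and test statistic\<close>

text \<open>Samples are sequences indexed from 1. Ties, for which there are several conventions for the
  rank, have probability zero when the marginals are continuous.\<close>

definition rank :: "nat \<Rightarrow> (nat \<Rightarrow> real) \<Rightarrow> nat \<Rightarrow> nat" where
  "rank n x i = card {j \<in> {1..n}. x j \<le> x i}"

definition pseudo_obs :: "nat \<Rightarrow> (nat \<Rightarrow> real) \<Rightarrow> nat \<Rightarrow> real" where
  "pseudo_obs n x i = real (rank n x i) / (real n + 1)"

definition emp_copula ::
    "nat \<Rightarrow> (nat \<Rightarrow> real) \<Rightarrow> (nat \<Rightarrow> real) \<Rightarrow> real \<Rightarrow> real \<Rightarrow> real" where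
  "emp_copula n x y u v =
     (1 / real n) * (\<Sum>i=1..n. of_bool (pseudo_obs n x i \<le> u \<and> pseudo_obs n y i \<le> v))"

definition L1_asymmetry :: "(real \<Rightarrow> real \<Rightarrow> real) \<Rightarrow> real" where
  "L1_asymmetry f = (LINT (u, v) : unit_square | lborel. \<bar>f u v - f v u\<bar>)"

definition test_statistic :: "nat \<Rightarrow> (nat \<Rightarrow> real) \<Rightarrow> (nat \<Rightarrow> real) \<Rightarrow> real" where
  "test_statistic n x y = real n * L1_asymmetry (emp_copula n x y)"

section \<open>The limiting Gaussian process\<close>

text \<open>The second argument is the standard deviation; the value 0 gives a point mass.\<close>

definition normal_law :: "real \<Rightarrow> real \<Rightarrow> real measure" where
  "normal_law m s =
     (if s = 0 then return borel m else density lborel (\<lambda>x. ennreal (normal_density m s x)))"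

definition centred_gaussian_process ::
    "'b measure \<Rightarrow> 't set \<Rightarrow> ('t \<Rightarrow> 'b \<Rightarrow> real) \<Rightarrow> bool" where
  "centred_gaussian_process N T Z \<longleftrightarrow>
     (\<forall>t\<in>T. Z t \<in> borel_measurable N \<and> integral\<^sup>L N (Z t) = 0) \<and>
     (\<forall>F a. finite F \<and> F \<subseteq> T \<longrightarrow>
        (\<exists>m s. 0 \<le> s \<and> distr N borel (\<lambda>\<omega>. \<Sum>t\<in>F. a t * Z t \<omega>) = normal_law m s))"

definition copula_bridge ::
    "'b measure \<Rightarrow> (real \<Rightarrow> real \<Rightarrow> real) \<Rightarrow> (real \<times> real \<Rightarrow> 'b \<Rightarrow> real) \<Rightarrow> bool" where
  "copula_bridge N C B \<longleftrightarrow> centred_gaussian_process N unit_square B \<and>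
     (\<forall>u\<in>{0..1}. \<forall>v\<in>{0..1}. \<forall>u'\<in>{0..1}. \<forall>v'\<in>{0..1}.
        integral\<^sup>L N (\<lambda>\<omega>. B (u, v) \<omega> * B (u', v') \<omega>) = C (min u u') (min v v') - C u v * C u' v')"

text \<open>The bridge \<open>B\<close> is only determined through its finite-dimensional distributions, so \<open>G\<close> is
  required to be a version, with almost surely continuous paths, of the process obtained from it.\<close>

definition copula_limit_process ::
    "'b measure \<Rightarrow> (real \<Rightarrow> real \<Rightarrow> real) \<Rightarrow> (real \<times> real \<Rightarrow> 'b \<Rightarrow> real) \<Rightarrow> bool" where
  "copula_limit_process N C G \<longleftrightarrow>
     centred_gaussian_process N unit_square G \<and>
     (AE \<omega> in N. continuous_on unit_square (\<lambda>p. G p \<omega>)) \<and>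
     (\<exists>B. copula_bridge N C B \<and>
        (\<forall>u\<in>{0..1}. \<forall>v\<in>{0..1}. AE \<omega> in N.
           G (u, v) \<omega> = B (u, v) \<omega> - partial1 C u v * B (u, 1) \<omega> - partial2 C u v * B (1, v) \<omega>))"

definition limit_functional :: "(real \<times> real \<Rightarrow> 'b \<Rightarrow> real) \<Rightarrow> 'b \<Rightarrow> real" where
  "limit_functional G \<omega> = L1_asymmetry (\<lambda>u v. G (u, v) \<omega>)"

text \<open>Convergence in distribution of real random variables living on possibly different spaces.
  Continuity of the paths of the limit process only holds almost surely, and on the exceptional null
  set the path integral need not depend measurably on \<open>\<omega>\<close>; so the law of the limit is taken on
  the completed space. For a measurable \<open>Z\<close> this is the same as \<open>distr N borel Z\<close>.\<close>

definition converges_in_distribution ::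
    "'a measure \<Rightarrow> (nat \<Rightarrow> 'a \<Rightarrow> real) \<Rightarrow> 'b measure \<Rightarrow> ('b \<Rightarrow> real) \<Rightarrow> bool" where
  "converges_in_distribution M Zs N Z \<longleftrightarrow>
     weak_conv_m (\<lambda>n. distr M borel (Zs n)) (distr (completion N) borel Z)"

end

theory Submission
  imports Defs
begin

text \<open>
  No weak convergence in a function space is needed, because the limit functional is an \<open>L\<^sup>1\<close>-norm.
  Passing to \<open>(F(X\<^sub>i), G(Y\<^sub>i))\<close>, which does not change ranks almost surely, we may take uniform
  margins. For each fixed \<open>(u, v)\<close> the process \<open>\<surd>n (C\<^sub>n - C)\<close> differs from the normalised sum of
  the centred variables \<open>1(U\<^sub>i \<le> u, V\<^sub>i \<le> v) - \<partial>\<^sub>1C(u, v) 1(U\<^sub>i \<le> u) - \<partial>\<^sub>2C(u, v) 1(V\<^sub>i \<le> v)\<close> by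
  a term that tends to 0 in mean; being bounded in mean, this remainder disappears after integration
  over the square. The second moments of the increments of the normalised sums are bounded
  independently of \<open>n\<close>, so the integral over the square may be replaced, uniformly in \<open>n\<close>, by a finite
  sum \<open>\<Sum>w\<^sub>g \<bar>S\<^sub>n(g)\<bar>\<close>. Its characteristic function converges by the central limit theorem for
  linear combinations, whose limit variances agree with those of the Gaussian process, and Levy's
  continuity theorem finishes the proof.
\<close>

section \<open>Characteristic functions of sums of absolute values\<close>

text \<open>Ranks are linearised at one fixed interior point at a time, through the total derivative
  of C there; Fubini's theorem then exchanges expectation and integration over the square. The
  obstacle that remains is the absolute value. The central limit theorem controls characteristic
  functions of linear statistics, while the exponential of a weighted sum of absolute values is not
  a function of one linear combination. It is approximated by combinations of characters, after a
  cut-off at a height L whose cost is paid by second moments. The symmetry of C enters through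
  centring: C(u, v) and C(v, u) may be subtracted from the two empirical copulas without changing
  their difference. The mean error of the discretisation is at most a term in n plus a term in the
  fineness m of the mesh, so m can be fixed for all n at once before n grows. Continuity of the
  paths of G identifies the limit of its Riemann sums with the path integral.\<close>

inductive trig_poly :: "'i set \<Rightarrow> (('i \<Rightarrow> real) \<Rightarrow> complex) \<Rightarrow> bool" for I where
  iexp: "trig_poly I (\<lambda>x. iexp (\<Sum>j\<in>I. t j * x j))"
| add: "trig_poly I f \<Longrightarrow> trig_poly I g \<Longrightarrow> trig_poly I (\<lambda>x. f x + g x)"
| scale: "trig_poly I f \<Longrightarrow> trig_poly I (\<lambda>x. c * f x)"

text \<open>Exponents add, so a product of two characters is a character; the nested induction
  extends this bilinearly. Closure under products is what brings polynomials in cosines into the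
  class.\<close>

lemma trig_poly_mult:
  assumes "trig_poly I f" "trig_poly I g"
  shows "trig_poly I (\<lambda>x. f x * g x)"
  using assms(1)
proof induction
  case (iexp t)
  show ?case using assms(2)
  proof induction
    case (iexp s)
    have "(\<lambda>x. exp (\<i> * complex_of_real (\<Sum>j\<in>I. t j * x j)) * exp (\<i> * complex_of_real (\<Sum>j\<in>I. s j * x j)))
      = (\<lambda>x. exp (\<i> * complex_of_real (\<Sum>j\<in>I. (t j + s j) * x j)))"
      by (simp add: exp_add[symmetric] distrib_right sum.distrib distrib_left)
    then show ?case using trig_poly.iexp[of I "\<lambda>j. t j + s j"] by simp
  next
    case (add f g)
    then show ?case by (simp add: distrib_left trig_poly.add)
  next
    case (scale f c)
    then show ?case using trig_poly.scale[OF scale.IH, of c] by (simp add: mult.left_commute)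
  qed
next
  case (add f h)
  then show ?case by (simp add: distrib_right trig_poly.add)
next
  case (scale f c)
  then show ?case using trig_poly.scale[OF scale.IH, of c] by (simp add: mult.assoc)
qed

lemma trig_poly_const: "trig_poly I (\<lambda>x. c)"
  using trig_poly.scale[OF trig_poly.iexp[of I "\<lambda>_. 0"], of c] by simp

lemma trig_poly_sum:
  assumes "finite A" "\<And>a. a \<in> A \<Longrightarrow> trig_poly I (f a)"
  shows "trig_poly I (\<lambda>x. \<Sum>a\<in>A. f a x)"
  using assms by (induction A rule: finite_induct) (auto intro: trig_poly_const trig_poly.add)

lemma trig_poly_power: "trig_poly I f \<Longrightarrow> trig_poly I (\<lambda>x. f x ^ k)"
  by (induction k) (auto intro: trig_poly_const trig_poly_mult)

text \<open>By Euler's formula the cosine of one coordinate is half the sum of two characters, with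
  coefficient c or -c at j and 0 elsewhere.\<close>

lemma trig_poly_cos:
  assumes "finite I" "j \<in> I"
  shows "trig_poly I (\<lambda>x. complex_of_real (cos (c * x j)))"
proof -
  have s: "(\<Sum>k\<in>I. (if k = j then d else 0) * x k) = d * x j" for d and x :: "'a \<Rightarrow> real"
  proof -
    have "(\<Sum>k\<in>I. (if k = j then d else 0) * x k) = (\<Sum>k\<in>I. if k = j then d * x k else 0)"
      by (intro sum.cong) auto
    then show ?thesis using assms by simp
  qed
  have "trig_poly I (\<lambda>x. (1/2) * iexp (c * x j))" "trig_poly I (\<lambda>x. (1/2) * iexp ((-c) * x j))"
    using trig_poly.scale[OF trig_poly.iexp[of I "\<lambda>k. if k = j then c else 0"], of "1/2"]
      trig_poly.scale[OF trig_poly.iexp[of I "\<lambda>k. if k = j then -c else 0"], of "1/2"]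
    unfolding s by blast+
  from trig_poly.add[OF this]
  show ?thesis
    by (simp add: cos_of_real[symmetric] cos_exp_eq add_divide_distrib)
qed

text \<open>Stone-Weierstrass delivers such polynomials. A bounded linear map on the reals is
  multiplication by \<open>f 1\<close>, so the linear generator gives a scaled cosine; the other
  generators are closure properties.\<close>

lemma trig_poly_poly_cos:
  fixes g :: "real \<Rightarrow> real"
  assumes "real_polynomial_function g" "finite I" "j \<in> I"
  shows "trig_poly I (\<lambda>x. complex_of_real (g (cos (c * x j))))"
  using assms(1)
proof induction
  case (linear f)
  then interpret bounded_linear f .
  have "f y = f 1 * y" for y using scaleR[of y 1] by (simp add: mult.commute)
  then have e: "complex_of_real (f y) = of_real (f 1) * of_real y" for y
    by (metis of_real_mult)
  show ?case
    by (subst e) (intro trig_poly.scale trig_poly_cos assms)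
qed (auto intro: trig_poly_const trig_poly_mult trig_poly.add)

lemma trig_poly_bounded: "trig_poly I f \<Longrightarrow> \<exists>B. \<forall>x. norm (f x) \<le> B"
proof (induction rule: trig_poly.induct)
  case (iexp t)
  then show ?case by (intro exI[of _ 1]) simp
next
  case (add f g)
  then obtain A B where "\<forall>x. norm (f x) \<le> A" "\<forall>x. norm (g x) \<le> B" by auto
  then show ?case by (intro exI[of _ "A + B"]) (auto intro: norm_triangle_mono)
next
  case (scale f c)
  then obtain A where "\<forall>x. norm (f x) \<le> A" by auto
  then show ?case by (intro exI[of _ "norm c * A"]) (auto simp: norm_mult intro: mult_left_mono)
qed

lemma trig_poly_measurable:
  assumes "trig_poly I f" "\<And>j. j \<in> I \<Longrightarrow> Z j \<in> borel_measurable M"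
  shows "(\<lambda>\<omega>. f (\<lambda>j. Z j \<omega>)) \<in> borel_measurable M"
  using assms(1)
proof (induction rule: trig_poly.induct)
  case (iexp t)
  have [measurable]: "(\<lambda>\<omega>. \<Sum>j\<in>I. t j * Z j \<omega>) \<in> borel_measurable M"
    using assms(2) by (intro borel_measurable_sum) auto
  show ?case by measurable
next
  case (add f g)
  show ?case by (rule borel_measurable_add[OF add.IH])
next
  case (scale f c)
  show ?case by (rule borel_measurable_times[OF borel_measurable_const scale.IH])
qed

lemma (in finite_measure) trig_poly_integrable:
  assumes "trig_poly I f" "\<And>j. j \<in> I \<Longrightarrow> Z j \<in> borel_measurable M"
  shows "integrable M (\<lambda>\<omega>. f (\<lambda>j. Z j \<omega>))"
proof -
  obtain B where "\<forall>x. norm (f x) \<le> B" using trig_poly_bounded[OF assms(1)] by auto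
  then show ?thesis
    using trig_poly_measurable[OF assms(1), of Z M] assms(2)
    by (intro integrable_const_bound[of _ B]) auto
qed

lemma (in finite_measure) integrable_iexp_real:
  fixes S :: "'a \<Rightarrow> real"
  assumes [measurable]: "S \<in> borel_measurable M"
  shows "integrable M (\<lambda>\<omega>. iexp (S \<omega>))"
  by (rule integrable_const_bound[of _ 1]) auto

text \<open>Factoring out the unimodular \<open>iexp b\<close> leaves the Taylor remainder of order
  0 at \<open>a - b\<close>. The Lipschitz bound converts errors of statistics into errors of
  characteristic functions.\<close>

lemma norm_iexp_diff_le: "norm (iexp a - iexp b) \<le> \<bar>a - b\<bar>"
proof -
  have "iexp a - iexp b = iexp b * (iexp (a - b) - 1)"
    by (simp add: algebra_simps exp_add[symmetric])
  then have "norm (iexp a - iexp b) = norm (iexp (a - b) - 1)"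
    by (simp add: norm_mult)
  also have "\<dots> \<le> \<bar>a - b\<bar>"
    using iexp_approx1[of "a - b" 0] by simp
  finally show ?thesis .
qed

text \<open>The error e is uniform in n and holds at the limit too, so limits may be interchanged.
  The approximants may depend on e, which is how the cut-off height and the trigonometric polynomial
  enter.\<close>

lemma LIMSEQ_of_uniform_approx:
  fixes a :: "nat \<Rightarrow> 'c::real_normed_vector"
  assumes "\<And>e. e > 0 \<Longrightarrow> \<exists>b b'. b \<longlonglongrightarrow> b' \<and> (\<forall>n. norm (a n - b n) \<le> e) \<and> norm (a' - b') \<le> e"
  shows "a \<longlonglongrightarrow> a'"
proof (rule LIMSEQ_I)
  fix r :: real assume "r > 0"
  then obtain b b' where b: "b \<longlonglongrightarrow> b'" "\<And>n. norm (a n - b n) \<le> r/4" "norm (a' - b') \<le> r/4"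
    using assms[of "r/4"] by auto
  then obtain n0 where n0: "\<And>n. n \<ge> n0 \<Longrightarrow> norm (b n - b') < r/4"
    using LIMSEQ_D[of b b' "r/4"] \<open>r > 0\<close> by auto
  show "\<exists>n0. \<forall>n\<ge>n0. norm (a n - a') < r"
  proof (intro exI[of _ n0] allI impI)
    fix n assume "n \<ge> n0"
    have "norm (a n - a') = norm ((a n - b n) + (b n - b') - (a' - b'))" by simp
    also have "\<dots> \<le> norm (a n - b n) + norm (b n - b') + norm (a' - b')"
      by (meson add_right_mono norm_triangle_ineq norm_triangle_ineq4 order_trans)
    also have "\<dots> < r" using b(2)[of n] b(3) n0[OF \<open>n \<ge> n0\<close>] \<open>r > 0\<close> by linarith
    finally show "norm (a n - a') < r" .
  qed
qed

text \<open>Since \<open>arccos (cos y)\<close> is the distance from y to the multiples of 2 pi,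
  this is the 2L-periodic extension of the absolute value from [-L, L]. Written through the cosine,
  it calls for a polynomial approximation of \<open>arccos\<close> on [-1, 1] only.\<close>

definition triangle_wave :: "real \<Rightarrow> real \<Rightarrow> real" where
  "triangle_wave L x = L / pi * arccos (cos (pi / L * x))"

lemma triangle_wave_eq:
  assumes "L > 0" "\<bar>x\<bar> \<le> L"
  shows "triangle_wave L x = \<bar>x\<bar>"
proof -
  have "\<bar>pi / L * x\<bar> \<le> pi"
    using assms by (simp add: abs_mult field_simps)
  moreover have "arccos (cos y) = \<bar>y\<bar>" if "\<bar>y\<bar> \<le> pi" for y
    using that arccos_cos[of y] arccos_cos2[of y] by (cases "y \<ge> 0") auto
  ultimately have "arccos (cos (pi / L * x)) = \<bar>pi / L * x\<bar>" by blast
  then show ?thesis using assms by (simp add: triangle_wave_def abs_mult)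
qed

lemma triangle_wave_measurable [measurable]: "triangle_wave L \<in> borel_measurable borel"
proof -
  have "continuous_on UNIV (\<lambda>x. arccos (cos (pi / L * x)))"
    by (intro continuous_on_compose2[OF continuous_on_arccos'] continuous_intros) auto
  then have "(\<lambda>x. arccos (cos (pi / L * x))) \<in> borel_measurable borel"
    by (rule borel_measurable_continuous_onI)
  then have "(\<lambda>x. L / pi * arccos (cos (pi / L * x))) \<in> borel_measurable borel"
    by (intro borel_measurable_times borel_measurable_const)
  then show ?thesis
    unfolding triangle_wave_def[abs_def] .
qed

text \<open>Two approximations with error e/2 each. A polynomial close to \<open>arccos\<close>
  replaces the exponent by a trigonometric polynomial S; as S is bounded, a Taylor polynomial of the
  exponential approximates \<open>iexp (S x)\<close> uniformly, and powers of S stay in the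
  class.\<close>

lemma trig_poly_approx_triangle_wave:
  assumes "finite I" "L > 0" "e > 0"
  obtains q where "trig_poly I q"
    "\<And>x. norm (iexp (\<Sum>j\<in>I. w j * triangle_wave L (x j)) - q x) \<le> e"
proof -
  define W where "W = (\<Sum>j\<in>I. \<bar>w j\<bar>) + 1"
  have W: "W \<ge> 1" unfolding W_def by (simp add: sum_nonneg)
  \<comment> \<open>Chosen so that \<open>W * (L / pi) * d\<close> equals e/2; the summand 1 in W
    keeps it positive when all weights vanish.\<close>
  define d where "d = e / (2 * W * (L / pi))"
  have "d > 0" using W assms by (simp add: d_def)
  obtain g where g: "real_polynomial_function g" "\<And>y. y \<in> {-1..1} \<Longrightarrow> \<bar>arccos y - g y\<bar> < d"
    by (rule Stone_Weierstrass_real_polynomial_function[OF compact_Icc continuous_on_arccos' \<open>d > 0\<close>])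
      auto
  define S where "S x = (\<Sum>j\<in>I. w j * (L / pi) * g (cos (pi / L * x j)))" for x :: "'a \<Rightarrow> real"
  have S_trig: "trig_poly I (\<lambda>x. complex_of_real (S x))"
    unfolding S_def of_real_sum of_real_mult
    by (intro trig_poly_sum assms trig_poly.scale trig_poly_poly_cos g(1)) 
  have "bounded (g ` {-1..1})"
    by (intro compact_imp_bounded compact_continuous_image compact_Icc
        continuous_at_imp_continuous_on ballI continuous_real_polymonial_function g(1))
  then obtain G where "\<forall>y\<in>g ` {-1..1}. norm y \<le> G"
    unfolding bounded_iff by blast
  then have G: "\<And>y. y \<in> {-1..1} \<Longrightarrow> \<bar>g y\<bar> \<le> G" by simp
  define B where "B = W * (L / pi) * G"
  have "G \<ge> 0" using G[of 0] by auto
  \<comment> \<open>A bound independent of x makes the degree of the Taylor polynomial independent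
    of x.\<close>
  have SB: "\<bar>S x\<bar> \<le> B" for x
  proof -
    have "\<bar>S x\<bar> \<le> (\<Sum>j\<in>I. \<bar>w j\<bar> * (L / pi) * G)"
      unfolding S_def using assms
      by (intro order_trans[OF sum_abs] sum_mono)
        (auto simp: abs_mult intro!: mult_left_mono G divide_right_mono)
    also have "\<dots> \<le> B" using assms \<open>G \<ge> 0\<close>
      unfolding B_def sum_distrib_right[symmetric] by (intro mult_right_mono) (auto simp: W_def)
    finally show ?thesis .
  qed
  have near: "norm (iexp (\<Sum>j\<in>I. w j * triangle_wave L (x j)) - iexp (S x)) \<le> e / 2" for x
  proof -
    have "\<bar>(\<Sum>j\<in>I. w j * triangle_wave L (x j)) - S x\<bar>
        = \<bar>\<Sum>j\<in>I. w j * (L / pi) * (arccos (cos (pi / L * x j)) - g (cos (pi / L * x j)))\<bar>"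
      by (simp add: S_def triangle_wave_def sum_subtractf[symmetric] algebra_simps)
    also have "\<dots> \<le> (\<Sum>j\<in>I. \<bar>w j\<bar> * (L / pi) * d)"
      using assms
      by (intro order_trans[OF sum_abs] sum_mono)
        (auto simp: abs_mult intro!: mult_left_mono less_imp_le[OF g(2)] divide_right_mono)
    also have "\<dots> \<le> W * (L / pi) * d" using assms \<open>d > 0\<close>
      unfolding sum_distrib_right[symmetric] by (intro mult_right_mono) (auto simp: W_def)
    also have "\<dots> = e / 2" using W assms by (simp add: d_def)
    finally show ?thesis using norm_iexp_diff_le order_trans by blast
  qed
  have "(\<lambda>k. B ^ k / fact k) \<longlonglongrightarrow> 0"
    using summable_LIMSEQ_zero[OF summable_exp[of B]] by (simp add: divide_inverse mult.commute)
  then have "\<forall>\<^sub>F k in sequentially. \<bar>B ^ k / fact k\<bar> < e / 2"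
    using \<open>e > 0\<close> by (intro order_tendstoD(2)[of _ 0] tendsto_rabs_zero) auto
  then obtain k0 where k0: "\<And>k. k \<ge> k0 \<Longrightarrow> \<bar>B ^ k / fact k\<bar> < e / 2"
    by (auto simp: eventually_sequentially)
  define q where "q x = (\<Sum>k\<le>k0. (\<i> * complex_of_real (S x)) ^ k / fact k)" for x
  have "trig_poly I (\<lambda>x. \<Sum>k\<le>k0. (1 / fact k) * (\<i> * complex_of_real (S x)) ^ k)"
    by (intro trig_poly_sum trig_poly.scale trig_poly_power S_trig) auto
  then have 1: "trig_poly I q" by (simp add: q_def[abs_def])
  have 2: "norm (iexp (\<Sum>j\<in>I. w j * triangle_wave L (x j)) - q x) \<le> e" for x
  proof -
    have "norm (iexp (S x) - q x) \<le> \<bar>S x\<bar> ^ Suc k0 / fact (Suc k0)"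
      unfolding q_def by (rule iexp_approx1)
    also have "\<dots> \<le> B ^ Suc k0 / fact (Suc k0)"
      by (intro divide_right_mono power_mono SB) auto
    also have "\<dots> \<le> e / 2" using k0[of "Suc k0"] abs_ge_self less_imp_le order_trans by (metis le_SucI order_refl)
    finally show ?thesis
      using near[of x] norm_triangle_ineq[of "iexp (\<Sum>j\<in>I. w j * triangle_wave L (x j)) - iexp (S x)" "iexp (S x) - q x"]
      by simp
  qed
  show ?thesis using that 1 2 by blast
qed

text \<open>A Cramer--Wold device for the functional \<open>\<Sum>w\<^sub>j\<bar>x\<^sub>j\<bar>\<close>. On \<open>[-L, L]\<close> the function \<open>\<bar>x\<bar>\<close> agrees
  with a continuous even periodic function, hence is a uniform limit of polynomials in a cosine;
  so \<open>iexp (\<Sum>w\<^sub>j\<bar>x\<^sub>j\<bar>)\<close> is, up to an error controlled by second moments, a uniform limit of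
  combinations of the functions \<open>iexp (\<Sum>t\<^sub>jx\<^sub>j)\<close>.\<close>

lemma tendsto_char_sum_abs:
  fixes X :: "nat \<Rightarrow> 'i \<Rightarrow> 'a \<Rightarrow> real" and Y :: "'i \<Rightarrow> 'b \<Rightarrow> real"
  assumes "prob_space M" "prob_space N" "finite I"
    and X: "\<And>n j. j \<in> I \<Longrightarrow> X n j \<in> borel_measurable M"
    and Y: "\<And>j. j \<in> I \<Longrightarrow> Y j \<in> borel_measurable N"
    and X2: "\<And>n j. j \<in> I \<Longrightarrow> integrable M (\<lambda>\<omega>. (X n j \<omega>)\<^sup>2)"
      "\<And>n j. j \<in> I \<Longrightarrow> (\<integral>\<omega>. (X n j \<omega>)\<^sup>2 \<partial>M) \<le> K"
    and Y2: "\<And>j. j \<in> I \<Longrightarrow> integrable N (\<lambda>\<omega>. (Y j \<omega>)\<^sup>2)"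
      "\<And>j. j \<in> I \<Longrightarrow> (\<integral>\<omega>. (Y j \<omega>)\<^sup>2 \<partial>N) \<le> K"
    and conv: "\<And>t. (\<lambda>n. \<integral>\<omega>. iexp (\<Sum>j\<in>I. t j * X n j \<omega>) \<partial>M) \<longlonglongrightarrow> (\<integral>\<omega>. iexp (\<Sum>j\<in>I. t j * Y j \<omega>) \<partial>N)"
  shows "(\<lambda>n. \<integral>\<omega>. iexp (\<Sum>j\<in>I. w j * \<bar>X n j \<omega>\<bar>) \<partial>M) \<longlonglongrightarrow> (\<integral>\<omega>. iexp (\<Sum>j\<in>I. w j * \<bar>Y j \<omega>\<bar>) \<partial>N)"
proof -
  interpret M: prob_space M by fact
  interpret N: prob_space N by fact
  have conv_trig: "(\<lambda>n. \<integral>\<omega>. q (\<lambda>j. X n j \<omega>) \<partial>M) \<longlonglongrightarrow> (\<integral>\<omega>. q (\<lambda>j. Y j \<omega>) \<partial>N)" if "trig_poly I q" for q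
    using that
  proof induction
    case (iexp t)
    show ?case by (rule conv)
  next
    case (add f g)
    show ?case using X Y
      by (subst (1 2) Bochner_Integration.integral_add)
        (auto intro!: M.trig_poly_integrable[OF add.hyps(1)] M.trig_poly_integrable[OF add.hyps(2)]
          N.trig_poly_integrable[OF add.hyps(1)] N.trig_poly_integrable[OF add.hyps(2)] tendsto_add add.IH)
  next
    case (scale f c)
    show ?case using tendsto_mult_left[OF scale.IH, of c] by simp
  qed
  have bdd: "norm ((\<integral>\<omega>. f \<omega> \<partial>P) - (\<integral>\<omega>. g \<omega> \<partial>P)) \<le> (\<integral>\<omega>. h \<omega> \<partial>P)"
    if "integrable P f" "integrable P g" "integrable P h" "\<And>\<omega>. norm (f \<omega> - g \<omega>) \<le> h \<omega>"
    for P :: "'c measure" and f g :: "'c \<Rightarrow> complex" and h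
  proof -
    have "norm (\<integral>\<omega>. f \<omega> - g \<omega> \<partial>P) \<le> (\<integral>\<omega>. h \<omega> \<partial>P)"
      by (rule order_trans[OF integral_norm_bound integral_mono]) (use that in auto)
    then show ?thesis using that by simp
  qed
  have int_wave: "integrable P (\<lambda>\<omega>. iexp (\<Sum>j\<in>I. w j * triangle_wave L (Z j \<omega>)))"
    "integrable P (\<lambda>\<omega>. iexp (\<Sum>j\<in>I. w j * \<bar>Z j \<omega>\<bar>))"
    if Z: "\<And>j. j \<in> I \<Longrightarrow> Z j \<in> borel_measurable P" and "prob_space P"
    for P :: "'c measure" and Z L
  proof -
    interpret prob_space P by fact
    show "integrable P (\<lambda>\<omega>. iexp (\<Sum>j\<in>I. w j * triangle_wave L (Z j \<omega>)))"
      "integrable P (\<lambda>\<omega>. iexp (\<Sum>j\<in>I. w j * \<bar>Z j \<omega>\<bar>))"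
      using Z by (auto simp del: of_real_sum intro!: integrable_iexp_real borel_measurable_sum measurable_compose[OF Z])
  qed
  have conv_wave: "(\<lambda>n. \<integral>\<omega>. iexp (\<Sum>j\<in>I. w j * triangle_wave L (X n j \<omega>)) \<partial>M)
      \<longlonglongrightarrow> (\<integral>\<omega>. iexp (\<Sum>j\<in>I. w j * triangle_wave L (Y j \<omega>)) \<partial>N)" if "L > 0" for L
  proof (rule LIMSEQ_of_uniform_approx)
    fix e :: real assume "e > 0"
    obtain q where q: "trig_poly I q"
      "\<And>x. norm (iexp (\<Sum>j\<in>I. w j * triangle_wave L (x j)) - q x) \<le> e"
      using trig_poly_approx_triangle_wave[OF \<open>finite I\<close> \<open>L > 0\<close> \<open>e > 0\<close>] by metis
    have "norm ((\<integral>\<omega>. iexp (\<Sum>j\<in>I. w j * triangle_wave L (X n j \<omega>)) \<partial>M) - (\<integral>\<omega>. q (\<lambda>j. X n j \<omega>) \<partial>M)) \<le> (\<integral>\<omega>. e \<partial>M)" for n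
      by (intro bdd int_wave M.trig_poly_integrable[OF q(1)] X q(2) assms) auto
    moreover have "norm ((\<integral>\<omega>. iexp (\<Sum>j\<in>I. w j * triangle_wave L (Y j \<omega>)) \<partial>N) - (\<integral>\<omega>. q (\<lambda>j. Y j \<omega>) \<partial>N)) \<le> (\<integral>\<omega>. e \<partial>N)"
      by (intro bdd int_wave N.trig_poly_integrable[OF q(1)] Y q(2) assms) auto
    ultimately show "\<exists>b b'. b \<longlonglongrightarrow> b' \<and>
        (\<forall>n. norm ((\<integral>\<omega>. iexp (\<Sum>j\<in>I. w j * triangle_wave L (X n j \<omega>)) \<partial>M) - b n) \<le> e) \<and>
        norm ((\<integral>\<omega>. iexp (\<Sum>j\<in>I. w j * triangle_wave L (Y j \<omega>)) \<partial>N) - b') \<le> e"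
      using conv_trig[OF q(1)] by (simp add: M.prob_space N.prob_space) blast
  qed
  \<comment> \<open>If no coordinate exceeds L, the exponents coincide; otherwise two unit complex
    numbers differ by at most 2, and one summand on the right is already that large. Taking means
    gives Chebyshev's bound.\<close>
  have cut: "norm (iexp (\<Sum>j\<in>I. w j * \<bar>x j\<bar>) - iexp (\<Sum>j\<in>I. w j * triangle_wave L (x j)))
      \<le> (\<Sum>j\<in>I. 2 / L\<^sup>2 * (x j)\<^sup>2)" if "L > 0" for L and x :: "'i \<Rightarrow> real"
  proof (cases "\<forall>j\<in>I. \<bar>x j\<bar> \<le> L")
    case True
    then have "(\<Sum>j\<in>I. w j * \<bar>x j\<bar>) = (\<Sum>j\<in>I. w j * triangle_wave L (x j))"
      using that by (intro sum.cong) (auto simp: triangle_wave_eq)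
    then show ?thesis by (simp add: sum_nonneg)
  next
    case False
    then obtain k where k: "k \<in> I" "\<bar>x k\<bar> > L" by auto
    then have "L\<^sup>2 \<le> (x k)\<^sup>2" using that by (metis abs_le_square_iff abs_of_pos less_imp_le)
    then have "2 \<le> 2 / L\<^sup>2 * (x k)\<^sup>2" using that by (simp add: field_simps)
    also have "\<dots> \<le> (\<Sum>j\<in>I. 2 / L\<^sup>2 * (x j)\<^sup>2)"
      using \<open>finite I\<close> k by (intro member_le_sum) auto
    finally show ?thesis
      using norm_triangle_ineq4[of "iexp (\<Sum>j\<in>I. w j * \<bar>x j\<bar>)" "iexp (\<Sum>j\<in>I. w j * triangle_wave L (x j))"]
      by simp
  qed
  show ?thesis
  proof (rule LIMSEQ_of_uniform_approx)
    fix e :: real assume "e > 0"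
    \<comment> \<open>With \<open>L\<^sup>2 = c / e\<close> the total tail is at most e. The
      absolute value allows K of any sign, and the 1 keeps c positive when the product is 0.\<close>
    define c where "c = real (card I) * \<bar>K\<bar> * 2 + 1"
    define L where "L = sqrt (c / e)"
    have "c > 0" unfolding c_def by (simp add: add_nonneg_pos)
    then have "L > 0" using \<open>e > 0\<close> by (simp add: L_def)
    have small: "(\<Sum>j\<in>I. 2 / L\<^sup>2 * a j) \<le> e" if "\<And>j. j \<in> I \<Longrightarrow> a j \<le> K" for a
    proof -
      have "(\<Sum>j\<in>I. 2 / L\<^sup>2 * a j) \<le> (\<Sum>j\<in>I. 2 / L\<^sup>2 * \<bar>K\<bar>)"
        using that by (intro sum_mono mult_left_mono) (auto intro: order_trans[OF _ abs_ge_self])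
      also have "\<dots> = (c - 1) / L\<^sup>2" by (simp add: c_def)
      also have "\<dots> \<le> c / L\<^sup>2" by (intro divide_right_mono) auto
      also have "\<dots> = e" using \<open>c > 0\<close> \<open>e > 0\<close> by (simp add: L_def)
      finally show ?thesis .
    qed
    have "norm ((\<integral>\<omega>. iexp (\<Sum>j\<in>I. w j * \<bar>X n j \<omega>\<bar>) \<partial>M) - (\<integral>\<omega>. iexp (\<Sum>j\<in>I. w j * triangle_wave L (X n j \<omega>)) \<partial>M))
       \<le> (\<integral>\<omega>. (\<Sum>j\<in>I. 2 / L\<^sup>2 * (X n j \<omega>)\<^sup>2) \<partial>M)" for n
      using X2(1) by (intro bdd int_wave X cut assms \<open>L > 0\<close>) auto
    also have "\<dots> n \<le> e" for n
      using X2 small[of "\<lambda>j. \<integral>\<omega>. (X n j \<omega>)\<^sup>2 \<partial>M"] by (subst Bochner_Integration.integral_sum) auto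
    finally have 1: "norm ((\<integral>\<omega>. iexp (\<Sum>j\<in>I. w j * \<bar>X n j \<omega>\<bar>) \<partial>M) - (\<integral>\<omega>. iexp (\<Sum>j\<in>I. w j * triangle_wave L (X n j \<omega>)) \<partial>M)) \<le> e" for n .
    have "norm ((\<integral>\<omega>. iexp (\<Sum>j\<in>I. w j * \<bar>Y j \<omega>\<bar>) \<partial>N) - (\<integral>\<omega>. iexp (\<Sum>j\<in>I. w j * triangle_wave L (Y j \<omega>)) \<partial>N))
       \<le> (\<integral>\<omega>. (\<Sum>j\<in>I. 2 / L\<^sup>2 * (Y j \<omega>)\<^sup>2) \<partial>N)"
      using Y2(1) by (intro bdd int_wave Y cut assms \<open>L > 0\<close>) auto
    also have "\<dots> \<le> e"
      using Y2 small[of "\<lambda>j. \<integral>\<omega>. (Y j \<omega>)\<^sup>2 \<partial>N"] by (subst Bochner_Integration.integral_sum) auto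
    finally show "\<exists>b b'. b \<longlonglongrightarrow> b' \<and>
        (\<forall>n. norm ((\<integral>\<omega>. iexp (\<Sum>j\<in>I. w j * \<bar>X n j \<omega>\<bar>) \<partial>M) - b n) \<le> e) \<and>
        norm ((\<integral>\<omega>. iexp (\<Sum>j\<in>I. w j * \<bar>Y j \<omega>\<bar>) \<partial>N) - b') \<le> e"
      using 1 conv_wave[OF \<open>L > 0\<close>] by blast
  qed
qed

section \<open>Normal laws and the central limit theorem\<close>

text \<open>Division by s standardises the law, so its characteristic function at 1 is the standard
  normal one at s.\<close>

lemma char_normal_density:
  assumes "0 < s"
  shows "(\<integral>x. iexp x \<partial>density lborel (\<lambda>x. ennreal (normal_density 0 s x))) = exp (- (s\<^sup>2 / 2))"
proof -
  let ?D = "density lborel (\<lambda>x. ennreal (normal_density 0 s x))"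
  interpret D: prob_space ?D by (rule prob_space_normal_density[OF assms])
  have "distributed ?D lborel (\<lambda>x. x) (normal_density 0 s)"
    by (auto simp: distributed_def distr_id2)
  then have "distributed ?D lborel (\<lambda>x. (x - 0) / s) std_normal_density"
    by (rule D.normal_standard_normal_convert[OF assms, where X = "\<lambda>x. x" and \<mu> = 0, THEN iffD1])
  then have std: "std_normal_distribution = distr ?D lborel (\<lambda>x. x / s)"
    by (simp add: distributed_def)
  have "complex_of_real (exp (- (s\<^sup>2) / 2)) = char std_normal_distribution s"
    by (simp add: char_std_normal_distribution)
  also have "\<dots> = (\<integral>x. iexp (s * (x / s)) \<partial>?D)"
    unfolding char_def std by (subst integral_distr) auto
  also have "\<dots> = (\<integral>x. iexp x \<partial>?D)" using assms by simp
  finally show ?thesis by (simp add: exp_of_real[symmetric])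
qed

text \<open>Both branches of \<open>normal_law\<close> have mean m, so centring forces m = 0, and
  the moments are read off the law. The characteristic function is taken at 1, as any other
  frequency can be absorbed into W.\<close>

lemma normal_law_centred:
  fixes W :: "'b \<Rightarrow> real"
  assumes "prob_space N" and W[measurable]: "W \<in> borel_measurable N"
    and law: "distr N borel W = normal_law m s" and "0 \<le> s" and mean: "(\<integral>\<omega>. W \<omega> \<partial>N) = 0"
  shows "integrable N (\<lambda>\<omega>. (W \<omega>)\<^sup>2)" "(\<integral>\<omega>. (W \<omega>)\<^sup>2 \<partial>N) = s\<^sup>2"
    "(\<integral>\<omega>. iexp (W \<omega>) \<partial>N) = exp (- (s\<^sup>2 / 2))"
proof -
  have "(\<integral>x. x \<partial>normal_law m s) = m"
  proof (cases "s = 0")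
    case True
    then show ?thesis by (simp add: normal_law_def integral_return)
  next
    case False
    then have "0 < s" using assms by auto
    then show ?thesis
      using integral_normal_moment_nz_1[of s m]
      by (simp add: normal_law_def integral_density)
  qed
  moreover have "(\<integral>x. x \<partial>distr N borel W) = 0"
    by (subst integral_distr) (auto simp: mean)
  ultimately have m: "m = 0" using law by simp
  have 1: "integrable (normal_law m s) (\<lambda>x. x\<^sup>2) \<and> (\<integral>x. x\<^sup>2 \<partial>normal_law m s) = s\<^sup>2 \<and>
     (\<integral>x. iexp x \<partial>normal_law m s) = exp (- (s\<^sup>2 / 2))"
  proof (cases "s = 0")
    case True
    interpret R: prob_space "return borel (0::real)" by (rule prob_space_return) simp
    have "integrable (return borel (0::real)) (\<lambda>x. x\<^sup>2)"
      by (rule R.integrable_const_bound[of _ 0]) (auto simp: AE_return)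
    then show ?thesis using True by (simp add: normal_law_def integral_return m)
  next
    case False
    then have "0 < s" using assms by auto
    have "has_bochner_integral lborel (\<lambda>x. normal_density 0 s x * x\<^sup>2) (s\<^sup>2)"
      using normal_moment_even[OF \<open>0 < s\<close>, of 0 1] \<open>0 < s\<close> by simp
    then show ?thesis
      using \<open>0 < s\<close> char_normal_density[OF \<open>0 < s\<close>]
      by (simp add: normal_law_def integral_density integrable_density m
          has_bochner_integral_iff)
  qed
  have "integrable (distr N borel W) (\<lambda>x. x\<^sup>2)" "(\<integral>x. x\<^sup>2 \<partial>distr N borel W) = s\<^sup>2"
    "(\<integral>x. iexp x \<partial>distr N borel W) = exp (- (s\<^sup>2 / 2))"
    using 1 by (simp_all only: law)
  then show "integrable N (\<lambda>\<omega>. (W \<omega>)\<^sup>2)" "(\<integral>\<omega>. (W \<omega>)\<^sup>2 \<partial>N) = s\<^sup>2"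
    "(\<integral>\<omega>. iexp (W \<omega>) \<partial>N) = exp (- (s\<^sup>2 / 2))"
    using integral_distr[OF W, of "\<lambda>x. x\<^sup>2"] integral_distr[OF W, of "\<lambda>x. iexp x"]
      integrable_distr_eq[OF W, of "\<lambda>x. x\<^sup>2"] by simp_all
qed

text \<open>The combination over the singleton of t with coefficient 1 is \<open>Z t\<close> itself,
  so its law is normal and has a second moment.\<close>

lemma centred_gaussian_process_sq_integrable:
  assumes "prob_space N" "centred_gaussian_process N T Z" "t \<in> T"
  shows "Z t \<in> borel_measurable N" "integrable N (\<lambda>\<omega>. (Z t \<omega>)\<^sup>2)" "integrable N (Z t)"
proof -
  interpret prob_space N by fact
  show Z: "Z t \<in> borel_measurable N"
    using assms by (auto simp: centred_gaussian_process_def)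
  have "\<exists>m s. 0 \<le> s \<and> distr N borel (\<lambda>\<omega>. \<Sum>t\<in>F. a t * Z t \<omega>) = normal_law m s"
    if "finite F" "F \<subseteq> T" for F a
    using assms(2) that by (auto simp: centred_gaussian_process_def)
  from this[of "{t}" "\<lambda>_. 1"] obtain m s
    where "0 \<le> s" "distr N borel (\<lambda>\<omega>. \<Sum>t\<in>{t}. 1 * Z t \<omega>) = normal_law m s"
    using assms(3) by auto
  then show "integrable N (\<lambda>\<omega>. (Z t \<omega>)\<^sup>2)"
    using normal_law_centred(1)[OF \<open>prob_space N\<close> Z, of m s] assms
    by (auto simp: centred_gaussian_process_def)
  then show "integrable N (Z t)"
    by (rule square_integrable_imp_integrable[OF Z])
qed

text \<open>A centred normal law is determined by its variance. Comparing the Gaussian process with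
  the sample therefore amounts to comparing second moments of linear combinations.\<close>

lemma centred_gaussian_process_char:
  assumes "prob_space N" "centred_gaussian_process N T Z" "finite F" "F \<subseteq> T"
  shows "(\<integral>\<omega>. iexp (\<Sum>t\<in>F. a t * Z t \<omega>) \<partial>N) = exp (- ((\<integral>\<omega>. (\<Sum>t\<in>F. a t * Z t \<omega>)\<^sup>2 \<partial>N) / 2))"
proof -
  interpret prob_space N by fact
  note Z = centred_gaussian_process_sq_integrable[OF assms(1,2)]
  have meas: "(\<lambda>\<omega>. \<Sum>t\<in>F. a t * Z t \<omega>) \<in> borel_measurable N"
    using Z(1) assms(4) by (intro borel_measurable_sum) auto
  have mean: "(\<integral>\<omega>. (\<Sum>t\<in>F. a t * Z t \<omega>) \<partial>N) = 0"
    using Z(3) assms by (subst Bochner_Integration.integral_sum)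
      (auto simp: centred_gaussian_process_def subset_iff)
  obtain m s where "0 \<le> s" "distr N borel (\<lambda>\<omega>. \<Sum>t\<in>F. a t * Z t \<omega>) = normal_law m s"
    using assms unfolding centred_gaussian_process_def by metis
  from normal_law_centred(2,3)[OF \<open>prob_space N\<close> meas this(2,1) mean]
  show ?thesis by simp
qed

section \<open>Sums of independent centred variables\<close>

lemma (in prob_space) expectation_square_sum_indep:
  fixes \<xi> :: "'i \<Rightarrow> 'a \<Rightarrow> real"
  assumes "finite I" "indep_vars (\<lambda>_. borel) \<xi> I"
    and sq: "\<And>i. i \<in> I \<Longrightarrow> integrable M (\<lambda>\<omega>. (\<xi> i \<omega>)\<^sup>2)"
    and mean: "\<And>i. i \<in> I \<Longrightarrow> expectation (\<xi> i) = 0"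
  shows "integrable M (\<lambda>\<omega>. (\<Sum>i\<in>I. \<xi> i \<omega>)\<^sup>2)"
    "expectation (\<lambda>\<omega>. (\<Sum>i\<in>I. \<xi> i \<omega>)\<^sup>2) = (\<Sum>i\<in>I. expectation (\<lambda>\<omega>. (\<xi> i \<omega>)\<^sup>2))"
proof -
  have meas: "\<xi> i \<in> borel_measurable M" if "i \<in> I" for i
    using assms(2) that by (auto simp: indep_vars_def)
  have int: "integrable M (\<xi> i)" if "i \<in> I" for i
    using square_integrable_imp_integrable[OF meas sq] that by blast
  have cross: "integrable M (\<lambda>\<omega>. \<xi> i \<omega> * \<xi> j \<omega>) \<and>
      expectation (\<lambda>\<omega>. \<xi> i \<omega> * \<xi> j \<omega>) = (if i = j then expectation (\<lambda>\<omega>. (\<xi> i \<omega>)\<^sup>2) else 0)"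
    if "i \<in> I" "j \<in> I" for i j
  proof (cases "i = j")
    case True
    then show ?thesis using sq[OF that(1)] by (simp add: power2_eq_square)
  next
    case False
    have "indep_vars (\<lambda>_. borel) \<xi> {i, j}"
      by (rule indep_vars_subset[OF assms(2)]) (use that in auto)
    from indep_vars_lebesgue_integral[OF _ this] indep_vars_integrable[OF _ this]
    show ?thesis using False int that mean by auto
  qed
  have e: "(\<Sum>i\<in>I. \<xi> i \<omega>)\<^sup>2 = (\<Sum>i\<in>I. \<Sum>j\<in>I. \<xi> i \<omega> * \<xi> j \<omega>)" for \<omega>
    by (simp add: power2_eq_square sum_product)
  show "integrable M (\<lambda>\<omega>. (\<Sum>i\<in>I. \<xi> i \<omega>)\<^sup>2)"
    unfolding e using cross by auto
  show "expectation (\<lambda>\<omega>. (\<Sum>i\<in>I. \<xi> i \<omega>)\<^sup>2) = (\<Sum>i\<in>I. expectation (\<lambda>\<omega>. (\<xi> i \<omega>)\<^sup>2))"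
  proof -
    have "expectation (\<lambda>\<omega>. (\<Sum>i\<in>I. \<xi> i \<omega>)\<^sup>2) = (\<Sum>i\<in>I. \<Sum>j\<in>I. expectation (\<lambda>\<omega>. \<xi> i \<omega> * \<xi> j \<omega>))"
      unfolding e using cross by (simp add: Bochner_Integration.integral_sum)
    also have "\<dots> = (\<Sum>i\<in>I. \<Sum>j\<in>I. if i = j then expectation (\<lambda>\<omega>. (\<xi> i \<omega>)\<^sup>2) else 0)"
      using cross by (intro sum.cong) auto
    finally show ?thesis using \<open>finite I\<close> by simp
  qed
qed

text \<open>Evaluation at the frequency \<open>sqrt v\<close> undoes the division by the standard
  deviation in the standardised central limit theorem. A vanishing variance has to be treated
  apart.\<close>

lemma (in prob_space) central_limit_char:
  fixes \<xi> :: "nat \<Rightarrow> 'a \<Rightarrow> real"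
  assumes indep: "indep_vars (\<lambda>_. borel) \<xi> UNIV"
    and mean: "\<And>n. expectation (\<xi> n) = 0"
    and sq: "\<And>n. integrable M (\<lambda>\<omega>. (\<xi> n \<omega>)\<^sup>2)"
    and var: "\<And>n. expectation (\<lambda>\<omega>. (\<xi> n \<omega>)\<^sup>2) = v"
    and law: "\<And>n. distr M borel (\<xi> n) = \<mu>"
  shows "(\<lambda>n. \<integral>\<omega>. iexp ((\<Sum>i<n. \<xi> i \<omega>) / sqrt (real n)) \<partial>M) \<longlonglongrightarrow> exp (- (complex_of_real v / 2))"
proof -
  have meas[measurable]: "\<xi> i \<in> borel_measurable M" for i
    using indep by (auto simp: indep_vars_def)
  have "v \<ge> 0" using var[of 0] by (metis Bochner_Integration.integral_nonneg zero_le_power2)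
  show ?thesis
  proof (cases "v = 0")
    \<comment> \<open>Every summand is 0 almost surely, so the integrand is 1 and the sequence is
      constant.\<close>
    case True
    have "AE \<omega> in M. (\<xi> i \<omega>)\<^sup>2 = 0" for i
      using integral_nonneg_eq_0_iff_AE[OF sq[of i]] var[of i] True by simp
    then have "AE \<omega> in M. \<forall>i. (\<xi> i \<omega>)\<^sup>2 = 0" by (simp add: AE_all_countable)
    then have "(\<integral>\<omega>. iexp ((\<Sum>i<n. \<xi> i \<omega>) / sqrt (real n)) \<partial>M) = (\<integral>\<omega>. 1 \<partial>M)" for n
      by (intro integral_cong_AE) auto
    then show ?thesis using True by (simp add: prob_space)
  next
    case False
    then have "v > 0" using \<open>v \<ge> 0\<close> by simp
    have "weak_conv_m (\<lambda>n. distr M borel (\<lambda>\<omega>. (\<Sum>i<n. \<xi> i \<omega>) / sqrt (n * (sqrt v)\<^sup>2))) std_normal_distribution"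
      using central_limit_theorem_zero_mean[OF indep mean _ sq _ law, of "sqrt v"] \<open>v > 0\<close> mean var
      by simp
    from levy_continuity1[OF _ real_dist_normal_dist this, of "sqrt v"]
    have "(\<lambda>n. char (distr M borel (\<lambda>\<omega>. (\<Sum>i<n. \<xi> i \<omega>) / sqrt (n * (sqrt v)\<^sup>2))) (sqrt v))
      \<longlonglongrightarrow> complex_of_real (exp (- (v / 2)))"
      using \<open>v > 0\<close> by (simp add: char_std_normal_distribution)
    moreover have "char (distr M borel (\<lambda>\<omega>. (\<Sum>i<n. \<xi> i \<omega>) / sqrt (n * (sqrt v)\<^sup>2))) (sqrt v)
      = (\<integral>\<omega>. iexp ((\<Sum>i<n. \<xi> i \<omega>) / sqrt (real n)) \<partial>M)" for n
      unfolding char_def using \<open>v > 0\<close>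
      by (subst integral_distr) (auto simp: real_sqrt_mult)
    ultimately show ?thesis by (simp add: exp_of_real[symmetric])
  qed
qed

section \<open>Ranks and the empirical copula\<close>

lemma rank_less:
  assumes "j \<in> {1..n}" "x i < x j"
  shows "rank n x i < rank n x j"
proof -
  have "{k \<in> {1..n}. x k \<le> x i} \<subset> {k \<in> {1..n}. x k \<le> x j}"
  proof (rule psubsetI)
    have "j \<in> {k \<in> {1..n}. x k \<le> x j}" "j \<notin> {k \<in> {1..n}. x k \<le> x i}" using assms by auto
    then show "{k \<in> {1..n}. x k \<le> x i} \<noteq> {k \<in> {1..n}. x k \<le> x j}" by blast
  qed (use assms in auto)
  then show ?thesis unfolding rank_def by (intro psubset_card_mono) auto
qed

text \<open>Without ties distinct values have distinct ranks, and an injection of {1..n} into itself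
  is onto.\<close>

lemma bij_betw_rank:
  assumes "inj_on x {1..n}"
  shows "bij_betw (rank n x) {1..n} {1..n}"
proof -
  have "inj_on (rank n x) {1..n}"
  proof (rule inj_onI, rule ccontr)
    fix i j assume ij: "i \<in> {1..n}" "j \<in> {1..n}" "rank n x i = rank n x j" "i \<noteq> j"
    then have "x i \<noteq> x j" using assms by (auto dest: inj_onD)
    then show False
      using rank_less[of i n x j] rank_less[of j n x i] ij by (cases "x i < x j") auto
  qed
  moreover have "rank n x ` {1..n} \<subseteq> {1..n}"
  proof safe
    fix i assume i: "i \<in> {1..n}"
    have "rank n x i \<le> card {1..n}" unfolding rank_def by (intro card_mono) auto
    moreover have "card {i} \<le> rank n x i" unfolding rank_def using i by (intro card_mono) auto
    ultimately show "rank n x i \<in> {1..n}" by simp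
  qed
  ultimately show ?thesis
    by (simp add: bij_betw_def endo_inj_surj)
qed

section \<open>Rank sets compared with level sets\<close>

definition rank_set :: "nat \<Rightarrow> (nat \<Rightarrow> real) \<Rightarrow> real \<Rightarrow> nat set" where
  "rank_set n x u = {i \<in> {1..n}. pseudo_obs n x i \<le> u}"

definition level_set :: "nat \<Rightarrow> (nat \<Rightarrow> real) \<Rightarrow> real \<Rightarrow> nat set" where
  "level_set n x a = {i \<in> {1..n}. x i \<le> a}"

lemma finite_rank_set [simp]: "finite (rank_set n x u)"
  and finite_level_set [simp]: "finite (level_set n x a)"
  by (auto simp: rank_set_def level_set_def)

text \<open>A pseudo-observation is at most u exactly when the rank is at most the integer part m of
  (n + 1)u. Ranks being a permutation of 1, ..., n, the rank set has m elements whatever the sample;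
  this deterministic size takes the place of empirical quantiles.\<close>

lemma card_rank_set:
  assumes "inj_on x {1..n}" "0 < u" "u < 1"
  shows "real (card (rank_set n x u)) \<le> (real n + 1) * u"
    "(real n + 1) * u - 1 \<le> real (card (rank_set n x u))"
proof -
  define m where "m = nat \<lfloor>(real n + 1) * u\<rfloor>"
  have pos: "0 \<le> (real n + 1) * u" using assms by simp
  have m: "k \<le> m \<longleftrightarrow> real k \<le> (real n + 1) * u" for k
    unfolding m_def using pos by (simp add: le_nat_floor le_nat_iff le_floor_iff)
  \<comment> \<open>As u < 1, m does not exceed n, so each of 1, ..., m occurs as a rank.\<close>
  have "(real n + 1) * u < real n + 1"
    using assms by (metis mult.right_neutral mult_strict_left_mono of_nat_0_le_iff add_nonneg_pos zero_less_one)
  then have "m < n + 1"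
    using m[of m] by linarith
  have "rank_set n x u = {i \<in> {1..n}. rank n x i \<le> m}"
    unfolding rank_set_def pseudo_obs_def m by (auto simp: divide_le_eq mult.commute)
  then have "rank n x ` rank_set n x u = {k \<in> rank n x ` {1..n}. k \<le> m}" by auto
  also have "\<dots> = {1..m}"
    using bij_betw_imp_surj_on[OF bij_betw_rank[OF assms(1)]] \<open>m < n + 1\<close> by auto
  finally have "card (rank n x ` rank_set n x u) = m" by simp
  moreover have "inj_on (rank n x) (rank_set n x u)"
    by (rule inj_on_subset[OF bij_betw_imp_inj_on[OF bij_betw_rank[OF assms(1)]]])
      (auto simp: rank_set_def)
  ultimately have c: "card (rank_set n x u) = m" by (simp add: card_image)
  show "real (card (rank_set n x u)) \<le> (real n + 1) * u" using m[of m] c by simp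
  show "(real n + 1) * u - 1 \<le> real (card (rank_set n x u))"
    using m[of "Suc m"] c by simp
qed

lemma rank_mono: "x j \<le> x i \<Longrightarrow> rank n x j \<le> rank n x i"
  unfolding rank_def by (intro card_mono) auto

text \<open>Both sets are downward closed in the ordering of the sample by x, and such sets form a
  chain. Comparing cardinalities therefore decides inclusion.\<close>

lemma rank_level_nested: "rank_set n x u \<subseteq> level_set n x a \<or> level_set n x a \<subseteq> rank_set n x u"
proof (rule ccontr)
  assume "\<not> ?thesis"
  then obtain i j where ij: "i \<in> rank_set n x u" "i \<notin> level_set n x a"
      "j \<in> level_set n x a" "j \<notin> rank_set n x u" by auto
  then have "x j \<le> x i" by (auto simp: rank_set_def level_set_def)
  then have "pseudo_obs n x j \<le> pseudo_obs n x i"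
    by (auto simp: pseudo_obs_def intro!: divide_right_mono rank_mono)
  then show False using ij by (auto simp: rank_set_def level_set_def)
qed

lemma subset_of_card_le_nested:
  assumes "A \<subseteq> B \<or> B \<subseteq> A" "finite A" "card A \<le> card B"
  shows "A \<subseteq> B"
  using assms card_seteq by auto

lemma emp_copula_eq_card:
  "real n * emp_copula n x y u v = real (card (rank_set n x u \<inter> rank_set n y v))"
proof -
  have "{1..n} \<inter> {i. pseudo_obs n x i \<le> u \<and> pseudo_obs n y i \<le> v} = rank_set n x u \<inter> rank_set n y v"
    by (auto simp: rank_set_def)
  then show ?thesis
    by (cases "n = 0") (auto simp: emp_copula_def rank_set_def)
qed

text \<open>A level whose count lies below, or above, the known size of the rank set yields a level
  set inside, or around, the rank set. Doing this in both coordinates bounds the intersection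
  without inverting the marginal empirical distributions.\<close>

lemma emp_copula_sandwich:
  assumes inj: "inj_on x {1..n}" "inj_on y {1..n}" and uv: "0 < u" "u < 1" "0 < v" "v < 1"
  shows "real (card (level_set n x a)) \<le> (real n + 1) * u - 1 \<Longrightarrow>
      real (card (level_set n y b)) \<le> (real n + 1) * v - 1 \<Longrightarrow>
      real (card (level_set n x a \<inter> level_set n y b)) \<le> real n * emp_copula n x y u v"
    and "(real n + 1) * u \<le> real (card (level_set n x a)) \<Longrightarrow>
      (real n + 1) * v \<le> real (card (level_set n y b)) \<Longrightarrow>
      real n * emp_copula n x y u v \<le> real (card (level_set n x a \<inter> level_set n y b))"
proof -
  note c = card_rank_set[OF inj(1) uv(1,2)] card_rank_set[OF inj(2) uv(3,4)]
  assume "real (card (level_set n x a)) \<le> (real n + 1) * u - 1"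
    "real (card (level_set n y b)) \<le> (real n + 1) * v - 1"
  then have "level_set n x a \<subseteq> rank_set n x u" "level_set n y b \<subseteq> rank_set n y v"
    using c rank_level_nested by (intro subset_of_card_le_nested; force)+
  then show "real (card (level_set n x a \<inter> level_set n y b)) \<le> real n * emp_copula n x y u v"
    unfolding emp_copula_eq_card by (intro of_nat_mono card_mono) auto
next
  note c = card_rank_set[OF inj(1) uv(1,2)] card_rank_set[OF inj(2) uv(3,4)]
  assume "(real n + 1) * u \<le> real (card (level_set n x a))"
    "(real n + 1) * v \<le> real (card (level_set n y b))"
  then have "rank_set n x u \<subseteq> level_set n x a" "rank_set n y v \<subseteq> level_set n y b"
    using c rank_level_nested by (intro subset_of_card_le_nested; force)+
  then show "real n * emp_copula n x y u v \<le> real (card (level_set n x a \<inter> level_set n y b))"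
    unfolding emp_copula_eq_card by (intro of_nat_mono card_mono) auto
qed

text \<open>One set is exchanged at a time. For nested P and Q the intersections with R differ at
  most by the elements of the larger set outside the smaller, and their number is the difference of
  cardinalities.\<close>

lemma card_Int_diff_le:
  assumes fin: "finite A" "finite A'" "finite B" "finite B'"
    and nested: "A \<subseteq> A' \<or> A' \<subseteq> A" "B \<subseteq> B' \<or> B' \<subseteq> B"
  shows "\<bar>real (card (A \<inter> B)) - real (card (A' \<inter> B'))\<bar>
     \<le> \<bar>real (card A) - real (card A')\<bar> + \<bar>real (card B) - real (card B')\<bar>"
proof -
  have 1: "\<bar>real (card (P \<inter> R)) - real (card (Q \<inter> R))\<bar> \<le> \<bar>real (card P) - real (card Q)\<bar>"
    if "finite P" "finite Q" "P \<subseteq> Q \<or> Q \<subseteq> P" for P Q R :: "'a set"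
  proof -
    have *: "\<bar>real (card (P \<inter> R)) - real (card (Q \<inter> R))\<bar> \<le> \<bar>real (card P) - real (card Q)\<bar>"
      if "finite Q" "P \<subseteq> Q" for P Q :: "'a set"
    proof -
      have fP: "finite P" using that finite_subset by blast
      have "card (Q \<inter> R) \<le> card (P \<inter> R) + card (Q - P)"
        using that fP by (intro order_trans[OF card_mono card_Un_le]) auto
      moreover have "card (P \<inter> R) \<le> card (Q \<inter> R)" "card P \<le> card Q"
        using that by (auto intro!: card_mono)
      moreover have "card (Q - P) = card Q - card P" using that fP by (simp add: card_Diff_subset)
      ultimately show ?thesis by (simp add: abs_le_iff)
    qed
    show ?thesis using *[of P Q] *[of Q P] that by (auto simp: abs_minus_commute)
  qed
  have "\<bar>real (card (A \<inter> B)) - real (card (A' \<inter> B))\<bar> \<le> \<bar>real (card A) - real (card A')\<bar>"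
    using 1[OF fin(1,2) nested(1)] .
  moreover have "\<bar>real (card (A' \<inter> B)) - real (card (A' \<inter> B'))\<bar> \<le> \<bar>real (card B) - real (card B')\<bar>"
    using 1[OF fin(3,4) nested(2), of A'] by (simp add: Int_commute)
  ultimately show ?thesis by linarith
qed

text \<open>The rank set at u has between (n + 1)u - 1 and (n + 1)u elements, hence differs from n u
  by at most 1; the two coordinates together give the 2.\<close>

lemma emp_copula_minus_level_le:
  assumes inj: "inj_on x {1..n}" "inj_on y {1..n}" and uv: "0 < u" "u < 1" "0 < v" "v < 1"
  shows "\<bar>real n * emp_copula n x y u v - real (card (level_set n x u \<inter> level_set n y v))\<bar>
    \<le> \<bar>real (card (level_set n x u)) - real n * u\<bar> + \<bar>real (card (level_set n y v)) - real n * v\<bar> + 2"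
proof -
  note c = card_rank_set[OF inj(1) uv(1,2)] card_rank_set[OF inj(2) uv(3,4)]
  have "\<bar>real n * emp_copula n x y u v - real (card (level_set n x u \<inter> level_set n y v))\<bar>
     \<le> \<bar>real (card (rank_set n x u)) - real (card (level_set n x u))\<bar>
      + \<bar>real (card (rank_set n y v)) - real (card (level_set n y v))\<bar>"
    unfolding emp_copula_eq_card by (intro card_Int_diff_le rank_level_nested) auto
  moreover have "\<bar>real (card (rank_set n x u)) - real n * u\<bar> \<le> 1"
    "\<bar>real (card (rank_set n y v)) - real n * v\<bar> \<le> 1"
    using c uv by (auto simp: abs_le_iff algebra_simps)
  ultimately show ?thesis by linarith
qed

section \<open>A finite grid of local shifts\<close>

definition grid :: "real \<Rightarrow> real set" where
  "grid \<epsilon> = (\<lambda>k. \<epsilon> * of_int k) ` {- \<lceil>1 / \<epsilon>\<^sup>2\<rceil> - 2 .. \<lceil>1 / \<epsilon>\<^sup>2\<rceil> + 2}"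

lemma finite_grid [simp]: "finite (grid \<epsilon>)"
  by (simp add: grid_def)

text \<open>The grid reaches beyond 1/\<epsilon> on both sides, so one further step can be taken
  after rounding k/\<epsilon> up or down. The distance of at least \<epsilon> leaves a margin for
  stochastic errors; the distance of at most 2\<epsilon> keeps the loss small.\<close>

lemma grid_approx:
  assumes "\<epsilon> > 0" "\<bar>k\<bar> \<le> 1 / \<epsilon>"
  obtains s s' where "s \<in> grid \<epsilon>" "k + \<epsilon> \<le> s" "s \<le> k + 2 * \<epsilon>"
    "s' \<in> grid \<epsilon>" "k - 2 * \<epsilon> \<le> s'" "s' \<le> k - \<epsilon>"
proof
  have "\<bar>k / \<epsilon>\<bar> \<le> 1 / \<epsilon>\<^sup>2"
    using assms by (simp add: power2_eq_square field_simps)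
  then have b: "- (1 / \<epsilon>\<^sup>2) \<le> k / \<epsilon>" "k / \<epsilon> \<le> 1 / \<epsilon>\<^sup>2" by linarith+
  then have "- \<lceil>1 / \<epsilon>\<^sup>2\<rceil> - 2 \<le> \<lceil>k / \<epsilon>\<rceil> + 1" "\<lceil>k / \<epsilon>\<rceil> + 1 \<le> \<lceil>1 / \<epsilon>\<^sup>2\<rceil> + 2"
     "- \<lceil>1 / \<epsilon>\<^sup>2\<rceil> - 2 \<le> \<lfloor>k / \<epsilon>\<rfloor> - 1" "\<lfloor>k / \<epsilon>\<rfloor> - 1 \<le> \<lceil>1 / \<epsilon>\<^sup>2\<rceil> + 2"
    by linarith+
  then show "\<epsilon> * of_int (\<lceil>k / \<epsilon>\<rceil> + 1) \<in> grid \<epsilon>" "\<epsilon> * of_int (\<lfloor>k / \<epsilon>\<rfloor> - 1) \<in> grid \<epsilon>"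
    unfolding grid_def by (auto intro!: imageI simp del: of_int_add of_int_diff)
  have k: "k = \<epsilon> * (k / \<epsilon>)" using assms by simp
  have m: "\<epsilon> * a \<le> \<epsilon> * b" if "a \<le> b" for a b using that assms by simp
  show "k + \<epsilon> \<le> \<epsilon> * of_int (\<lceil>k / \<epsilon>\<rceil> + 1)"
    using m[of "k / \<epsilon> + 1" "of_int (\<lceil>k / \<epsilon>\<rceil> + 1)"] k by (simp add: distrib_left)
  show "\<epsilon> * of_int (\<lceil>k / \<epsilon>\<rceil> + 1) \<le> k + 2 * \<epsilon>"
    using m[of "of_int (\<lceil>k / \<epsilon>\<rceil> + 1)" "k / \<epsilon> + 2"] k of_int_ceiling_le_add_one[of "k / \<epsilon>"]
    by (simp add: distrib_left)
  show "k - 2 * \<epsilon> \<le> \<epsilon> * of_int (\<lfloor>k / \<epsilon>\<rfloor> - 1)"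
    using m[of "k / \<epsilon> - 2" "of_int (\<lfloor>k / \<epsilon>\<rfloor> - 1)"] k real_of_int_floor_add_one_ge[of "k / \<epsilon>"]
    by (simp add: right_diff_distrib)
  show "\<epsilon> * of_int (\<lfloor>k / \<epsilon>\<rfloor> - 1) \<le> k - \<epsilon>"
    using m[of "of_int (\<lfloor>k / \<epsilon>\<rfloor> - 1)" "k / \<epsilon> - 1"] k by (simp add: right_diff_distrib)
qed

text \<open>No local increments appear on the right: this bound is used off the favourable event of
  the sharper estimate, and it supplies an integrable majorant of the remainder.\<close>

lemma emp_copula_linearization_crude:
  fixes x y :: "nat \<Rightarrow> real" and n :: nat
  defines "N \<equiv> \<lambda>a. real (card (level_set n x a))" and "N' \<equiv> \<lambda>b. real (card (level_set n y b))"
    and "J \<equiv> \<lambda>a b. real (card (level_set n x a \<inter> level_set n y b))" and "r \<equiv> sqrt (real n)"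
  assumes inj: "inj_on x {1..n}" "inj_on y {1..n}" and uv: "0 < u" "u < 1" "0 < v" "v < 1"
    and pq: "\<bar>p\<bar> \<le> K" "\<bar>q\<bar> \<le> K" and n: "n \<ge> 1"
  defines "\<kappa> \<equiv> (N u - real n * u) / r" and "\<kappa>' \<equiv> (N' v - real n * v) / r"
  shows "\<bar>(real n * emp_copula n x y u v - J u v) / r + p * \<kappa> + q * \<kappa>'\<bar>
    \<le> (K + 1) * (\<bar>\<kappa>\<bar> + \<bar>\<kappa>'\<bar>) + 2"
proof -
  have r: "r \<ge> 1" "r > 0" using n unfolding r_def by auto
  have "\<bar>(real n * emp_copula n x y u v - J u v) / r\<bar> \<le> (\<bar>N u - real n * u\<bar> + \<bar>N' v - real n * v\<bar> + 2) / r"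
    using emp_copula_minus_level_le[OF inj uv] r
    by (simp add: J_def N_def N'_def divide_right_mono)
  also have "\<dots> = \<bar>\<kappa>\<bar> + \<bar>\<kappa>'\<bar> + 2 / r" using r by (simp add: \<kappa>_def \<kappa>'_def add_divide_distrib)
  also have "\<dots> \<le> \<bar>\<kappa>\<bar> + \<bar>\<kappa>'\<bar> + 2" using r by (simp add: divide_le_eq)
  finally have 1: "\<bar>(real n * emp_copula n x y u v - J u v) / r\<bar> \<le> \<bar>\<kappa>\<bar> + \<bar>\<kappa>'\<bar> + 2" .
  have "\<bar>p * \<kappa>\<bar> \<le> K * \<bar>\<kappa>\<bar>" "\<bar>q * \<kappa>'\<bar> \<le> K * \<bar>\<kappa>'\<bar>"
    using pq by (simp_all add: abs_mult mult_right_mono)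
  moreover have "(K + 1) * (\<bar>\<kappa>\<bar> + \<bar>\<kappa>'\<bar>) + 2 = K * \<bar>\<kappa>\<bar> + K * \<bar>\<kappa>'\<bar> + (\<bar>\<kappa>\<bar> + \<bar>\<kappa>'\<bar> + 2)" by (simp add: algebra_simps)
  ultimately show ?thesis using 1 by linarith
qed

text \<open>Writing \<open>\<kappa>\<close> for the normalised marginal empirical process at \<open>u\<close>, the rank set at \<open>u\<close> is
  squeezed between level sets at \<open>u + s/\<surd>n\<close> for grid points \<open>s\<close> close to \<open>-\<kappa>\<close>; by monotonicity
  only finitely many values of the local empirical process need to be controlled, and this is
  done by \<open>E\<close>. The remaining terms on the right account for the event that \<open>E\<close>, \<open>\<kappa>\<close> or \<open>\<kappa>'\<close> is large.\<close>

lemma emp_copula_linearization: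
  fixes x y :: "nat \<Rightarrow> real" and n :: nat
  defines "N \<equiv> \<lambda>a. real (card (level_set n x a))" and "N' \<equiv> \<lambda>b. real (card (level_set n y b))"
    and "J \<equiv> \<lambda>a b. real (card (level_set n x a \<inter> level_set n y b))" and "r \<equiv> sqrt (real n)"
  assumes inj: "inj_on x {1..n}" "inj_on y {1..n}" and uv: "0 < u" "u < 1" "0 < v" "v < 1"
    and pq: "\<bar>p\<bar> \<le> K" "\<bar>q\<bar> \<le> K" and \<epsilon>: "\<epsilon> > 0" "2 \<le> \<epsilon> * r" and n: "n \<ge> 1"
    and \<kappa>: "\<kappa> = (N u - real n * u) / r" "\<kappa>' = (N' v - real n * v) / r"
    and E: "E = (\<Sum>s\<in>grid \<epsilon>. \<Sum>t\<in>grid \<epsilon>. \<bar>(J (u + s / r) (v + t / r) - J u v) / r - (p * s + q * t)\<bar>)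
      + (\<Sum>s\<in>grid \<epsilon>. \<bar>(N (u + s / r) - N u) / r - s\<bar>)
      + (\<Sum>t\<in>grid \<epsilon>. \<bar>(N' (v + t / r) - N' v) / r - t\<bar>)"
  shows "\<bar>(real n * emp_copula n x y u v - J u v) / r + p * \<kappa> + q * \<kappa>'\<bar>
    \<le> (4 * K + 1) * \<epsilon> + \<epsilon> * ((K + 1) * (\<bar>\<kappa>\<bar> + \<bar>\<kappa>'\<bar>) + 2)\<^sup>2 + 2 * E / \<epsilon>\<^sup>2 + \<epsilon> * (\<kappa>\<^sup>2 + \<kappa>'\<^sup>2)"
    (is "\<bar>?R\<bar> \<le> _ + \<epsilon> * ?B\<^sup>2 + _ + _")
proof -
  have r: "r \<ge> 1" "r * r = real n" "r > 0" using n unfolding r_def by auto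
  have K: "K \<ge> 0" using pq by linarith
  define E1 where "E1 s t = \<bar>(J (u + s / r) (v + t / r) - J u v) / r - (p * s + q * t)\<bar>" for s t
  define E2 where "E2 s = \<bar>(N (u + s / r) - N u) / r - s\<bar>" for s
  define E3 where "E3 t = \<bar>(N' (v + t / r) - N' v) / r - t\<bar>" for t
  have E': "E = (\<Sum>s\<in>grid \<epsilon>. \<Sum>t\<in>grid \<epsilon>. E1 s t) + (\<Sum>s\<in>grid \<epsilon>. E2 s) + (\<Sum>t\<in>grid \<epsilon>. E3 t)"
    by (simp add: E E1_def E2_def E3_def)
  have nonneg: "0 \<le> E1 s t" "0 \<le> E2 s" "0 \<le> E3 t" for s t
    by (auto simp: E1_def E2_def E3_def)
  have sums: "0 \<le> (\<Sum>s\<in>grid \<epsilon>. \<Sum>t\<in>grid \<epsilon>. E1 s t)" "0 \<le> (\<Sum>s\<in>grid \<epsilon>. E2 s)" "0 \<le> (\<Sum>t\<in>grid \<epsilon>. E3 t)"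
    using nonneg by (auto intro!: sum_nonneg)
  then have "E \<ge> 0" by (simp add: E')
  have le: "E1 s t \<le> E" "E2 s \<le> E" "E3 t \<le> E" if "s \<in> grid \<epsilon>" "t \<in> grid \<epsilon>" for s t
  proof -
    have "E1 s t \<le> (\<Sum>t\<in>grid \<epsilon>. E1 s t)" using that nonneg by (intro member_le_sum) auto
    also have "\<dots> \<le> (\<Sum>s\<in>grid \<epsilon>. \<Sum>t\<in>grid \<epsilon>. E1 s t)"
      using that nonneg by (intro member_le_sum[where f = "\<lambda>s. \<Sum>t\<in>grid \<epsilon>. E1 s t"]) (auto intro: sum_nonneg)
    finally show "E1 s t \<le> E" using sums by (simp add: E')
    have "E2 s \<le> (\<Sum>s\<in>grid \<epsilon>. E2 s)" using that nonneg by (intro member_le_sum) auto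
    then show "E2 s \<le> E" using sums by (simp add: E')
    have "E3 t \<le> (\<Sum>t\<in>grid \<epsilon>. E3 t)" using that nonneg by (intro member_le_sum) auto
    then show "E3 t \<le> E" using sums by (simp add: E')
  qed
  have crude: "\<bar>?R\<bar> \<le> ?B"
    using emp_copula_linearization_crude[OF inj uv pq n]
    unfolding \<kappa> r_def J_def N_def N'_def .
  show ?thesis
  \<comment> \<open>The favourable event: each local increment is within \<epsilon>/2 of its
    linearisation, and -\<kappa> and -\<kappa>' lie in the range covered by the grid.\<close>
  proof (cases "E \<le> \<epsilon> / 2 \<and> \<bar>\<kappa>\<bar> \<le> 1 / \<epsilon> \<and> \<bar>\<kappa>'\<bar> \<le> 1 / \<epsilon>")
    case True
    obtain s s' where s: "s \<in> grid \<epsilon>" "- \<kappa> + \<epsilon> \<le> s" "s \<le> - \<kappa> + 2 * \<epsilon>"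
      "s' \<in> grid \<epsilon>" "- \<kappa> - 2 * \<epsilon> \<le> s'" "s' \<le> - \<kappa> - \<epsilon>"
      using grid_approx[OF \<epsilon>(1), of "- \<kappa>"] True by auto
    obtain t t' where t: "t \<in> grid \<epsilon>" "- \<kappa>' + \<epsilon> \<le> t" "t \<le> - \<kappa>' + 2 * \<epsilon>"
      "t' \<in> grid \<epsilon>" "- \<kappa>' - 2 * \<epsilon> \<le> t'" "t' \<le> - \<kappa>' - \<epsilon>"
      using grid_approx[OF \<epsilon>(1), of "- \<kappa>'"] True by auto
    have Nu: "N u = real n * u + \<kappa> * r" "N' v = real n * v + \<kappa>' * r" using r by (simp_all add: \<kappa>)
    have expand: "c = b + z * r" if "(c - b) / r = z" for b c z
      using that r by (simp add: field_simps)
    define z where "z = (N (u + s / r) - N u) / r"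
    define z' where "z' = (N (u + s' / r) - N u) / r"
    define w where "w = (N' (v + t / r) - N' v) / r"
    define w' where "w' = (N' (v + t' / r) - N' v) / r"
    have zz: "\<bar>z - s\<bar> \<le> \<epsilon> / 2" "\<bar>z' - s'\<bar> \<le> \<epsilon> / 2" "\<bar>w - t\<bar> \<le> \<epsilon> / 2" "\<bar>w' - t'\<bar> \<le> \<epsilon> / 2"
      using le(2)[of s t] le(2)[of s' t] le(3)[of s t] le(3)[of s t'] s t True
      by (auto simp: E2_def E3_def z_def z'_def w_def w'_def)
    \<comment> \<open>A gap of at least \<epsilon> less an error of at most \<epsilon>/2 leaves
      \<epsilon>/2, and r times this is at least 1 by \<open>2 \<le> \<epsilon> * r\<close>. One
      whole count is enough to pass from n u to (n + 1)u upwards and to (n + 1)u - 1 downwards, as 0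
      < u < 1.\<close>
    have key: "1 \<le> (\<kappa> + z) * r" "(\<kappa> + z') * r \<le> -1" "1 \<le> (\<kappa>' + w) * r" "(\<kappa>' + w') * r \<le> -1"
    proof -
      have h: "1 \<le> c * r" if "c \<ge> \<epsilon> / 2" for c
      proof -
        have "\<epsilon> / 2 * r \<le> c * r" using that r by (intro mult_right_mono) auto
        then show ?thesis using \<epsilon> by linarith
      qed
      have "\<kappa> + z \<ge> \<epsilon> / 2" "- (\<kappa> + z') \<ge> \<epsilon> / 2" "\<kappa>' + w \<ge> \<epsilon> / 2" "- (\<kappa>' + w') \<ge> \<epsilon> / 2"
        using zz s t by linarith+
      from this[THEN h] show "1 \<le> (\<kappa> + z) * r" "(\<kappa> + z') * r \<le> -1" "1 \<le> (\<kappa>' + w) * r" "(\<kappa>' + w') * r \<le> -1"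
        by linarith+
    qed
    have N: "N (u + s / r) = real n * u + (\<kappa> + z) * r" "N (u + s' / r) = real n * u + (\<kappa> + z') * r"
       "N' (v + t / r) = real n * v + (\<kappa>' + w) * r" "N' (v + t' / r) = real n * v + (\<kappa>' + w') * r"
      using expand[OF z_def[symmetric]] expand[OF z'_def[symmetric]] expand[OF w_def[symmetric]]
        expand[OF w'_def[symmetric]] Nu by (simp_all add: distrib_right)
    have up: "real n * emp_copula n x y u v \<le> J (u + s / r) (v + t / r)"
      unfolding J_def using N key uv
      by (intro emp_copula_sandwich(2)[OF inj uv]) (auto simp: N_def N'_def distrib_right)
    have low: "J (u + s' / r) (v + t' / r) \<le> real n * emp_copula n x y u v"
      unfolding J_def using N key uv
      by (intro emp_copula_sandwich(1)[OF inj uv]) (auto simp: N_def N'_def distrib_right)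
    \<comment> \<open>The grid points are within 2\<epsilon> of -\<kappa> and -\<kappa>'. Two such
      terms and the error \<epsilon>/2 account for (4K + 1)\<epsilon>.\<close>
    have pb: "\<bar>p * (s + \<kappa>)\<bar> \<le> K * (2 * \<epsilon>)" "\<bar>p * (s' + \<kappa>)\<bar> \<le> K * (2 * \<epsilon>)"
        "\<bar>q * (t + \<kappa>')\<bar> \<le> K * (2 * \<epsilon>)" "\<bar>q * (t' + \<kappa>')\<bar> \<le> K * (2 * \<epsilon>)"
      unfolding abs_mult using pq K s t \<epsilon> by (auto intro!: mult_mono simp: abs_le_iff)
    have e1: "E1 s t \<le> \<epsilon> / 2" "E1 s' t' \<le> \<epsilon> / 2" using le(1) s t True by force+
    have "?R \<le> (J (u + s / r) (v + t / r) - J u v) / r + p * \<kappa> + q * \<kappa>'"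
      using up r by (simp add: divide_right_mono)
    also have "\<dots> \<le> p * s + q * t + \<epsilon> / 2 + p * \<kappa> + q * \<kappa>'"
      using e1(1) unfolding E1_def by linarith
    also have "\<dots> = p * (s + \<kappa>) + q * (t + \<kappa>') + \<epsilon> / 2" by (simp add: algebra_simps)
    also have "\<dots> \<le> (4 * K + 1) * \<epsilon>" using pb \<epsilon> by (simp add: algebra_simps abs_le_iff)
    finally have A: "?R \<le> (4 * K + 1) * \<epsilon>" .
    have "- ((4 * K + 1) * \<epsilon>) \<le> p * (s' + \<kappa>) + q * (t' + \<kappa>') - \<epsilon> / 2"
      using pb \<epsilon> by (simp add: algebra_simps abs_le_iff)
    also have "\<dots> = p * s' + q * t' - \<epsilon> / 2 + p * \<kappa> + q * \<kappa>'" by (simp add: algebra_simps)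
    also have "\<dots> \<le> (J (u + s' / r) (v + t' / r) - J u v) / r + p * \<kappa> + q * \<kappa>'"
      using e1(2) unfolding E1_def by linarith
    also have "\<dots> \<le> ?R" using low r by (simp add: divide_right_mono)
    finally have B: "- ((4 * K + 1) * \<epsilon>) \<le> ?R" .
    have "0 \<le> \<epsilon> * ?B\<^sup>2" "0 \<le> 2 * E / \<epsilon>\<^sup>2" "0 \<le> \<epsilon> * (\<kappa>\<^sup>2 + \<kappa>'\<^sup>2)"
      using \<epsilon> \<open>E \<ge> 0\<close> by auto
    then show ?thesis using A B by linarith
  next
    case False
    \<comment> \<open>Off the favourable event E or one of the marginal processes is large, and the
      matching Markov or Chebyshev term alone reaches 1/\<epsilon>.\<close>
    have "1 / \<epsilon> \<le> 2 * E / \<epsilon>\<^sup>2 + \<epsilon> * (\<kappa>\<^sup>2 + \<kappa>'\<^sup>2)"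
    proof -
      have sq: "1 / \<epsilon> \<le> \<epsilon> * k\<^sup>2" if "\<bar>k\<bar> > 1 / \<epsilon>" for k
      proof -
        have "(1 / \<epsilon>)\<^sup>2 \<le> k\<^sup>2" using that \<epsilon> by (metis abs_le_square_iff abs_of_pos less_imp_le zero_less_divide_1_iff)
        then have "\<epsilon> * (1 / \<epsilon>)\<^sup>2 \<le> \<epsilon> * k\<^sup>2" using \<epsilon> by simp
        then show ?thesis using \<epsilon> by (simp add: power2_eq_square)
      qed
      have "1 / \<epsilon> \<le> 2 * E / \<epsilon>\<^sup>2" if "E > \<epsilon> / 2"
        using that \<epsilon> by (simp add: power2_eq_square field_simps)
      moreover have "0 \<le> 2 * E / \<epsilon>\<^sup>2" "0 \<le> \<epsilon> * \<kappa>\<^sup>2" "0 \<le> \<epsilon> * \<kappa>'\<^sup>2" using \<epsilon> \<open>E \<ge> 0\<close> by auto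
      ultimately show ?thesis
        using False sq[of \<kappa>] sq[of \<kappa>'] unfolding distrib_left by linarith
    qed
    \<comment> \<open>A weighted arithmetic-geometric mean inequality. It separates the crude bound
      from the bad event, so that expectations can later be taken term by term.\<close>
    moreover have "?B \<le> \<epsilon> * ?B\<^sup>2 + 1 / \<epsilon>"
    proof -
      have "0 \<le> (\<epsilon> * ?B - 1)\<^sup>2 + \<epsilon> * ?B"
        using \<epsilon> K by (intro add_nonneg_nonneg mult_nonneg_nonneg) auto
      then have "\<epsilon> * ?B \<le> \<epsilon> * (\<epsilon> * ?B\<^sup>2) + 1"
        by (simp add: power2_eq_square algebra_simps)
      then have "?B \<le> (\<epsilon> * (\<epsilon> * ?B\<^sup>2) + 1) / \<epsilon>" using \<epsilon>
        by (simp add: pos_le_divide_eq mult.commute)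
      then show ?thesis using \<epsilon> by (simp add: add_divide_distrib)
    qed
    moreover have "0 \<le> (4 * K + 1) * \<epsilon>" using K \<epsilon> by simp
    ultimately show ?thesis using crude by linarith
  qed
qed

section \<open>Empirical processes of a sample from a copula\<close>

text \<open>Events over a finite K are carried to the image of K by the inverse of f, where the
  product formula is known; injectivity keeps the factors apart. This serves to renumber the sample
  from 0 and to single out two observations.\<close>

lemma (in prob_space) indep_sets_reindex_inj:
  assumes "indep_sets F I" "inj_on f J" "f ` J \<subseteq> I"
  shows "indep_sets (\<lambda>j. F (f j)) J"
proof (rule indep_setsI)
  fix j assume "j \<in> J"
  then show "F (f j) \<subseteq> events" using assms by (auto simp: indep_sets_def)
next
  fix A K assume K: "K \<noteq> {}" "K \<subseteq> J" "finite K" "\<forall>j\<in>K. A j \<in> F (f j)"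
  define A' where "A' i = A (the_inv_into J f i)" for i
  have A': "A' (f j) = A j" if "j \<in> K" for j
    using the_inv_into_f_f[OF assms(2)] K(2) that by (auto simp: A'_def)
  have "prob (\<Inter>i\<in>f ` K. A' i) = (\<Prod>i\<in>f ` K. prob (A' i))"
  proof (rule indep_setsD[OF assms(1)])
    show "f ` K \<subseteq> I" using K(2) assms(3) by blast
  qed (use K A' in auto)
  moreover have "inj_on f K" using assms(2) K(2) inj_on_subset by blast
  ultimately show "prob (\<Inter>j\<in>K. A j) = (\<Prod>j\<in>K. prob (A j))"
    using A' by (simp add: prod.reindex)
qed

lemma (in prob_space) indep_vars_reindex_inj:
  assumes "indep_vars M' X I" "inj_on f J" "f ` J \<subseteq> I"
  shows "indep_vars (\<lambda>j. M' (f j)) (\<lambda>j. X (f j)) J"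
  using assms indep_sets_reindex_inj[of "\<lambda>i. {X i -` A \<inter> space M |A. A \<in> sets (M' i)}" I f J]
  by (auto simp: indep_vars_def2)

text \<open>The Cauchy-Schwarz bound, in the form that the variance of the absolute value of g is
  nonnegative.\<close>

lemma (in prob_space) expectation_abs_le_sqrt:
  fixes g :: "'a \<Rightarrow> real"
  assumes [measurable]: "g \<in> borel_measurable M" and "integrable M (\<lambda>\<omega>. (g \<omega>)\<^sup>2)"
    and "expectation (\<lambda>\<omega>. (g \<omega>)\<^sup>2) \<le> c"
  shows "integrable M g" "expectation (\<lambda>\<omega>. \<bar>g \<omega>\<bar>) \<le> sqrt c"
proof -
  show 1: "integrable M g" by (rule square_integrable_imp_integrable[OF assms(1,2)])
  have "0 \<le> variance (\<lambda>\<omega>. \<bar>g \<omega>\<bar>)" by (rule variance_positive)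
  also have "\<dots> = expectation (\<lambda>\<omega>. (g \<omega>)\<^sup>2) - (expectation (\<lambda>\<omega>. \<bar>g \<omega>\<bar>))\<^sup>2"
    using 1 assms by (subst variance_eq) auto
  finally show "expectation (\<lambda>\<omega>. \<bar>g \<omega>\<bar>) \<le> sqrt c"
    using assms(3) by (intro real_le_rsqrt) linarith
qed

text \<open>For observations in the unit square, r = (u, 1) and r = (1, v) give the marginal
  indicators, so joint and marginal counts belong to one family.\<close>

definition quadrant :: "real \<times> real \<Rightarrow> real \<times> real \<Rightarrow> real" where
  "quadrant r z = of_bool (fst z \<le> fst r \<and> snd z \<le> snd r)"

lemma quadrant_measurable [measurable]: "quadrant r \<in> borel_measurable borel"
proof -
  have "{z. fst z \<le> fst r \<and> snd z \<le> snd r} = {..fst r} \<times> {..snd r}" by auto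
  then have "closed {z :: real \<times> real. fst z \<le> fst r \<and> snd z \<le> snd r}"
    by (simp add: closed_Times)
  then have [measurable]: "{z :: real \<times> real. fst z \<le> fst r \<and> snd z \<le> snd r} \<in> sets borel" by simp
  have "quadrant r = indicator {z. fst z \<le> fst r \<and> snd z \<le> snd r}"
    by (auto simp: quadrant_def indicator_def fun_eq_iff)
  then show ?thesis by simp
qed

lemma quadrant_bounds: "0 \<le> quadrant r z" "quadrant r z \<le> 1" "\<bar>quadrant r z\<bar> \<le> 1"
  by (auto simp: quadrant_def)

text \<open>Mixed moments of quadrants thus reduce to values of the copula at coordinatewise minima,
  the shape of the bridge covariance.\<close>

lemma quadrant_mult: "quadrant r z * quadrant s z = quadrant (min (fst r) (fst s), min (snd r) (snd s)) z"
  by (auto simp: quadrant_def)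

text \<open>The situation after the probability integral transform. \<open>unit\<close> is asked for
  at every outcome, so that marginal counts are quadrant counts at 1 exactly and not just almost
  surely.\<close>

locale copula_sample = prob_space M for M :: "'a measure" +
  fixes U V :: "nat \<Rightarrow> 'a \<Rightarrow> real" and C :: "real \<Rightarrow> real \<Rightarrow> real"
  assumes indep: "indep_vars (\<lambda>_. borel) (\<lambda>i \<omega>. (U i \<omega>, V i \<omega>)) {1..}"
    and ident: "\<And>i. i \<ge> 1 \<Longrightarrow>
      distr M borel (\<lambda>\<omega>. (U i \<omega>, V i \<omega>)) = distr M borel (\<lambda>\<omega>. (U 1 \<omega>, V 1 \<omega>))"
    and cdf: "\<And>a b. a \<in> {0..1} \<Longrightarrow> b \<in> {0..1} \<Longrightarrow>
      prob {\<omega> \<in> space M. U 1 \<omega> \<le> a \<and> V 1 \<omega> \<le> b} = C a b"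
    and unit: "\<And>i \<omega>. U i \<omega> \<in> {0..1}" "\<And>i \<omega>. V i \<omega> \<in> {0..1}"
    and margins: "\<And>a. a \<in> {0..1} \<Longrightarrow> C a 1 = a" "\<And>b. b \<in> {0..1} \<Longrightarrow> C 1 b = b"
    and partials: "continuous_partials C"
begin

definition Z :: "nat \<Rightarrow> 'a \<Rightarrow> real \<times> real" where
  "Z i \<omega> = (U i \<omega>, V i \<omega>)"

definition \<nu> :: "(real \<times> real) measure" where
  "\<nu> = distr M borel (Z 1)"

lemma Z_measurable: "i \<ge> 1 \<Longrightarrow> Z i \<in> borel_measurable M"
  using indep by (simp add: indep_vars_def Z_def[abs_def])

lemma U_measurable: "i \<ge> 1 \<Longrightarrow> U i \<in> borel_measurable M"
  and V_measurable: "i \<ge> 1 \<Longrightarrow> V i \<in> borel_measurable M"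
proof -
  assume "i \<ge> 1"
  have "fst \<in> borel_measurable (borel :: (real \<times> real) measure)" "snd \<in> borel_measurable (borel :: (real \<times> real) measure)"
    by (intro borel_measurable_continuous_onI continuous_intros)+
  from this[THEN measurable_compose[OF Z_measurable[OF \<open>i \<ge> 1\<close>]]]
  show "U i \<in> borel_measurable M" "V i \<in> borel_measurable M" by (auto simp: Z_def)
qed

lemma Z_law: "i \<ge> 1 \<Longrightarrow> distr M borel (Z i) = \<nu>"
  using ident[of i] by (simp add: \<nu>_def Z_def[abs_def])

lemma prob_space_\<nu>: "prob_space \<nu>"
  unfolding \<nu>_def by (rule prob_space_distr) (simp add: Z_measurable)

sublocale \<nu>: prob_space \<nu> by (rule prob_space_\<nu>)

lemma sets_\<nu> [simp, measurable_cong]: "sets \<nu> = sets borel"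
  and space_\<nu> [simp]: "space \<nu> = UNIV"
  by (simp_all add: \<nu>_def)

lemma \<nu>_integrable:
  fixes f :: "real \<times> real \<Rightarrow> real"
  assumes [measurable]: "f \<in> borel_measurable borel" and "\<And>z. \<bar>f z\<bar> \<le> B"
  shows "integrable \<nu> f"
  using assms(2) by (intro \<nu>.integrable_const_bound[of _ B]) auto

lemma expectation_Z:
  fixes f :: "real \<times> real \<Rightarrow> real"
  assumes [measurable]: "f \<in> borel_measurable borel" and "i \<ge> 1"
  shows "expectation (\<lambda>\<omega>. f (Z i \<omega>)) = \<integral>z. f z \<partial>\<nu>"
  using Z_law[OF \<open>i \<ge> 1\<close>] by (metis assms(1) Z_measurable[OF \<open>i \<ge> 1\<close>] integral_distr)

text \<open>The empirical process sqrt n (P_n - P) indexed by functions. It is linear on integrable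
  functions, so a combination over finitely many points is its value at a single function. For n = 0
  the division by \<open>sqrt 0\<close> gives 0.\<close>

definition emp :: "(real \<times> real \<Rightarrow> real) \<Rightarrow> nat \<Rightarrow> 'a \<Rightarrow> real" where
  "emp f n \<omega> = ((\<Sum>i=1..n. f (Z i \<omega>)) - real n * (\<integral>z. f z \<partial>\<nu>)) / sqrt (real n)"

lemma emp_eq: "emp f n \<omega> = (\<Sum>i=1..n. f (Z i \<omega>) - (\<integral>z. f z \<partial>\<nu>)) / sqrt (real n)"
  by (simp add: emp_def sum_subtractf)

lemma emp_measurable:
  assumes [measurable]: "f \<in> borel_measurable borel"
  shows "emp f n \<in> borel_measurable M"
proof -
  have "(\<lambda>\<omega>. f (Z i \<omega>)) \<in> borel_measurable M" if "i \<in> {1..n}" for i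
    using measurable_compose[OF Z_measurable assms, of i] that by simp
  then show ?thesis unfolding emp_def[abs_def] by (intro borel_measurable_divide borel_measurable_diff borel_measurable_sum) auto
qed

lemma centred_moments:
  fixes f :: "real \<times> real \<Rightarrow> real"
  assumes [measurable]: "f \<in> borel_measurable borel" and bound: "\<And>z. \<bar>f z\<bar> \<le> B" and "i \<ge> 1"
  defines "\<xi> \<equiv> \<lambda>\<omega>. f (Z i \<omega>) - (\<integral>z. f z \<partial>\<nu>)"
  shows "integrable M (\<lambda>\<omega>. (\<xi> \<omega>)\<^sup>2)" "expectation \<xi> = 0"
    "expectation (\<lambda>\<omega>. (\<xi> \<omega>)\<^sup>2) = (\<integral>z. (f z - (\<integral>z. f z \<partial>\<nu>))\<^sup>2 \<partial>\<nu>)"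
proof -
  have meas: "(\<lambda>z. f z - \<nu>.expectation f) \<in> borel_measurable borel"
    "(\<lambda>z. (f z - \<nu>.expectation f)\<^sup>2) \<in> borel_measurable borel" by measurable
  have "\<bar>(f z - \<nu>.expectation f)\<^sup>2\<bar> \<le> (B + \<bar>\<nu>.expectation f\<bar>)\<^sup>2" for z
    unfolding abs_power2 by (subst abs_le_square_iff[symmetric]) (use bound[of z] in linarith)
  then have "integrable \<nu> (\<lambda>z. (f z - \<nu>.expectation f)\<^sup>2)" by (rule \<nu>_integrable[OF meas(2)])
  then show "integrable M (\<lambda>\<omega>. (\<xi> \<omega>)\<^sup>2)"
    using Z_law[OF \<open>i \<ge> 1\<close>] integrable_distr_eq[OF Z_measurable[OF \<open>i \<ge> 1\<close>] meas(2)] by (simp add: \<xi>_def)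
  show "expectation \<xi> = 0"
    unfolding \<xi>_def using expectation_Z[OF meas(1) \<open>i \<ge> 1\<close>] \<nu>_integrable[OF assms(1) bound]
    by (simp add: \<nu>.prob_space[simplified])
  show "expectation (\<lambda>\<omega>. (\<xi> \<omega>)\<^sup>2) = (\<integral>z. (f z - (\<integral>z. f z \<partial>\<nu>))\<^sup>2 \<partial>\<nu>)"
    unfolding \<xi>_def by (rule expectation_Z[OF meas(2) \<open>i \<ge> 1\<close>])
qed

text \<open>Independence reduces the second moment to an average of variances, each at most the raw
  second moment of f. The bound is free of n, and the later estimates uniform in n rest on
  it.\<close>

lemma emp_square:
  assumes [measurable]: "f \<in> borel_measurable borel" and bound: "\<And>z. \<bar>f z\<bar> \<le> B"
  shows "integrable M (\<lambda>\<omega>. (emp f n \<omega>)\<^sup>2)" "expectation (\<lambda>\<omega>. (emp f n \<omega>)\<^sup>2) \<le> (\<integral>z. (f z)\<^sup>2 \<partial>\<nu>)"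
proof -
  define \<xi> where "\<xi> i \<omega> = f (Z i \<omega>) - (\<integral>z. f z \<partial>\<nu>)" for i \<omega>
  have f2: "\<bar>(f z)\<^sup>2\<bar> \<le> B\<^sup>2" for z using bound[of z] by (simp add: abs_le_square_iff[symmetric])
  have int: "integrable \<nu> f" "integrable \<nu> (\<lambda>z. (f z)\<^sup>2)"
    by (rule \<nu>_integrable[OF assms]) (rule \<nu>_integrable[OF _ f2], measurable)
  have indep': "indep_vars (\<lambda>_. borel) \<xi> {1..n}"
    unfolding \<xi>_def
    by (rule indep_vars_compose2[where X = Z and M' = "\<lambda>_. borel", OF indep_vars_subset[of _ _ "{1..}"]])
       (use indep in \<open>auto simp: Z_def[abs_def]\<close>)
  have var: "expectation (\<lambda>\<omega>. (\<xi> i \<omega>)\<^sup>2) \<le> (\<integral>z. (f z)\<^sup>2 \<partial>\<nu>)" if "i \<in> {1..n}" for i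
  proof -
    have "expectation (\<lambda>\<omega>. (\<xi> i \<omega>)\<^sup>2) = \<nu>.variance f"
      unfolding \<xi>_def using that by (intro centred_moments(3)[OF assms]) simp
    also have "\<dots> \<le> (\<integral>z. (f z)\<^sup>2 \<partial>\<nu>)" by (subst \<nu>.variance_eq[OF int]) simp
    finally show ?thesis .
  qed
  have "integrable M (\<lambda>\<omega>. (\<xi> i \<omega>)\<^sup>2)" "expectation (\<xi> i) = 0" if "i \<in> {1..n}" for i
    unfolding \<xi>_def using that by (intro centred_moments[OF assms]; simp)+
  note S = expectation_square_sum_indep[OF _ indep' this]
  have e: "(emp f n \<omega>)\<^sup>2 = (\<Sum>i=1..n. \<xi> i \<omega>)\<^sup>2 / real n" for \<omega>
    by (simp add: emp_eq \<xi>_def power_divide)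
  show "integrable M (\<lambda>\<omega>. (emp f n \<omega>)\<^sup>2)" unfolding e using S(1) by auto
  have "expectation (\<lambda>\<omega>. (emp f n \<omega>)\<^sup>2) = (\<Sum>i=1..n. expectation (\<lambda>\<omega>. (\<xi> i \<omega>)\<^sup>2)) / real n"
    unfolding e using S(2) by simp
  also have "\<dots> \<le> (\<Sum>i=1..n. (\<integral>z. (f z)\<^sup>2 \<partial>\<nu>)) / real n"
    using var by (intro divide_right_mono sum_mono) auto
  also have "\<dots> \<le> (\<integral>z. (f z)\<^sup>2 \<partial>\<nu>)" by (cases "n = 0") auto
  finally show "expectation (\<lambda>\<omega>. (emp f n \<omega>)\<^sup>2) \<le> (\<integral>z. (f z)\<^sup>2 \<partial>\<nu>)" .
qed

lemma emp_abs:
  assumes "f \<in> borel_measurable borel" "\<And>z. \<bar>f z\<bar> \<le> B"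
  shows "integrable M (emp f n)" "expectation (\<lambda>\<omega>. \<bar>emp f n \<omega>\<bar>) \<le> sqrt (\<integral>z. (f z)\<^sup>2 \<partial>\<nu>)"
  using expectation_abs_le_sqrt[OF emp_measurable[OF assms(1)] emp_square[OF assms]] by auto

text \<open>The sample is numbered from 1 and the summands of the central limit theorem from 0,
  hence the shift by \<open>Suc\<close>.\<close>

lemma emp_char:
  assumes [measurable]: "f \<in> borel_measurable borel" and bound: "\<And>z. \<bar>f z\<bar> \<le> B"
  shows "(\<lambda>n. \<integral>\<omega>. iexp (emp f n \<omega>) \<partial>M) \<longlonglongrightarrow>
    exp (- (complex_of_real (\<integral>z. (f z - (\<integral>z. f z \<partial>\<nu>))\<^sup>2 \<partial>\<nu>) / 2))"
proof -
  define \<xi> where "\<xi> i \<omega> = f (Z (Suc i) \<omega>) - (\<integral>z. f z \<partial>\<nu>)" for i \<omega>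
  have meas: "(\<lambda>z. f z - \<nu>.expectation f) \<in> borel_measurable borel" by measurable
  have "indep_vars (\<lambda>_. borel) (\<lambda>i. Z (Suc i)) UNIV"
    using indep_vars_reindex_inj[OF indep, of Suc UNIV] by (auto simp: Z_def[abs_def])
  then have indep': "indep_vars (\<lambda>_. borel) \<xi> UNIV"
    unfolding \<xi>_def by (rule indep_vars_compose2) simp
  have moments: "integrable M (\<lambda>\<omega>. (\<xi> i \<omega>)\<^sup>2)" "expectation (\<xi> i) = 0"
    "expectation (\<lambda>\<omega>. (\<xi> i \<omega>)\<^sup>2) = (\<integral>z. (f z - (\<integral>z. f z \<partial>\<nu>))\<^sup>2 \<partial>\<nu>)" for i
    unfolding \<xi>_def by (intro centred_moments[OF assms]; simp)+
  have law: "distr M borel (\<xi> i) = distr \<nu> borel (\<lambda>z. f z - \<nu>.expectation f)" for i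
    unfolding \<xi>_def using distr_distr[OF meas Z_measurable[of "Suc i"]] Z_law[of "Suc i"]
    by (simp add: comp_def cong: distr_cong)
  have "(\<Sum>i=1..n. f (Z i \<omega>) - (\<integral>z. f z \<partial>\<nu>)) = (\<Sum>i<n. \<xi> i \<omega>)" for n \<omega>
    unfolding \<xi>_def by (simp add: sum.atLeast1_atMost_eq lessThan_atLeast0)
  then show ?thesis
    using central_limit_char[OF indep' moments(2,1,3) law] by (simp add: emp_eq)
qed

lemma emp_diff:
  assumes "integrable \<nu> f" "integrable \<nu> g"
  shows "emp (\<lambda>z. f z - g z) n \<omega> = emp f n \<omega> - emp g n \<omega>"
  using assms by (simp add: emp_def sum_subtractf diff_divide_distrib right_diff_distrib)

lemma emp_scale: "emp (\<lambda>z. c * f z) n \<omega> = c * emp f n \<omega>"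
  by (simp add: emp_eq sum_distrib_left algebra_simps)

lemma emp_sum:
  assumes "\<And>g. g \<in> A \<Longrightarrow> integrable \<nu> (f g)"
  shows "emp (\<lambda>z. \<Sum>g\<in>A. f g z) n \<omega> = (\<Sum>g\<in>A. emp (f g) n \<omega>)"
proof -
  have "emp (\<lambda>z. \<Sum>g\<in>A. f g z) n \<omega> = (\<Sum>i=1..n. \<Sum>g\<in>A. f g (Z i \<omega>) - \<nu>.expectation (f g)) / sqrt (real n)"
    using assms by (simp add: emp_eq sum_subtractf)
  also have "\<dots> = (\<Sum>g\<in>A. emp (f g) n \<omega>)"
    by (subst sum.swap) (simp add: emp_eq sum_divide_distrib)
  finally show ?thesis .
qed

subsection \<open>Quadrant indicators\<close>

lemma quadrant_integrable [simp]: "integrable \<nu> (quadrant r)"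
  by (rule \<nu>_integrable[OF quadrant_measurable quadrant_bounds(3)])

lemma integral_quadrant:
  assumes "a \<in> {0..1}" "b \<in> {0..1}"
  shows "(\<integral>z. quadrant (a, b) z \<partial>\<nu>) = C a b"
proof -
  have "(\<integral>z. quadrant (a, b) z \<partial>\<nu>) = expectation (\<lambda>\<omega>. quadrant (a, b) (Z 1 \<omega>))"
    by (rule expectation_Z[symmetric]) auto
  also have "\<dots> = expectation (indicator {\<omega> \<in> space M. U 1 \<omega> \<le> a \<and> V 1 \<omega> \<le> b})"
    by (intro Bochner_Integration.integral_cong) (auto simp: quadrant_def Z_def indicator_def)
  also have "\<dots> = prob {\<omega> \<in> space M. U 1 \<omega> \<le> a \<and> V 1 \<omega> \<le> b}"
    by (simp add: Int_absorb2 Collect_mono_iff subset_iff)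
  finally show ?thesis using cdf[OF assms] by simp
qed

text \<open>A quadrant is the product of its two marginal indicators, so the difference is dominated
  by the sum of the marginal differences. Nested marginal quadrants differ in mean by the distance
  of their endpoints, the margins being uniform.\<close>

lemma integral_abs_quadrant_diff:
  assumes "a \<in> {0..1}" "b \<in> {0..1}" "a' \<in> {0..1}" "b' \<in> {0..1}"
  shows "(\<integral>z. \<bar>quadrant (a, b) z - quadrant (a', b') z\<bar> \<partial>\<nu>) \<le> \<bar>a - a'\<bar> + \<bar>b - b'\<bar>"
proof -
  have nested: "(\<integral>z. \<bar>quadrant r z - quadrant s z\<bar> \<partial>\<nu>) = \<bar>(\<integral>z. quadrant r z \<partial>\<nu>) - (\<integral>z. quadrant s z \<partial>\<nu>)\<bar>"
    if "r \<le> s \<or> s \<le> r" for r s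
  proof -
    have *: "(\<integral>z. \<bar>quadrant r z - quadrant s z\<bar> \<partial>\<nu>) = \<bar>(\<integral>z. quadrant r z \<partial>\<nu>) - (\<integral>z. quadrant s z \<partial>\<nu>)\<bar>"
      if "r \<le> s" for r s
    proof -
      have le: "quadrant r z \<le> quadrant s z" for z
        using that by (auto simp: quadrant_def less_eq_prod_def)
      then have "(\<integral>z. quadrant r z \<partial>\<nu>) \<le> (\<integral>z. quadrant s z \<partial>\<nu>)" by (intro integral_mono) auto
      then show ?thesis using le by (simp add: abs_of_nonpos)
    qed
    show ?thesis using *[of r s] *[of s r] that by (auto simp: abs_minus_commute)
  qed
  have m1: "(\<integral>z. \<bar>quadrant (a, 1) z - quadrant (a', 1) z\<bar> \<partial>\<nu>) = \<bar>a - a'\<bar>"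
    and m2: "(\<integral>z. \<bar>quadrant (1, b) z - quadrant (1, b') z\<bar> \<partial>\<nu>) = \<bar>b - b'\<bar>"
    using assms by (subst nested; auto simp: integral_quadrant margins less_eq_prod_def)+
  have int: "integrable \<nu> (\<lambda>z. \<bar>quadrant r z - quadrant s z\<bar>)" for r s
    by (intro integrable_abs Bochner_Integration.integrable_diff quadrant_integrable)
  have "(\<integral>z. \<bar>quadrant (a, b) z - quadrant (a', b') z\<bar> \<partial>\<nu>)
    \<le> (\<integral>z. \<bar>quadrant (a, 1) z - quadrant (a', 1) z\<bar> + \<bar>quadrant (1, b) z - quadrant (1, b') z\<bar> \<partial>\<nu>)"
    using assms by (intro integral_mono int Bochner_Integration.integrable_add) (auto simp: quadrant_def)
  also have "\<dots> = \<bar>a - a'\<bar> + \<bar>b - b'\<bar>"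
    using assms by (simp add: Bochner_Integration.integral_add[OF int int] m1 m2)
  finally show ?thesis .
qed

lemma sum_quadrant_eq_card:
  "real (card (level_set n (\<lambda>i. U i \<omega>) a \<inter> level_set n (\<lambda>i. V i \<omega>) b)) = (\<Sum>i=1..n. quadrant (a, b) (Z i \<omega>))"
  "real (card (level_set n (\<lambda>i. U i \<omega>) a)) = (\<Sum>i=1..n. quadrant (a, 1) (Z i \<omega>))"
  "real (card (level_set n (\<lambda>i. V i \<omega>) b)) = (\<Sum>i=1..n. quadrant (1, b) (Z i \<omega>))"
proof -
  have "level_set n (\<lambda>i. U i \<omega>) a \<inter> level_set n (\<lambda>i. V i \<omega>) b = {1..n} \<inter> {i. U i \<omega> \<le> a \<and> V i \<omega> \<le> b}" for a b
    by (auto simp: level_set_def)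
  then have *: "real (card (level_set n (\<lambda>i. U i \<omega>) a \<inter> level_set n (\<lambda>i. V i \<omega>) b)) = (\<Sum>i=1..n. quadrant (a, b) (Z i \<omega>))" for a b
    by (simp add: quadrant_def Z_def)
  then show "real (card (level_set n (\<lambda>i. U i \<omega>) a \<inter> level_set n (\<lambda>i. V i \<omega>) b)) = (\<Sum>i=1..n. quadrant (a, b) (Z i \<omega>))" .
  have full: "level_set n (\<lambda>i. U i \<omega>) 1 = {1..n}" "level_set n (\<lambda>i. V i \<omega>) 1 = {1..n}"
    using unit by (auto simp: level_set_def)
  have sub: "level_set n x c \<subseteq> {1..n}" for x c by (auto simp: level_set_def)
  show "real (card (level_set n (\<lambda>i. U i \<omega>) a)) = (\<Sum>i=1..n. quadrant (a, 1) (Z i \<omega>))"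
    "real (card (level_set n (\<lambda>i. V i \<omega>) b)) = (\<Sum>i=1..n. quadrant (1, b) (Z i \<omega>))"
    unfolding *[symmetric] full using sub by (simp_all add: Int_absorb1 Int_absorb2)
qed

text \<open>A difference of indicators takes the values -1, 0 and 1, so its square is its absolute
  value, and the L1 distance of quadrants bounds the second moment of the fluctuation. The drift is
  compared with l separately.\<close>

lemma expectation_increment_le:
  fixes n :: nat and l :: real
  assumes "a \<in> {0..1}" "b \<in> {0..1}" "a' \<in> {0..1}" "b' \<in> {0..1}"
  defines "D \<equiv> \<lambda>\<omega>. ((\<Sum>i=1..n. quadrant (a, b) (Z i \<omega>)) - (\<Sum>i=1..n. quadrant (a', b') (Z i \<omega>))) / sqrt (real n) - l"
  shows "integrable M D"
    "expectation (\<lambda>\<omega>. \<bar>D \<omega>\<bar>) \<le> sqrt (\<bar>a - a'\<bar> + \<bar>b - b'\<bar>) + \<bar>sqrt (real n) * (C a b - C a' b') - l\<bar>"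
proof -
  define f where "f z = quadrant (a, b) z - quadrant (a', b') z" for z
  have fm: "f \<in> borel_measurable borel" unfolding f_def[abs_def] by measurable
  have fb: "\<bar>f z\<bar> \<le> 1" for z by (auto simp: f_def quadrant_def)
  define c where "c = sqrt (real n) * (C a b - C a' b') - l"
  have D: "D \<omega> = emp f n \<omega> + c" for \<omega>
  proof -
    have q: "(\<integral>z. f z \<partial>\<nu>) = C a b - C a' b'"
      unfolding f_def using assms(1-4) by (simp add: integral_quadrant)
    have n: "real n * x / sqrt (real n) = sqrt (real n) * x" for x
      using real_div_sqrt[of "real n"] by (metis of_nat_0_le_iff times_divide_eq_left)
    show ?thesis
      unfolding D_def emp_def q diff_divide_distrib n c_def by (simp add: f_def sum_subtractf diff_divide_distrib)
  qed
  note e = emp_abs[OF fm fb, of n]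
  show "integrable M D" using e(1) by (simp add: D[abs_def])
  have "(\<integral>z. (f z)\<^sup>2 \<partial>\<nu>) = (\<integral>z. \<bar>quadrant (a, b) z - quadrant (a', b') z\<bar> \<partial>\<nu>)"
    by (intro Bochner_Integration.integral_cong) (auto simp: f_def quadrant_def)
  also have "\<dots> \<le> \<bar>a - a'\<bar> + \<bar>b - b'\<bar>" by (rule integral_abs_quadrant_diff) fact+
  finally have f2: "(\<integral>z. (f z)\<^sup>2 \<partial>\<nu>) \<le> \<bar>a - a'\<bar> + \<bar>b - b'\<bar>" .
  have "expectation (\<lambda>\<omega>. \<bar>D \<omega>\<bar>) \<le> expectation (\<lambda>\<omega>. \<bar>emp f n \<omega>\<bar> + \<bar>c\<bar>)"
    unfolding D using e(1) by (intro integral_mono integrable_abs Bochner_Integration.integrable_add) auto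
  also have "\<dots> = expectation (\<lambda>\<omega>. \<bar>emp f n \<omega>\<bar>) + \<bar>c\<bar>"
    using e(1) by (subst Bochner_Integration.integral_add) (auto simp: prob_space)
  also have "\<dots> \<le> sqrt (\<bar>a - a'\<bar> + \<bar>b - b'\<bar>) + \<bar>c\<bar>"
    using e(2) f2 by (meson add_right_mono order_trans real_sqrt_le_mono)
  finally show "expectation (\<lambda>\<omega>. \<bar>D \<omega>\<bar>) \<le> sqrt (\<bar>a - a'\<bar> + \<bar>b - b'\<bar>) + \<bar>sqrt (real n) * (C a b - C a' b') - l\<bar>"
    unfolding c_def .
qed

end

section \<open>Linearisation of the empirical copula process\<close>

lemma inverse_sqrt_tendsto: "(\<lambda>n. c / sqrt (real n)) \<longlonglongrightarrow> 0"
  by (intro tendsto_divide_0[OF tendsto_const] filterlim_at_top_imp_at_infinity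
      filterlim_compose[OF sqrt_at_top filterlim_real_sequentially])

text \<open>All arguments may vary with x, which covers measurability in the sample, in the point of
  the square, and jointly in both.\<close>

lemma emp_copula_measurable:
  fixes X Y :: "nat \<Rightarrow> 'b \<Rightarrow> real"
  assumes X: "\<And>i. i \<ge> 1 \<Longrightarrow> X i \<in> borel_measurable L" and Y: "\<And>i. i \<ge> 1 \<Longrightarrow> Y i \<in> borel_measurable L"
    and [measurable]: "a \<in> borel_measurable L" "b \<in> borel_measurable L"
  shows "(\<lambda>x. emp_copula n (\<lambda>i. X i x) (\<lambda>i. Y i x) (a x) (b x)) \<in> borel_measurable L"
proof -
  have r: "(\<lambda>x. pseudo_obs n (\<lambda>i. X i x) i) \<in> borel_measurable L"
    if X: "\<And>i. i \<ge> 1 \<Longrightarrow> X i \<in> borel_measurable L" and "i \<in> {1..n}" for X :: "nat \<Rightarrow> 'b \<Rightarrow> real" and i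
  proof -
    have e: "real (rank n (\<lambda>i. X i x) i) = (\<Sum>j=1..n. of_bool (X j x \<le> X i x))" for x
      unfolding rank_def by (simp add: Int_def)
    have "(\<lambda>x. of_bool (X j x \<le> X i x) :: real) \<in> borel_measurable L" if "j \<in> {1..n}" for j
    proof -
      have [measurable]: "X j \<in> borel_measurable L" "X i \<in> borel_measurable L"
        using X that \<open>i \<in> {1..n}\<close> by auto
      show ?thesis by measurable
    qed
    then show ?thesis unfolding pseudo_obs_def e by (intro borel_measurable_divide borel_measurable_sum) auto
  qed
  have "(\<lambda>x. of_bool (pseudo_obs n (\<lambda>i. X i x) i \<le> a x \<and> pseudo_obs n (\<lambda>i. Y i x) i \<le> b x) :: real) \<in> borel_measurable L"
    if "i \<in> {1..n}" for i
  proof -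
    note [measurable] = r[OF X that] r[OF Y that]
    show ?thesis by measurable
  qed
  then show ?thesis unfolding emp_copula_def by (intro borel_measurable_times borel_measurable_sum) auto
qed

context copula_sample
begin

lemma partials_bounded:
  "\<exists>K\<ge>0. \<forall>u\<in>{0..1}. \<forall>v\<in>{0..1}. \<bar>partial1 C u v\<bar> \<le> K \<and> \<bar>partial2 C u v\<bar> \<le> K"
proof -
  have c: "compact unit_square" by (intro compact_Times compact_Icc)
  have "bounded ((\<lambda>(u, v). partial1 C u v) ` unit_square)" "bounded ((\<lambda>(u, v). partial2 C u v) ` unit_square)"
    using partials c by (auto simp: continuous_partials_def intro!: compact_imp_bounded compact_continuous_image)
  then obtain A B where A: "\<forall>x\<in>(\<lambda>(u, v). partial1 C u v) ` unit_square. norm x \<le> A"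
    and B: "\<forall>x\<in>(\<lambda>(u, v). partial2 C u v) ` unit_square. norm x \<le> B"
    unfolding bounded_iff by blast
  show ?thesis
  proof (intro exI[of _ "max 0 (max A B)"] conjI ballI)
    fix u v :: real assume uv: "u \<in> {0..1}" "v \<in> {0..1}"
    then have "\<bar>partial1 C u v\<bar> \<le> A" using A by (auto intro!: bexI[of _ "(u, v)"] simp: image_iff)
    then show "\<bar>partial1 C u v\<bar> \<le> max 0 (max A B)" by simp
    have "\<bar>partial2 C u v\<bar> \<le> B" using B uv by (auto intro!: bexI[of _ "(u, v)"] simp: image_iff)
    then show "\<bar>partial2 C u v\<bar> \<le> max 0 (max A B)" by simp
  qed simp
qed

text \<open>Selected once, by compactness of the square, so that later definitions can mention
  it.\<close>

definition K :: real where
  "K = (SOME K. K \<ge> 0 \<and> (\<forall>u\<in>{0..1}. \<forall>v\<in>{0..1}. \<bar>partial1 C u v\<bar> \<le> K \<and> \<bar>partial2 C u v\<bar> \<le> K))"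

lemma K_nonneg: "K \<ge> 0"
  and partial1_le: "u \<in> {0..1} \<Longrightarrow> v \<in> {0..1} \<Longrightarrow> \<bar>partial1 C u v\<bar> \<le> K"
  and partial2_le: "u \<in> {0..1} \<Longrightarrow> v \<in> {0..1} \<Longrightarrow> \<bar>partial2 C u v\<bar> \<le> K"
  using someI_ex[OF partials_bounded] unfolding K_def[symmetric] by blast+

text \<open>Continuous partial derivatives give a total derivative in the interior; this is its
  value in the direction (s, t), reached along the steps 1 / sqrt n.\<close>

lemma copula_increment_tendsto:
  assumes uv: "0 < u" "u < 1" "0 < v" "v < 1"
  shows "(\<lambda>n. sqrt (real n) * (C (u + s / sqrt (real n)) (v + t / sqrt (real n)) - C u v))
    \<longlonglongrightarrow> partial1 C u v * s + partial2 C u v * t"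
proof -
  let ?I = "{0<..<1::real}"
  have in_I: "u \<in> ?I" "v \<in> ?I" using uv by auto
  have d1: "((\<lambda>x. C x v) has_derivative (\<lambda>h. h * partial1 C u v)) (at u within ?I)"
  proof -
    have "((\<lambda>x. C x v) has_derivative (\<lambda>h. partial1 C u v * h)) (at u within {0..1})"
      using partials uv unfolding continuous_partials_def has_field_derivative_def by auto
    then have "((\<lambda>x. C x v) has_derivative (\<lambda>h. partial1 C u v * h)) (at u within ?I)"
      by (rule has_derivative_subset) auto
    then show ?thesis by (simp add: mult.commute)
  qed
  \<comment> \<open>The criterion for total differentiability takes the derivative in the second
    variable as a continuous family of bounded linear maps.\<close>
  have d2: "((\<lambda>y. C x y) has_derivative blinfun_apply (blinfun_scaleR_left (partial2 C x y))) (at y within ?I)"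
    if "x \<in> ?I" "y \<in> ?I" for x y
  proof -
    have "((\<lambda>y. C x y) has_derivative (\<lambda>h. partial2 C x y * h)) (at y within {0..1})"
      using partials that unfolding continuous_partials_def has_field_derivative_def by auto
    then have "((\<lambda>y. C x y) has_derivative (\<lambda>h. partial2 C x y * h)) (at y within ?I)"
      by (rule has_derivative_subset) auto
    moreover have "blinfun_apply (blinfun_scaleR_left (partial2 C x y)) = (\<lambda>h. partial2 C x y * h)"
      by (auto simp: mult.commute)
    ultimately show ?thesis by simp
  qed
  have "continuous_on (?I \<times> ?I) (\<lambda>(x, y). partial2 C x y)"
    using partials unfolding continuous_partials_def by (auto intro: continuous_on_subset)
  then have "continuous (at (u, v) within ?I \<times> ?I) (\<lambda>(x, y). partial2 C x y)"
    using in_I by (auto simp: continuous_on_eq_continuous_within)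
  from bounded_linear.continuous[OF bounded_linear_blinfun_scaleR_left this]
  have "continuous (at (u, v) within ?I \<times> ?I) (\<lambda>(x, y). blinfun_scaleR_left (partial2 C x y))"
    by (simp add: case_prod_beta')
  from has_derivative_partialsI[OF d1 d2 this in_I(2)]
  have "((\<lambda>(x, y). C x y) has_derivative (\<lambda>(h, k). h * partial1 C u v + k * partial2 C u v)) (at (u, v) within ?I \<times> ?I)"
    by simp
  moreover have "open (?I \<times> ?I)" "(u, v) \<in> ?I \<times> ?I" using in_I by (auto intro: open_Times)
  ultimately have D: "((\<lambda>(x, y). C x y) has_derivative (\<lambda>(h, k). h * partial1 C u v + k * partial2 C u v)) (at (u, v))"
    using at_within_open by metis
  have g: "((\<lambda>h. (u + h * s, v + h * t)) has_derivative (\<lambda>h. (h * s, h * t))) (at 0)"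
    by (auto intro!: derivative_eq_intros)
  have "((\<lambda>h. C (u + h * s) (v + h * t)) has_derivative (\<lambda>h. (h * s) * partial1 C u v + (h * t) * partial2 C u v)) (at 0)"
    using has_derivative_compose[OF g, of "\<lambda>(x, y). C x y" "\<lambda>(h, k). h * partial1 C u v + k * partial2 C u v"] D
    by simp
  then have "DERIV (\<lambda>h. C (u + h * s) (v + h * t)) 0 :> partial1 C u v * s + partial2 C u v * t"
    unfolding has_field_derivative_def
    by (rule has_derivative_eq_rhs) (auto simp: algebra_simps)
  then have lim: "((\<lambda>h. (C (u + h * s) (v + h * t) - C u v) / h) \<longlongrightarrow> partial1 C u v * s + partial2 C u v * t) (at 0)"
    by (simp add: DERIV_def)
  have "filterlim (\<lambda>n. 1 / sqrt (real n)) (at 0) sequentially"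
    using inverse_sqrt_tendsto[of 1] by (auto simp: filterlim_at intro: eventually_sequentiallyI[of 1])
  from filterlim_compose[OF lim this] show ?thesis
    by (simp add: mult.commute divide_inverse)
qed

text \<open>The fluctuation vanishes because the two points merge, and the drift tends to l. A
  shifted point is in the square only for large n, hence the eventual quantifiers.\<close>

lemma expectation_increment_tendsto:
  assumes uv: "u \<in> {0..1}" "v \<in> {0..1}"
    and ev: "\<forall>\<^sub>F n in sequentially. a n \<in> {0..1} \<and> b n \<in> {0..1}"
    and ab: "a \<longlonglongrightarrow> u" "b \<longlonglongrightarrow> v"
    and lim: "(\<lambda>n. sqrt (real n) * (C (a n) (b n) - C u v)) \<longlonglongrightarrow> l"
  defines "D \<equiv> \<lambda>n \<omega>. \<bar>((\<Sum>i=1..n. quadrant (a n, b n) (Z i \<omega>)) - (\<Sum>i=1..n. quadrant (u, v) (Z i \<omega>))) / sqrt (real n) - l\<bar>"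
  shows "\<forall>\<^sub>F n in sequentially. integrable M (D n)" "(\<lambda>n. expectation (D n)) \<longlonglongrightarrow> 0"
proof -
  show "\<forall>\<^sub>F n in sequentially. integrable M (D n)"
    using ev unfolding D_def
    by eventually_elim (intro integrable_abs expectation_increment_le; use uv in simp)
  have "(\<lambda>n. sqrt (\<bar>a n - u\<bar> + \<bar>b n - v\<bar>) + \<bar>sqrt (real n) * (C (a n) (b n) - C u v) - l\<bar>)
      \<longlonglongrightarrow> sqrt (\<bar>u - u\<bar> + \<bar>v - v\<bar>) + \<bar>l - l\<bar>"
    by (intro tendsto_intros ab lim)
  then have B: "(\<lambda>n. sqrt (\<bar>a n - u\<bar> + \<bar>b n - v\<bar>) + \<bar>sqrt (real n) * (C (a n) (b n) - C u v) - l\<bar>) \<longlonglongrightarrow> 0"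
    by simp
  show "(\<lambda>n. expectation (D n)) \<longlonglongrightarrow> 0"
  proof (rule tendsto_sandwich[OF _ _ tendsto_const B])
    show "\<forall>\<^sub>F n in sequentially. 0 \<le> expectation (D n)"
      by (intro always_eventually allI Bochner_Integration.integral_nonneg) (simp add: D_def)
    show "\<forall>\<^sub>F n in sequentially. expectation (D n) \<le>
        sqrt (\<bar>a n - u\<bar> + \<bar>b n - v\<bar>) + \<bar>sqrt (real n) * (C (a n) (b n) - C u v) - l\<bar>"
      using ev unfolding D_def
      by eventually_elim (intro expectation_increment_le; use uv in simp)
  qed
qed

text \<open>The influence function of the empirical copula at r: the formula of the limit process
  with quadrants in place of the bridge.\<close>

definition lin :: "real \<times> real \<Rightarrow> real \<times> real \<Rightarrow> real" where
  "lin r z = quadrant r z - partial1 C (fst r) (snd r) * quadrant (fst r, 1) z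
     - partial2 C (fst r) (snd r) * quadrant (1, snd r) z"

definition remainder :: "real \<times> real \<Rightarrow> nat \<Rightarrow> 'a \<Rightarrow> real" where
  "remainder r n \<omega> = sqrt (real n) *
     (emp_copula n (\<lambda>i. U i \<omega>) (\<lambda>i. V i \<omega>) (fst r) (snd r) - C (fst r) (snd r)) - emp (lin r) n \<omega>"

abbreviation emp_cop :: "nat \<Rightarrow> 'a \<Rightarrow> real \<Rightarrow> real \<Rightarrow> real" where
  "emp_cop n \<omega> \<equiv> emp_copula n (\<lambda>i. U i \<omega>) (\<lambda>i. V i \<omega>)"

lemma emp_lin: "emp (lin r) n \<omega> = emp (quadrant r) n \<omega> - partial1 C (fst r) (snd r) * emp (quadrant (fst r, 1)) n \<omega>
     - partial2 C (fst r) (snd r) * emp (quadrant (1, snd r)) n \<omega>"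
  unfolding lin_def[abs_def] by (simp add: emp_diff emp_scale)

text \<open>By independence the two coordinates have a product law, and Fubini's theorem reduces the
  claim to the absence of atoms in a uniform margin. The parameter h treats both coordinates at
  once.\<close>

lemma AE_distinct_pair:
  assumes ij: "i \<ge> 1" "j \<ge> 1" "i \<noteq> j" 
    and h: "h = fst \<or> h = snd"
  shows "AE \<omega> in M. h (Z i \<omega>) \<noteq> h (Z j \<omega>)"
proof -
  have hm [measurable]: "h \<in> borel_measurable (borel :: (real \<times> real) measure)"
    using h by (auto intro!: borel_measurable_continuous_onI continuous_intros)
  \<comment> \<open>Two indices become a family over the booleans, the form in which
    \<open>indep_var\<close> is defined; \<open>i \<noteq> j\<close> makes the reindexing
    injective.\<close>
  have "indep_vars (\<lambda>_. borel) (\<lambda>b. Z (case_bool i j b)) UNIV"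
  proof -
    have "inj (case_bool i j)" using ij by (auto simp: inj_def split: bool.splits)
    moreover have "range (case_bool i j) \<subseteq> {1..}" using ij by (auto split: bool.splits)
    ultimately show ?thesis
      using indep_vars_reindex_inj[OF indep, of "case_bool i j" UNIV] by (simp only: Z_def[abs_def])
  qed
  then have "indep_vars (\<lambda>_. borel) (\<lambda>b \<omega>. h (Z (case_bool i j b) \<omega>)) UNIV"
    by (rule indep_vars_compose2) simp
  moreover have "(\<lambda>b \<omega>. h (Z (case_bool i j b) \<omega>)) = case_bool (\<lambda>\<omega>. h (Z i \<omega>)) (\<lambda>\<omega>. h (Z j \<omega>))"
    by (auto split: bool.splits simp: fun_eq_iff)
  moreover have "(\<lambda>_. borel) = case_bool borel (borel :: real measure)"
    by (auto split: bool.splits simp: fun_eq_iff)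
  ultimately have ind: "indep_var borel (\<lambda>\<omega>. h (Z i \<omega>)) borel (\<lambda>\<omega>. h (Z j \<omega>))"
    by (simp add: indep_var_def)
  let ?P = "distr M borel (\<lambda>\<omega>. h (Z i \<omega>))" and ?Q = "distr M borel (\<lambda>\<omega>. h (Z j \<omega>))"
  have m: "(\<lambda>\<omega>. h (Z i \<omega>)) \<in> borel_measurable M" "(\<lambda>\<omega>. h (Z j \<omega>)) \<in> borel_measurable M"
    using measurable_compose[OF Z_measurable hm] ij by auto
  interpret P: prob_space ?P by (rule prob_space_distr) (rule m)
  interpret Q: prob_space ?Q by (rule prob_space_distr) (rule m)
  interpret PQ: pair_prob_space ?P ?Q ..
  \<comment> \<open>The uniform distribution function on the whole line: outside [0, 1] it comes
    from \<open>unit\<close>, inside from \<open>margins\<close>.\<close>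
  have level: "prob {\<omega> \<in> space M. h (Z j \<omega>) \<le> c} = max 0 (min 1 c)" for c
  proof -
    have h01: "h (Z j \<omega>) \<in> {0..1}" for \<omega> using h unit by (auto simp: Z_def)
    consider "c < 0" | "c > 1" | "c \<in> {0..1}" by force
    then show ?thesis
    proof cases
      case 1
      then have "\<not> h (Z j \<omega>) \<le> c" for \<omega> using h01[of \<omega>] by simp
      then show ?thesis using 1 by simp
    next
      case 2
      then have "h (Z j \<omega>) \<le> c" for \<omega> using h01[of \<omega>] by simp
      then show ?thesis using 2 by (simp add: prob_space)
    next
      case 3
      define r where "r = (if h = fst then (c, 1) else (1, c))"
      have "expectation (\<lambda>\<omega>. quadrant r (Z j \<omega>)) = expectation (indicator {\<omega> \<in> space M. h (Z j \<omega>) \<le> c})"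
        using h unit
        by (intro Bochner_Integration.integral_cong) (auto simp: r_def quadrant_def Z_def indicator_def)
      moreover have "{\<omega> \<in> space M. h (Z j \<omega>) \<le> c} \<inter> space M = {\<omega> \<in> space M. h (Z j \<omega>) \<le> c}" by auto
      moreover have "expectation (\<lambda>\<omega>. quadrant r (Z j \<omega>)) = c"
        using expectation_Z[OF quadrant_measurable ij(2), of r] 3
        by (auto simp: r_def integral_quadrant margins split: if_splits)
      ultimately show ?thesis using 3 by simp
    qed
  qed
  have atom: "AE \<omega> in M. x \<noteq> h (Z j \<omega>)" for x
  proof -
    have ev: "{\<omega> \<in> space M. h (Z j \<omega>) = x} \<in> events" "{\<omega> \<in> space M. h (Z j \<omega>) \<le> c} \<in> events" for c
      using m(2) by measurable
    \<comment> \<open>The atom at x lies in the strip from x - d to x, whose probability is at most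
      d.\<close>
    have "prob {\<omega> \<in> space M. h (Z j \<omega>) = x} \<le> 0"
    proof (rule field_le_epsilon)
      fix d :: real assume "d > 0"
      have "prob {\<omega> \<in> space M. h (Z j \<omega>) = x} \<le> prob ({\<omega> \<in> space M. h (Z j \<omega>) \<le> x} - {\<omega> \<in> space M. h (Z j \<omega>) \<le> x - d})"
        using \<open>d > 0\<close> ev(2) by (intro finite_measure_mono) auto
      also have "\<dots> = max 0 (min 1 x) - max 0 (min 1 (x - d))"
        using \<open>d > 0\<close> ev(2) by (subst finite_measure_Diff) (auto simp: level)
      also have "\<dots> \<le> 0 + d" using \<open>d > 0\<close> by linarith
      finally show "prob {\<omega> \<in> space M. h (Z j \<omega>) = x} \<le> 0 + d" .
    qed
    then have "prob {\<omega> \<in> space M. h (Z j \<omega>) = x} = 0" by (simp only: measure_le_0_iff)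
    then have "AE \<omega> in M. \<omega> \<notin> {\<omega> \<in> space M. h (Z j \<omega>) = x}" using prob_eq_0[OF ev(1)] by simp
    then show ?thesis by (auto elim!: AE_mp)
  qed
  have "AE z in ?P \<Otimes>\<^sub>M ?Q. fst z \<noteq> snd z"
  proof (rule PQ.AE_pair_measure)
    show "{z \<in> space (?P \<Otimes>\<^sub>M ?Q). fst z \<noteq> snd z} \<in> sets (?P \<Otimes>\<^sub>M ?Q)" by measurable
    show "AE x in ?P. AE y in ?Q. fst (x, y) \<noteq> snd (x, y)"
      using atom m by (auto simp: AE_distr_iff)
  qed
  moreover have "?P \<Otimes>\<^sub>M ?Q = distr M (borel \<Otimes>\<^sub>M borel) (\<lambda>\<omega>. (h (Z i \<omega>), h (Z j \<omega>)))"
    using ind unfolding indep_var_distribution_eq by blast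
  ultimately have "AE z in distr M (borel \<Otimes>\<^sub>M borel) (\<lambda>\<omega>. (h (Z i \<omega>), h (Z j \<omega>))). fst z \<noteq> snd z"
    by (simp only:)
  then show ?thesis using m by (subst (asm) AE_distr_iff) auto
qed

lemma AE_distinct: "AE \<omega> in M. inj_on (\<lambda>i. U i \<omega>) {1..n} \<and> inj_on (\<lambda>i. V i \<omega>) {1..n}"
proof -
  have "AE \<omega> in M. i \<noteq> j \<longrightarrow> fst (Z i \<omega>) \<noteq> fst (Z j \<omega>) \<and> snd (Z i \<omega>) \<noteq> snd (Z j \<omega>)"
    if "i \<in> {1..n}" "j \<in> {1..n}" for i j
    using AE_distinct_pair[of i j fst] AE_distinct_pair[of i j snd] that by (cases "i = j") auto
  then have "AE \<omega> in M. \<forall>i\<in>{1..n}. \<forall>j\<in>{1..n}. i \<noteq> j \<longrightarrow> fst (Z i \<omega>) \<noteq> fst (Z j \<omega>) \<and> snd (Z i \<omega>) \<noteq> snd (Z j \<omega>)"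
    by (intro AE_finite_allI) auto
  then show ?thesis by eventually_elim (auto simp: inj_on_def Z_def)
qed

lemma lin_measurable [measurable]: "lin r \<in> borel_measurable borel"
  unfolding lin_def[abs_def] by measurable

lemma remainder_measurable: "remainder r n \<in> borel_measurable M"
  unfolding remainder_def[abs_def]
  by (intro borel_measurable_times borel_measurable_diff emp_copula_measurable emp_measurable lin_measurable
      U_measurable V_measurable) auto

text \<open>The centring by C u v is common to both processes and cancels; what remains has the
  shape of the combinatorial estimates.\<close>

lemma remainder_eq:
  assumes uv: "0 < u" "u < 1" "0 < v" "v < 1" and "n \<ge> 1"
  shows "remainder (u, v) n \<omega> =
      (real n * emp_cop n \<omega> u v
        - real (card (level_set n (\<lambda>i. U i \<omega>) u \<inter> level_set n (\<lambda>i. V i \<omega>) v))) / sqrt (real n)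
      + partial1 C u v * emp (quadrant (u, 1)) n \<omega> + partial2 C u v * emp (quadrant (1, v)) n \<omega>"
proof -
  have n: "real n * x / sqrt (real n) = sqrt (real n) * x" for x
    using real_div_sqrt[of "real n"] by (metis of_nat_0_le_iff times_divide_eq_left)
  have "emp (quadrant (u, v)) n \<omega> = (\<Sum>i=1..n. quadrant (u, v) (Z i \<omega>)) / sqrt (real n) - sqrt (real n) * C u v"
    using uv by (simp add: emp_def diff_divide_distrib n integral_quadrant)
  then show ?thesis
    unfolding remainder_def emp_lin sum_quadrant_eq_card diff_divide_distrib n
    by (simp add: right_diff_distrib)
qed

lemma emp_quadrant_margin:
  assumes "0 < u" "u < 1"
  shows "emp (quadrant (u, 1)) n \<omega> = (real (card (level_set n (\<lambda>i. U i \<omega>) u)) - real n * u) / sqrt (real n)"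
    "emp (quadrant (1, u)) n \<omega> = (real (card (level_set n (\<lambda>i. V i \<omega>) u)) - real n * u) / sqrt (real n)"
  using assms by (simp_all add: emp_def sum_quadrant_eq_card integral_quadrant margins)

lemma emp_quadrant_moments:
  "integrable M (\<lambda>\<omega>. (emp (quadrant r) n \<omega>)\<^sup>2)" "expectation (\<lambda>\<omega>. (emp (quadrant r) n \<omega>)\<^sup>2) \<le> 1"
  "integrable M (emp (quadrant r) n)" "expectation (\<lambda>\<omega>. \<bar>emp (quadrant r) n \<omega>\<bar>) \<le> 1"
proof -
  note q = quadrant_measurable quadrant_bounds(3)
  have "(\<integral>z. (quadrant r z)\<^sup>2 \<partial>\<nu>) \<le> (\<integral>z. 1 \<partial>\<nu>)"
  proof (intro integral_mono \<nu>_integrable[of _ 1])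
    show "(\<lambda>z. (quadrant r z)\<^sup>2) \<in> borel_measurable borel" by measurable
  qed (auto simp: quadrant_def)
  then have le: "(\<integral>z. (quadrant r z)\<^sup>2 \<partial>\<nu>) \<le> 1" using \<nu>.prob_space by simp
  show "integrable M (\<lambda>\<omega>. (emp (quadrant r) n \<omega>)\<^sup>2)" "expectation (\<lambda>\<omega>. (emp (quadrant r) n \<omega>)\<^sup>2) \<le> 1"
    "integrable M (emp (quadrant r) n)"
    using emp_square[OF q, of r n] emp_abs(1)[OF q, of r n] le by auto
  show "expectation (\<lambda>\<omega>. \<bar>emp (quadrant r) n \<omega>\<bar>) \<le> 1"
    using emp_abs(2)[OF q, of r n] le by (metis order_trans real_sqrt_le_mono real_sqrt_one)
qed

section \<open>The remainder of the linearisation vanishes in mean\<close>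

definition mean_remainder :: "nat \<Rightarrow> real \<times> real \<Rightarrow> real" where
  "mean_remainder n p = expectation (\<lambda>\<omega>. \<bar>remainder p n \<omega>\<bar>)"

lemma mean_remainder_nonneg: "0 \<le> mean_remainder n p"
  by (simp add: mean_remainder_def)

text \<open>The crude bound holds almost surely, ties being null, and each marginal process has mean
  absolute value at most 1; this gives 2(K + 1) + 2. Being independent of n and of the point, the
  constant later serves for dominated convergence.\<close>

lemma remainder_bound:
  assumes uv: "0 < u" "u < 1" "0 < v" "v < 1"
  shows "integrable M (remainder (u, v) n)" "mean_remainder n (u, v) \<le> 2 * K + 4"
proof -
  define B where "B \<omega> = (K + 1) * (\<bar>emp (quadrant (u, 1)) n \<omega>\<bar> + \<bar>emp (quadrant (1, v)) n \<omega>\<bar>) + 2" for \<omega>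
  have le: "AE \<omega> in M. \<bar>remainder (u, v) n \<omega>\<bar> \<le> B \<omega>"
  proof (cases "n = 0")
    \<comment> \<open>For n = 0 the square root is 0 and so is a quotient by it, hence the remainder
      is 0.\<close>
    case True
    then show ?thesis using K_nonneg by (auto simp: remainder_def emp_def B_def)
  next
    case False
    show ?thesis
      using AE_distinct[of n]
    proof eventually_elim
      case (elim \<omega>)
      have "\<bar>partial1 C u v\<bar> \<le> K" "\<bar>partial2 C u v\<bar> \<le> K"
        using uv by (auto intro: partial1_le partial2_le)
      from emp_copula_linearization_crude[OF _ _ uv this, of "\<lambda>i. U i \<omega>" n "\<lambda>i. V i \<omega>"]
      show ?case
        using elim False uv by (simp add: remainder_eq emp_quadrant_margin B_def)
    qed
  qed
  have B: "integrable M B"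
    unfolding B_def[abs_def] using emp_quadrant_moments(3) by auto
  show int: "integrable M (remainder (u, v) n)"
    by (rule Bochner_Integration.integrable_bound[OF B remainder_measurable]) (use le in auto)
  have "mean_remainder n (u, v) \<le> expectation B"
    unfolding mean_remainder_def by (intro integral_mono_AE integrable_abs int B le)
  also have "\<dots> = (K + 1) * (expectation (\<lambda>\<omega>. \<bar>emp (quadrant (u, 1)) n \<omega>\<bar>) + expectation (\<lambda>\<omega>. \<bar>emp (quadrant (1, v)) n \<omega>\<bar>)) + 2"
    unfolding B_def[abs_def] using emp_quadrant_moments(3) by (simp add: prob_space)
  also have "\<dots> \<le> (K + 1) * (1 + 1) + 2"
    using K_nonneg by (intro add_mono mult_left_mono emp_quadrant_moments(4)) auto
  finally show "mean_remainder n (u, v) \<le> 2 * K + 4" by simp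
qed

text \<open>For fixed \<epsilon> the grid is finite and does not move with n, so the mean of its
  total error tends to 0. The other terms have mean at most a constant times \<epsilon>, since the
  marginal processes have second moments at most 1.\<close>

lemma expectation_remainder_tendsto:
  assumes uv: "0 < u" "u < 1" "0 < v" "v < 1"
  shows "(\<lambda>n. mean_remainder n (u, v)) \<longlonglongrightarrow> 0"
proof -
  define p where "p = partial1 C u v"
  define q where "q = partial2 C u v"
  have pq: "\<bar>p\<bar> \<le> K" "\<bar>q\<bar> \<le> K"
    using uv by (auto simp: p_def q_def intro: partial1_le partial2_le)
  let ?r = "\<lambda>n. sqrt (real n)"
  define D where "D a b n \<omega> = (\<Sum>i=1..n. quadrant (a, b) (Z i \<omega>))" for a b n \<omega>
  define E1 where "E1 s t n \<omega> = \<bar>(D (u + s / ?r n) (v + t / ?r n) n \<omega> - D u v n \<omega>) / ?r n - (p * s + q * t)\<bar>" for s t n \<omega>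
  define E2 where "E2 s n \<omega> = \<bar>(D (u + s / ?r n) 1 n \<omega> - D u 1 n \<omega>) / ?r n - s\<bar>" for s n \<omega>
  define E3 where "E3 t n \<omega> = \<bar>(D 1 (v + t / ?r n) n \<omega> - D 1 v n \<omega>) / ?r n - t\<bar>" for t n \<omega>
  have shift: "(\<lambda>n. w + s / ?r n) \<longlonglongrightarrow> w" for w s
    using tendsto_add[OF tendsto_const inverse_sqrt_tendsto, of w s] by simp
  have ev: "\<forall>\<^sub>F n in sequentially. w + s / ?r n \<in> {0..1}" if "0 < w" "w < 1" for w s
    using order_tendstoD(1)[OF shift that(1), of s] order_tendstoD(2)[OF shift that(2), of s]
    by eventually_elim auto
  have lim: "(\<lambda>n. ?r n * ((w + s / ?r n) - w)) \<longlonglongrightarrow> s" for w s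
    by (rule tendsto_eventually, rule eventually_sequentiallyI[of 1]) auto
  have ev1: "\<forall>\<^sub>F n in sequentially. u + s / ?r n \<in> {0..1} \<and> v + t / ?r n \<in> {0..1}" for s t
    using ev[OF uv(1,2), of s] ev[OF uv(3,4), of t] by eventually_elim simp
  have E1: "\<forall>\<^sub>F n in sequentially. integrable M (E1 s t n)" "(\<lambda>n. expectation (E1 s t n)) \<longlonglongrightarrow> 0" for s t
    unfolding E1_def[abs_def] D_def
    using expectation_increment_tendsto[OF _ _ ev1 shift shift copula_increment_tendsto[OF uv], of s t, folded p_def q_def] uv
    by auto
  have lim2: "(\<lambda>n. ?r n * (C (u + s / ?r n) 1 - C u 1)) \<longlonglongrightarrow> s" for s
  proof (rule Lim_transform_eventually[OF lim[of u s]])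
    show "\<forall>\<^sub>F n in sequentially. ?r n * ((u + s / ?r n) - u) = ?r n * (C (u + s / ?r n) 1 - C u 1)"
      using ev[OF uv(1,2), of s] by eventually_elim (use uv in \<open>simp add: margins\<close>)
  qed
  have lim3: "(\<lambda>n. ?r n * (C 1 (v + s / ?r n) - C 1 v)) \<longlonglongrightarrow> s" for s
  proof (rule Lim_transform_eventually[OF lim[of v s]])
    show "\<forall>\<^sub>F n in sequentially. ?r n * ((v + s / ?r n) - v) = ?r n * (C 1 (v + s / ?r n) - C 1 v)"
      using ev[OF uv(3,4), of s] by eventually_elim (use uv in \<open>simp add: margins\<close>)
  qed
  have ev2: "\<forall>\<^sub>F n in sequentially. u + s / ?r n \<in> {0..1} \<and> (1::real) \<in> {0..1}" for s
    using ev[OF uv(1,2), of s] by simp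
  have ev3: "\<forall>\<^sub>F n in sequentially. (1::real) \<in> {0..1} \<and> v + s / ?r n \<in> {0..1}" for s
    using ev[OF uv(3,4), of s] by simp
  have E2: "\<forall>\<^sub>F n in sequentially. integrable M (E2 s n)" "(\<lambda>n. expectation (E2 s n)) \<longlonglongrightarrow> 0" for s
    unfolding E2_def[abs_def] D_def
    using expectation_increment_tendsto[OF _ _ ev2 shift tendsto_const lim2, of s] uv by auto
  have E3: "\<forall>\<^sub>F n in sequentially. integrable M (E3 s n)" "(\<lambda>n. expectation (E3 s n)) \<longlonglongrightarrow> 0" for s
    unfolding E3_def[abs_def] D_def
    using expectation_increment_tendsto[OF _ _ ev3 tendsto_const shift lim3, of s] uv by auto
  \<comment> \<open>The total coefficient of \<epsilon> once both marginal second moments are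
    replaced by their bound 1.\<close>
  define c where "c = (4 * K + 1) + 3 * (2 * (K + 1)\<^sup>2 + 4) + 2"
  have "c > 0" using K_nonneg unfolding c_def by (intro add_pos_pos add_nonneg_pos mult_nonneg_nonneg) (auto intro: add_nonneg_nonneg)
  have main: "\<forall>\<^sub>F n in sequentially. mean_remainder n (u, v) < \<delta>" if "\<delta> > 0" for \<delta>
  proof -
    \<comment> \<open>This makes \<open>c * \<epsilon>\<close> one half of \<delta>; the other half
      is left for the grid error.\<close>
    define \<epsilon> where "\<epsilon> = \<delta> / (2 * c)"
    have "\<epsilon> > 0" using that \<open>c > 0\<close> by (simp add: \<epsilon>_def)
    define E where "E n \<omega> = (\<Sum>s\<in>grid \<epsilon>. \<Sum>t\<in>grid \<epsilon>. E1 s t n \<omega>) + (\<Sum>s\<in>grid \<epsilon>. E2 s n \<omega>) + (\<Sum>t\<in>grid \<epsilon>. E3 t n \<omega>)" for n \<omega>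
    have "\<forall>\<^sub>F n in sequentially. \<forall>s\<in>grid \<epsilon>. \<forall>t\<in>grid \<epsilon>. integrable M (E1 s t n)"
      "\<forall>\<^sub>F n in sequentially. \<forall>s\<in>grid \<epsilon>. integrable M (E2 s n)"
      "\<forall>\<^sub>F n in sequentially. \<forall>s\<in>grid \<epsilon>. integrable M (E3 s n)"
      using E1(1) E2(1) E3(1) by (auto intro!: eventually_ball_finite)
    then have ints: "\<forall>\<^sub>F n in sequentially. integrable M (E n) \<and> expectation (E n) =
       (\<Sum>s\<in>grid \<epsilon>. \<Sum>t\<in>grid \<epsilon>. expectation (E1 s t n)) + (\<Sum>s\<in>grid \<epsilon>. expectation (E2 s n)) + (\<Sum>t\<in>grid \<epsilon>. expectation (E3 t n))"
      unfolding E_def[abs_def] by eventually_elim simp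
    have "(\<lambda>n. (\<Sum>s\<in>grid \<epsilon>. \<Sum>t\<in>grid \<epsilon>. expectation (E1 s t n)) + (\<Sum>s\<in>grid \<epsilon>. expectation (E2 s n)) + (\<Sum>t\<in>grid \<epsilon>. expectation (E3 t n)))
       \<longlonglongrightarrow> (\<Sum>s\<in>grid \<epsilon>. \<Sum>t\<in>grid \<epsilon>. 0) + (\<Sum>s\<in>grid \<epsilon>. 0) + (\<Sum>t\<in>grid \<epsilon>. 0)"
      by (intro tendsto_add tendsto_sum E1(2) E2(2) E3(2))
    then have "(\<lambda>n. (\<Sum>s\<in>grid \<epsilon>. \<Sum>t\<in>grid \<epsilon>. expectation (E1 s t n)) + (\<Sum>s\<in>grid \<epsilon>. expectation (E2 s n)) + (\<Sum>t\<in>grid \<epsilon>. expectation (E3 t n))) \<longlonglongrightarrow> 0"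
      by simp
    then have "(\<lambda>n. expectation (E n)) \<longlonglongrightarrow> 0"
      by (rule Lim_transform_eventually) (use ints in eventually_elim, simp)
    then have "(\<lambda>n. 2 * expectation (E n) / \<epsilon>\<^sup>2) \<longlonglongrightarrow> 0"
      using tendsto_mult_left[of "\<lambda>n. expectation (E n)" 0 sequentially "2 / \<epsilon>\<^sup>2"] by simp
    then have small: "\<forall>\<^sub>F n in sequentially. 2 * expectation (E n) / \<epsilon>\<^sup>2 < \<delta> / 2"
      using that by (intro order_tendstoD) auto
    have "\<forall>\<^sub>F n in sequentially. 2 / \<epsilon> \<le> ?r n"
      using filterlim_compose[OF sqrt_at_top filterlim_real_sequentially] by (simp add: filterlim_at_top)
    then show ?thesis
      using ints small eventually_ge_at_top[of 1]
    proof eventually_elim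
      case (elim n)
      define \<kappa> where "\<kappa> = emp (quadrant (u, 1)) n"
      define \<kappa>' where "\<kappa>' = emp (quadrant (1, v)) n"
      have k: "integrable M (\<lambda>\<omega>. (\<kappa> \<omega>)\<^sup>2)" "integrable M (\<lambda>\<omega>. (\<kappa>' \<omega>)\<^sup>2)"
        "expectation (\<lambda>\<omega>. (\<kappa> \<omega>)\<^sup>2) \<le> 1" "expectation (\<lambda>\<omega>. (\<kappa>' \<omega>)\<^sup>2) \<le> 1"
        using emp_quadrant_moments by (auto simp: \<kappa>_def \<kappa>'_def)
      define B where "B \<omega> = (4 * K + 1) * \<epsilon> + \<epsilon> * (3 * ((K + 1)\<^sup>2 * ((\<kappa> \<omega>)\<^sup>2 + (\<kappa>' \<omega>)\<^sup>2) + 4))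
         + 2 * E n \<omega> / \<epsilon>\<^sup>2 + \<epsilon> * ((\<kappa> \<omega>)\<^sup>2 + (\<kappa>' \<omega>)\<^sup>2)" for \<omega>
      have "2 \<le> \<epsilon> * ?r n" using elim(1) \<open>\<epsilon> > 0\<close> by (simp add: field_simps)
      have "AE \<omega> in M. \<bar>remainder (u, v) n \<omega>\<bar> \<le> B \<omega>"
        using AE_distinct[of n]
      proof eventually_elim
        case (elim \<omega>)
        have "\<bar>remainder (u, v) n \<omega>\<bar> \<le> (4 * K + 1) * \<epsilon> + \<epsilon> * ((K + 1) * (\<bar>\<kappa> \<omega>\<bar> + \<bar>\<kappa>' \<omega>\<bar>) + 2)\<^sup>2
          + 2 * E n \<omega> / \<epsilon>\<^sup>2 + \<epsilon> * ((\<kappa> \<omega>)\<^sup>2 + (\<kappa>' \<omega>)\<^sup>2)"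
          unfolding remainder_eq[OF uv \<open>n \<ge> 1\<close>] p_def[symmetric] q_def[symmetric] \<kappa>_def \<kappa>'_def
          by (rule emp_copula_linearization[OF _ _ uv pq \<open>\<epsilon> > 0\<close> \<open>2 \<le> \<epsilon> * ?r n\<close> \<open>n \<ge> 1\<close>])
            (use elim uv in \<open>auto simp: emp_quadrant_margin E_def E1_def E2_def E3_def D_def sum_quadrant_eq_card(1) sum_quadrant_eq_card(2,3)\<close>)
        moreover have sq: "((K + 1) * (\<bar>\<kappa> \<omega>\<bar> + \<bar>\<kappa>' \<omega>\<bar>) + 2)\<^sup>2 \<le> 3 * ((K + 1)\<^sup>2 * ((\<kappa> \<omega>)\<^sup>2 + (\<kappa>' \<omega>)\<^sup>2) + 4)"
        proof -
          \<comment> \<open>A bound by squares, whose means are controlled; it is the source of the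
            factor 3 in \<open>B\<close> and \<open>c\<close>.\<close>
          have sq3: "(a + b + 2)\<^sup>2 \<le> 3 * (a\<^sup>2 + b\<^sup>2 + 4)" for a b :: real
          proof -
            have "0 \<le> (a - b)\<^sup>2 + (a - 2)\<^sup>2 + (b - 2)\<^sup>2" by simp
            then show ?thesis by (simp add: power2_eq_square algebra_simps)
          qed
          show ?thesis
            using sq3[of "(K + 1) * \<bar>\<kappa> \<omega>\<bar>" "(K + 1) * \<bar>\<kappa>' \<omega>\<bar>"]
            by (simp add: power_mult_distrib distrib_left)
        qed
        ultimately show ?case
          using mult_left_mono[OF sq less_imp_le[OF \<open>\<epsilon> > 0\<close>]] unfolding B_def by linarith
      qed
      moreover have "integrable M B" unfolding B_def[abs_def] using k elim(2) by auto
      ultimately have "mean_remainder n (u, v) \<le> expectation B"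
        using remainder_bound(1)[OF uv] unfolding mean_remainder_def by (intro integral_mono_AE) auto
      also have "\<dots> = (4 * K + 1) * \<epsilon> + \<epsilon> * (3 * ((K + 1)\<^sup>2 * (expectation (\<lambda>\<omega>. (\<kappa> \<omega>)\<^sup>2) + expectation (\<lambda>\<omega>. (\<kappa>' \<omega>)\<^sup>2)) + 4))
         + 2 * expectation (E n) / \<epsilon>\<^sup>2 + \<epsilon> * (expectation (\<lambda>\<omega>. (\<kappa> \<omega>)\<^sup>2) + expectation (\<lambda>\<omega>. (\<kappa>' \<omega>)\<^sup>2))"
        unfolding B_def[abs_def] using k elim(2) by (simp add: prob_space)
      also have "\<dots> \<le> (4 * K + 1) * \<epsilon> + \<epsilon> * (3 * ((K + 1)\<^sup>2 * (1 + 1) + 4))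
         + 2 * expectation (E n) / \<epsilon>\<^sup>2 + \<epsilon> * (1 + 1)"
        using k(3,4) \<open>\<epsilon> > 0\<close> by (intro add_mono mult_left_mono order_refl) auto
      also have "\<dots> = c * \<epsilon> + 2 * expectation (E n) / \<epsilon>\<^sup>2" by (simp add: c_def algebra_simps)
      also have "\<dots> < \<delta>" using elim(3) \<open>c > 0\<close> by (simp add: \<epsilon>_def)
      finally show ?case .
    qed
  qed
  show ?thesis
  proof (rule order_tendstoI)
    fix a :: real assume "a < 0"
    then show "\<forall>\<^sub>F n in sequentially. a < mean_remainder n (u, v)"
      by (intro always_eventually allI less_le_trans[OF \<open>a < 0\<close>] mean_remainder_nonneg)
  qed (rule main)
qed

end

section \<open>Discretisation of the unit square\<close>

text \<open>Open, so that every point has both coordinates strictly between 0 and 1: there rank sets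
  have controlled size and C can be differentiated in every direction.\<close>

definition unit_box :: "(real \<times> real) set" where
  "unit_box = {0<..<1} \<times> {0<..<1}"

definition box_measure :: "(real \<times> real) measure" where
  "box_measure = restrict_space lborel unit_box"

lemma unit_box_measurable [measurable]: "unit_box \<in> sets borel"
proof -
  have "open unit_box" unfolding unit_box_def by (intro open_Times) auto
  then show ?thesis by simp
qed

lemma space_box_measure [simp]: "space box_measure = unit_box"
  by (simp add: box_measure_def space_restrict_space)

lemma sets_box_measure: "sets box_measure = sets (restrict_space borel unit_box)"
  unfolding box_measure_def by (intro sets_restrict_space_cong) simp

lemma prob_space_box_measure: "prob_space box_measure"
proof
  have "emeasure lborel unit_box = 1"
    unfolding unit_box_def lborel_prod[symmetric] by (subst lborel.emeasure_pair_measure_Times) auto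
  then show "emeasure box_measure (space box_measure) = 1"
    by (simp add: box_measure_def emeasure_restrict_space space_restrict_space)
qed

interpretation box: prob_space box_measure by (rule prob_space_box_measure)

lemma box_measurableI:
  "f \<in> borel_measurable (restrict_space borel unit_box) \<Longrightarrow> f \<in> borel_measurable box_measure"
  by (simp cong: measurable_cong_sets[OF sets_box_measure])

lemma box_measurable_continuous:
  fixes f :: "real \<times> real \<Rightarrow> 'c::{second_countable_topology, t2_space}"
  assumes "continuous_on unit_square f"
  shows "f \<in> borel_measurable box_measure"
  by (intro box_measurableI borel_measurable_continuous_on_restrict continuous_on_subset[OF assms])
    (auto simp: unit_box_def)

lemma fst_box_measurable [measurable]: "fst \<in> borel_measurable box_measure"
  and snd_box_measurable [measurable]: "snd \<in> borel_measurable box_measure"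
  and swap_box_measurable: "prod.swap \<in> measurable box_measure box_measure"
proof -
  show "fst \<in> borel_measurable box_measure" "snd \<in> borel_measurable box_measure"
    by (intro box_measurable_continuous continuous_intros)+
  have 1: "prod.swap \<in> borel_measurable box_measure"
    unfolding prod.swap_def by (intro box_measurable_continuous continuous_intros)
  have "prod.swap \<in> measurable box_measure (restrict_space borel unit_box)"
    by (intro measurable_restrict_space2 1) (auto simp: unit_box_def)
  then show "prod.swap \<in> measurable box_measure box_measure"
    by (simp cong: measurable_cong_sets[OF refl sets_box_measure])
qed

text \<open>Square and open box differ by parts of four null lines. The indicator in the hypothesis
  is there because f is arbitrary outside the square.\<close>

lemma L1_asymmetry_eq_box:
  assumes "(\<lambda>p. indicator unit_square p * \<bar>f (fst p) (snd p) - f (snd p) (fst p)\<bar>) \<in> borel_measurable borel"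
  shows "L1_asymmetry f = (\<integral>p. \<bar>f (fst p) (snd p) - f (snd p) (fst p)\<bar> \<partial>box_measure)"
proof -
  let ?g = "\<lambda>p. \<bar>f (fst p) (snd p) - f (snd p) (fst p)\<bar>"
  have sub: "unit_box \<subseteq> unit_square" by (auto simp: unit_box_def)
  have meas: "(\<lambda>p. indicator unit_box p * (indicator unit_square p * ?g p)) \<in> borel_measurable lborel"
    using borel_measurable_times[OF borel_measurable_indicator[OF unit_box_measurable] assms] by simp
  have "{0} \<times> UNIV \<in> null_sets (lborel :: (real \<times> real) measure)" "{1} \<times> UNIV \<in> null_sets (lborel :: (real \<times> real) measure)"
     "UNIV \<times> {0} \<in> null_sets (lborel :: (real \<times> real) measure)" "UNIV \<times> {1} \<in> null_sets (lborel :: (real \<times> real) measure)"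
    unfolding lborel_prod[symmetric] by (auto simp: null_sets_def lborel.emeasure_pair_measure_Times)
  then have "{0} \<times> UNIV \<union> {1} \<times> UNIV \<union> UNIV \<times> {0} \<union> UNIV \<times> {1} \<in> null_sets (lborel :: (real \<times> real) measure)"
    by (intro null_sets.Un)
  then have "AE p in lborel. (p :: real \<times> real) \<notin> {0} \<times> UNIV \<union> {1} \<times> UNIV \<union> UNIV \<times> {0} \<union> UNIV \<times> {1}"
    by (rule AE_not_in)
  then have ae: "AE p in lborel. indicator unit_square p * ?g p = indicator unit_box p * (indicator unit_square p * ?g p)"
    by eventually_elim (auto simp: unit_box_def indicator_def)
  have "L1_asymmetry f = (\<integral>p. indicator unit_square p * ?g p \<partial>lborel)"
    unfolding L1_asymmetry_def set_lebesgue_integral_def by (simp add: case_prod_beta')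
  also have "\<dots> = (\<integral>p. indicator unit_box p * (indicator unit_square p * ?g p) \<partial>lborel)"
    using assms meas by (intro integral_cong_AE ae) auto
  also have "\<dots> = (\<integral>p. indicator unit_box p *\<^sub>R ?g p \<partial>lborel)"
    using sub by (intro Bochner_Integration.integral_cong) (auto simp: indicator_def)
  also have "\<dots> = (\<integral>p. ?g p \<partial>box_measure)"
    unfolding box_measure_def by (intro integral_restrict_space[symmetric]) simp
  finally show ?thesis .
qed

text \<open>There are m + 1 cells per axis, so that m = 0 leads to no division by 0. Midpoints
  rather than end points keep the mesh inside the open box.\<close>

definition midpoint_of :: "nat \<Rightarrow> real \<Rightarrow> real" where
  "midpoint_of m x = (of_int \<lfloor>real (Suc m) * x\<rfloor> + 1 / 2) / real (Suc m)"

definition proj :: "nat \<Rightarrow> real \<times> real \<Rightarrow> real \<times> real" where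
  "proj m p = (midpoint_of m (fst p), midpoint_of m (snd p))"

definition mesh :: "nat \<Rightarrow> (real \<times> real) set" where
  "mesh m = (let c = (\<lambda>i. (of_int i + 1 / 2) / real (Suc m)) ` {0..<int (Suc m)} in c \<times> c)"

text \<open>The area of the cell of g, in the form in which it arises on integrating a function of
  \<open>proj m\<close>.\<close>

definition mesh_weight :: "nat \<Rightarrow> real \<times> real \<Rightarrow> real" where
  "mesh_weight m g = box.prob {p \<in> unit_box. proj m p = g}"

lemma finite_mesh [simp]: "finite (mesh m)"
  by (simp add: mesh_def Let_def)

text \<open>Both axes carry the same midpoints, so antisymmetrising on the mesh introduces no new
  points.\<close>

lemma mesh_swap: "prod.swap ` mesh m = mesh m"
  by (auto simp: mesh_def Let_def product_swap)

lemma mesh_subset: "mesh m \<subseteq> unit_box"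
  by (auto simp: mesh_def Let_def unit_box_def divide_less_eq)

lemma proj_in_mesh:
  assumes "p \<in> unit_box"
  shows "proj m p \<in> mesh m"
proof -
  have "\<lfloor>real (Suc m) * x\<rfloor> \<in> {0..<int (Suc m)}" if "0 < x" "x < 1" for x
  proof -
    have "real (Suc m) * x < real (Suc m)" using that mult_strict_left_mono[of x 1 "real (Suc m)"] by simp
    then have "\<lfloor>real (Suc m) * x\<rfloor> < int (Suc m)" by (subst floor_less_iff) simp
    then show ?thesis using that by simp
  qed
  then show ?thesis
    using assms unfolding proj_def mesh_def Let_def midpoint_of_def unit_box_def by auto
qed

lemma proj_in_box: "p \<in> unit_box \<Longrightarrow> proj m p \<in> unit_box"
  using proj_in_mesh mesh_subset by blast

lemma midpoint_of_tendsto: "(\<lambda>m. midpoint_of m x) \<longlonglongrightarrow> x"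
proof -
  have le: "norm (midpoint_of m x - x) \<le> 1 / real (Suc m)" for m
  proof -
    have "midpoint_of m x - x = (of_int \<lfloor>real (Suc m) * x\<rfloor> + 1 / 2 - real (Suc m) * x) / real (Suc m)"
      by (simp add: midpoint_of_def field_simps del: of_nat_Suc)
    moreover have "\<bar>of_int \<lfloor>real (Suc m) * x\<rfloor> + 1 / 2 - real (Suc m) * x\<bar> \<le> 1"
      by linarith
    ultimately show ?thesis by (simp add: divide_right_mono del: of_nat_Suc)
  qed
  have "(\<lambda>m. midpoint_of m x - x) \<longlonglongrightarrow> 0"
    by (rule Lim_null_comparison[OF _ LIMSEQ_Suc[OF lim_1_over_n]]) (use le in simp)
  then show ?thesis by (simp add: LIM_zero_iff)
qed

lemma proj_tendsto: "(\<lambda>m. proj m p) \<longlonglongrightarrow> p"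
  using tendsto_Pair[OF midpoint_of_tendsto midpoint_of_tendsto, of "fst p" "snd p"] by (simp add: proj_def)

lemma proj_measurable: "proj m \<in> measurable box_measure box_measure"
proof -
  have [measurable]: "midpoint_of m \<in> borel_measurable borel"
    unfolding midpoint_of_def[abs_def] by measurable
  have 1: "proj m \<in> borel_measurable box_measure"
    unfolding proj_def[abs_def] borel_prod[symmetric] by measurable
  have "proj m \<in> measurable box_measure (restrict_space borel unit_box)"
    by (intro measurable_restrict_space2 1) (use proj_in_box in auto)
  then show ?thesis
    by (simp cong: measurable_cong_sets[OF refl sets_box_measure])
qed

text \<open>Composed with \<open>proj m\<close>, any h becomes a simple function on the box, with
  one value per cell.\<close>

lemma integral_proj:
  fixes h :: "real \<times> real \<Rightarrow> real"
  shows "(\<integral>p. h (proj m p) \<partial>box_measure) = (\<Sum>g\<in>mesh m. mesh_weight m g * h g)"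
proof -
  have sets: "{p \<in> unit_box. proj m p = g} \<in> sets box_measure" if "g \<in> mesh m" for g
  proof -
    have "{g} \<in> sets (restrict_space borel unit_box)"
      using that mesh_subset by (auto simp: sets_restrict_space_iff)
    then have "proj m -` {g} \<inter> space box_measure \<in> sets box_measure"
      by (intro measurable_sets[OF proj_measurable]) (simp add: sets_box_measure)
    moreover have "proj m -` {g} \<inter> space box_measure = {p \<in> unit_box. proj m p = g}" by auto
    ultimately show ?thesis by simp
  qed
  have "(\<integral>p. h (proj m p) \<partial>box_measure)
      = (\<integral>p. (\<Sum>g\<in>mesh m. h g * indicator {p \<in> unit_box. proj m p = g} p) \<partial>box_measure)"
  proof (intro Bochner_Integration.integral_cong refl)
    fix p assume "p \<in> space box_measure"
    then have p: "p \<in> unit_box" by simp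
    have "(\<Sum>g\<in>mesh m. h g * indicator {p \<in> unit_box. proj m p = g} p)
        = (\<Sum>g\<in>mesh m. if g = proj m p then h g else 0)"
      using p by (intro sum.cong) (auto simp: indicator_def)
    then show "h (proj m p) = (\<Sum>g\<in>mesh m. h g * indicator {p \<in> unit_box. proj m p = g} p)"
      using proj_in_mesh[OF p] by simp
  qed
  also have "\<dots> = (\<Sum>g\<in>mesh m. h g * box.prob {p \<in> unit_box. proj m p = g})"
  proof (subst Bochner_Integration.integral_sum)
    show "integrable box_measure (\<lambda>p. h g * indicator {p \<in> unit_box. proj m p = g} p)" if "g \<in> mesh m" for g
      using sets[OF that] by (intro integrable_mult_right) (simp add: box.emeasure_eq_measure)
    show "(\<Sum>g\<in>mesh m. \<integral>p. h g * indicator {p \<in> unit_box. proj m p = g} p \<partial>box_measure)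
       = (\<Sum>g\<in>mesh m. h g * box.prob {p \<in> unit_box. proj m p = g})"
    proof (intro sum.cong refl)
      fix g assume "g \<in> mesh m"
      have "{p \<in> unit_box. proj m p = g} \<inter> unit_box = {p \<in> unit_box. proj m p = g}" by auto
      then show "(\<integral>p. h g * indicator {p \<in> unit_box. proj m p = g} p \<partial>box_measure)
          = h g * box.prob {p \<in> unit_box. proj m p = g}" by simp
    qed
  qed
  finally show ?thesis by (simp add: mesh_weight_def mult.commute)
qed

lemma integral_proj_tendsto:
  fixes h :: "real \<times> real \<Rightarrow> real"
  assumes "continuous_on unit_square h"
  shows "(\<lambda>m. \<Sum>g\<in>mesh m. mesh_weight m g * h g) \<longlonglongrightarrow> (\<integral>p. h p \<partial>box_measure)"
proof -
  have sub: "unit_box \<subseteq> unit_square" by (auto simp: unit_box_def)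
  have "compact (h ` unit_square)" using assms by (intro compact_continuous_image compact_Times) auto
  then obtain B where "\<forall>x\<in>h ` unit_square. norm x \<le> B" using compact_imp_bounded bounded_iff by metis
  then have B: "\<bar>h p\<bar> \<le> B" if "p \<in> unit_box" for p using sub that by auto
  have hm: "h \<in> borel_measurable box_measure" by (rule box_measurable_continuous[OF assms])
  have "(\<lambda>m. \<integral>p. h (proj m p) \<partial>box_measure) \<longlonglongrightarrow> (\<integral>p. h p \<partial>box_measure)"
  proof (rule integral_dominated_convergence[where w = "\<lambda>_. B"])
    show "AE p in box_measure. (\<lambda>m. h (proj m p)) \<longlonglongrightarrow> h p"
    proof (intro AE_I2)
      fix p assume "p \<in> space box_measure"
      then have "p \<in> unit_box" by simp
      then have "p \<in> unit_square" "\<And>m. proj m p \<in> unit_square" using proj_in_box sub by blast+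
      then show "(\<lambda>m. h (proj m p)) \<longlonglongrightarrow> h p"
        by (intro continuous_on_tendsto_compose[OF assms proj_tendsto]) auto
    qed
    show "AE p in box_measure. norm (h (proj m p)) \<le> B" for m
      using B proj_in_box by (intro AE_I2) auto
  qed (use hm measurable_compose[OF proj_measurable hm] in auto)
  then show ?thesis by (simp add: integral_proj)
qed

section \<open>Discretisation of the asymmetry functional\<close>

lemma quadrant_measurable_joint [measurable]:
  assumes [measurable]: "a \<in> borel_measurable L" "b \<in> borel_measurable L" "c \<in> borel_measurable L"
  shows "(\<lambda>x. quadrant (a x, b x) (c x)) \<in> borel_measurable L"
proof -
  have "(fst :: real \<times> real \<Rightarrow> real) \<in> borel_measurable borel" "(snd :: real \<times> real \<Rightarrow> real) \<in> borel_measurable borel"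
    by (intro borel_measurable_continuous_onI continuous_intros)+
  from this[THEN measurable_compose[OF assms(3)]]
  have [measurable]: "(\<lambda>x. fst (c x)) \<in> borel_measurable L" "(\<lambda>x. snd (c x)) \<in> borel_measurable L" .
  show ?thesis unfolding quadrant_def fst_conv snd_conv by measurable
qed

lemma unit_box_in_square: "p \<in> unit_box \<Longrightarrow> fst p \<in> {0..1} \<and> snd p \<in> {0..1}"
  by (auto simp: unit_box_def)

lemma unit_box_swap: "p \<in> unit_box \<Longrightarrow> prod.swap p \<in> unit_box"
  by (auto simp: unit_box_def)

lemma proj_swap: "proj m (prod.swap p) = prod.swap (proj m p)"
  by (simp add: proj_def)

lemma emp_copula_bounds: "0 \<le> emp_copula n x y u v" "emp_copula n x y u v \<le> 1"
proof -
  show "0 \<le> emp_copula n x y u v" unfolding emp_copula_def by (intro mult_nonneg_nonneg sum_nonneg) auto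
  have "(\<Sum>i=1..n. of_bool (pseudo_obs n x i \<le> u \<and> pseudo_obs n y i \<le> v)) \<le> (\<Sum>i=1..n. 1 :: real)"
    by (intro sum_mono) auto
  then have "emp_copula n x y u v \<le> 1 / real n * real n"
    unfolding emp_copula_def by (intro mult_left_mono) auto
  then show "emp_copula n x y u v \<le> 1" by (cases "n = 0") auto
qed

context copula_sample
begin

definition asym :: "real \<times> real \<Rightarrow> real \<times> real \<Rightarrow> real" where
  "asym p z = lin p z - lin (prod.swap p) z"

text \<open>For symmetric C the two centrings cancel, so this is the antisymmetrised empirical
  copula process although C does not appear.\<close>

definition H :: "real \<times> real \<Rightarrow> nat \<Rightarrow> 'a \<Rightarrow> real" where
  "H p n \<omega> = sqrt (real n) * (emp_cop n \<omega> (fst p) (snd p)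
     - emp_cop n \<omega> (snd p) (fst p))"

lemma lin_bound:
  assumes "p \<in> unit_box"
  shows "\<bar>lin p z\<bar> \<le> 1 + 2 * K"
proof -
  have "\<bar>partial1 C (fst p) (snd p) * quadrant (fst p, 1) z\<bar> \<le> K * 1"
    "\<bar>partial2 C (fst p) (snd p) * quadrant (1, snd p) z\<bar> \<le> K * 1"
    unfolding abs_mult using unit_box_in_square[OF assms]
    by (intro mult_mono partial1_le partial2_le quadrant_bounds K_nonneg; simp)+
  then show ?thesis using quadrant_bounds(3)[of p z] unfolding lin_def by linarith
qed

lemma asym_bound: "p \<in> unit_box \<Longrightarrow> \<bar>asym p z\<bar> \<le> 2 + 4 * K"
  using lin_bound[of p z] lin_bound[OF unit_box_swap, of p z] unfolding asym_def by linarith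

lemma asym_measurable [measurable]: "asym p \<in> borel_measurable borel"
  unfolding asym_def[abs_def] by measurable

lemma lin_integrable: "p \<in> unit_box \<Longrightarrow> integrable \<nu> (lin p)"
  by (rule \<nu>_integrable[OF lin_measurable lin_bound])

lemma emp_asym:
  "p \<in> unit_box \<Longrightarrow> emp (asym p) n \<omega> = emp (lin p) n \<omega> - emp (lin (prod.swap p)) n \<omega>"
  unfolding asym_def[abs_def] by (intro emp_diff lin_integrable unit_box_swap)

text \<open>A deterministic bound that grows with n; it secures integrability for fixed n, in
  particular for Fubini's theorem.\<close>

lemma emp_bound:
  assumes [measurable]: "f \<in> borel_measurable borel" and "\<And>z. \<bar>f z\<bar> \<le> B"
  shows "\<bar>emp f n \<omega>\<bar> \<le> 2 * B * sqrt (real n)"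
proof -
  have "\<bar>\<Sum>i=1..n. f (Z i \<omega>)\<bar> \<le> (\<Sum>i=1..n. B)"
    using assms(2) by (intro order_trans[OF sum_abs] sum_mono)
  moreover have "\<bar>\<integral>z. f z \<partial>\<nu>\<bar> \<le> B"
  proof -
    have "\<bar>\<integral>z. f z \<partial>\<nu>\<bar> \<le> (\<integral>z. \<bar>f z\<bar> \<partial>\<nu>)" by (rule integral_abs_bound)
    also have "\<dots> \<le> (\<integral>z. B \<partial>\<nu>)"
      using \<nu>_integrable[OF assms] assms(2) by (intro integral_mono) auto
    finally show ?thesis using \<nu>.prob_space by simp
  qed
  then have "\<bar>real n * (\<integral>z. f z \<partial>\<nu>)\<bar> \<le> real n * B" by (simp add: abs_mult mult_left_mono)
  moreover have "2 * B * real n = real n * B + real n * B" "(\<Sum>i=1..n. B) = real n * B" by simp_all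
  ultimately have "\<bar>(\<Sum>i=1..n. f (Z i \<omega>)) - real n * (\<integral>z. f z \<partial>\<nu>)\<bar> \<le> 2 * B * real n"
    using abs_triangle_ineq4[of "\<Sum>i=1..n. f (Z i \<omega>)" "real n * (\<integral>z. f z \<partial>\<nu>)"] by linarith
  then have "\<bar>emp f n \<omega>\<bar> \<le> 2 * B * real n / sqrt (real n)"
    by (simp add: emp_def divide_right_mono)
  then show ?thesis
    using real_div_sqrt[of "real n"] by (metis of_nat_0_le_iff times_divide_eq_right)
qed

subsection \<open>Joint measurability\<close>

text \<open>The partial derivatives are known to be continuous on the square alone, so a has to map
  into \<open>box_measure\<close> and not merely into the plane.\<close>

lemma partial_box_measurable:
  assumes [measurable]: "a \<in> measurable L box_measure"
  shows "(\<lambda>x. partial1 C (fst (a x)) (snd (a x))) \<in> borel_measurable L"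
    "(\<lambda>x. partial2 C (fst (a x)) (snd (a x))) \<in> borel_measurable L"
proof -
  have "(\<lambda>p. partial1 C (fst p) (snd p)) \<in> borel_measurable box_measure"
    "(\<lambda>p. partial2 C (fst p) (snd p)) \<in> borel_measurable box_measure"
    using partials unfolding continuous_partials_def
    by (auto intro!: box_measurable_continuous simp: case_prod_beta')
  from this[THEN measurable_compose[OF assms]]
  show "(\<lambda>x. partial1 C (fst (a x)) (snd (a x))) \<in> borel_measurable L"
    "(\<lambda>x. partial2 C (fst (a x)) (snd (a x))) \<in> borel_measurable L" .
qed

lemma lin_measurable_joint:
  assumes a: "a \<in> measurable L box_measure" and [measurable]: "c \<in> borel_measurable L"
  shows "(\<lambda>x. lin (a x) (c x)) \<in> borel_measurable L"
proof -
  note [measurable] = partial_box_measurable[OF a] measurable_compose[OF a fst_box_measurable]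
    measurable_compose[OF a snd_box_measurable]
  have "(\<lambda>x. quadrant (fst (a x), snd (a x)) (c x)) \<in> borel_measurable L" by measurable
  then have [measurable]: "(\<lambda>x. quadrant (a x) (c x)) \<in> borel_measurable L" by simp
  show ?thesis unfolding lin_def by measurable
qed

lemma integral_lin_measurable:
  assumes a: "a \<in> measurable L box_measure"
  shows "(\<lambda>x. \<integral>z. lin (a x) z \<partial>\<nu>) \<in> borel_measurable L"
proof (rule \<nu>.borel_measurable_lebesgue_integral)
  have "(\<lambda>y. lin (a (fst y)) (snd y)) \<in> borel_measurable (L \<Otimes>\<^sub>M \<nu>)"
  proof (rule lin_measurable_joint[OF measurable_compose[OF measurable_fst a]])
    show "snd \<in> borel_measurable (L \<Otimes>\<^sub>M \<nu>)" by measurable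
  qed
  then show "(\<lambda>(x, z). lin (a x) z) \<in> borel_measurable (L \<Otimes>\<^sub>M \<nu>)" by (simp add: case_prod_beta')
qed

lemma emp_lin_measurable_joint:
  assumes a: "a \<in> measurable L box_measure" and w: "w \<in> measurable L M"
  shows "(\<lambda>x. emp (lin (a x)) n (w x)) \<in> borel_measurable L"
proof -
  have "(\<lambda>x. lin (a x) (Z i (w x))) \<in> borel_measurable L" if "i \<in> {1..n}" for i
    using that by (intro lin_measurable_joint a measurable_compose[OF w Z_measurable]) auto
  then show ?thesis
    unfolding emp_def
    by (intro borel_measurable_divide borel_measurable_diff borel_measurable_sum borel_measurable_times
        integral_lin_measurable a borel_measurable_const)
qed

lemma emp_asym_measurable_joint:
  assumes a: "a \<in> measurable L box_measure" and w: "w \<in> measurable L M"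
  shows "(\<lambda>x. emp (asym (a x)) n (w x)) \<in> borel_measurable L"
proof -
  have "(\<lambda>x. emp (lin (a x)) n (w x) - emp (lin (prod.swap (a x))) n (w x)) \<in> borel_measurable L"
    by (intro borel_measurable_diff emp_lin_measurable_joint a w measurable_compose[OF a swap_box_measurable])
  moreover have "a x \<in> unit_box" if "x \<in> space L" for x using measurable_space[OF a that] by simp
  ultimately show ?thesis by (subst measurable_cong[OF emp_asym]) auto
qed

lemma emp_copula_measurable_joint:
  assumes "a \<in> borel_measurable L" "b \<in> borel_measurable L" and w: "w \<in> measurable L M"
  shows "(\<lambda>x. emp_copula n (\<lambda>i. U i (w x)) (\<lambda>i. V i (w x)) (a x) (b x)) \<in> borel_measurable L"
  by (rule emp_copula_measurable[OF measurable_compose[OF w U_measurable] measurable_compose[OF w V_measurable] assms(1,2)])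

lemma H_measurable_joint:
  assumes [measurable]: "a \<in> borel_measurable L" "b \<in> borel_measurable L" and w: "w \<in> measurable L M"
  shows "(\<lambda>x. H (a x, b x) n (w x)) \<in> borel_measurable L"
  unfolding H_def fst_conv snd_conv
  by (intro borel_measurable_times borel_measurable_diff emp_copula_measurable_joint w assms borel_measurable_const)

lemma H_bound: "\<bar>H p n \<omega>\<bar> \<le> sqrt (real n)"
proof -
  have "\<bar>emp_cop n \<omega> (fst p) (snd p) - emp_cop n \<omega> (snd p) (fst p)\<bar> \<le> 1"
    using emp_copula_bounds by (smt (verit))
  then show ?thesis by (simp add: H_def abs_mult mult_left_le)
qed

subsection \<open>Moduli of continuity in mean\<close>

text \<open>Each product of a partial derivative and a marginal indicator is changed one factor at a
  time: the indicator costs K times its L1 distance, the derivative its own increment.\<close>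

lemma integral_abs_lin_diff:
  assumes r: "r \<in> unit_box" and s: "s \<in> unit_box"
  shows "(\<integral>z. \<bar>lin r z - lin s z\<bar> \<partial>\<nu>) \<le> (1 + K) * (\<bar>fst r - fst s\<bar> + \<bar>snd r - snd s\<bar>)
    + \<bar>partial1 C (fst r) (snd r) - partial1 C (fst s) (snd s)\<bar>
    + \<bar>partial2 C (fst r) (snd r) - partial2 C (fst s) (snd s)\<bar>"
proof -
  define p where "p = partial1 C (fst r) (snd r)"
  define p' where "p' = partial1 C (fst s) (snd s)"
  define q where "q = partial2 C (fst r) (snd r)"
  define q' where "q' = partial2 C (fst s) (snd s)"
  note rs = unit_box_in_square[OF r] unit_box_in_square[OF s]
  have pq: "\<bar>p\<bar> \<le> K" "\<bar>q\<bar> \<le> K" using rs by (auto simp: p_def q_def intro: partial1_le partial2_le)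
  have int: "integrable \<nu> (\<lambda>z. \<bar>quadrant x z - quadrant y z\<bar>)" for x y
    by (intro integrable_abs Bochner_Integration.integrable_diff quadrant_integrable)
  let ?d = "\<lambda>x y z. \<bar>quadrant x z - quadrant y z\<bar>"
  have pt: "\<bar>lin r z - lin s z\<bar> \<le> ?d r s z + (K * ?d (fst r, 1) (fst s, 1) z + (K * ?d (1, snd r) (1, snd s) z + (\<bar>p - p'\<bar> + \<bar>q - q'\<bar>)))" for z
  proof -
    have split: "lin r z - lin s z = (quadrant r z - quadrant s z)
        - p * (quadrant (fst r, 1) z - quadrant (fst s, 1) z) - q * (quadrant (1, snd r) z - quadrant (1, snd s) z)
        - (p - p') * quadrant (fst s, 1) z - (q - q') * quadrant (1, snd s) z"
      by (simp add: lin_def p_def p'_def q_def q'_def algebra_simps)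
    have b: "\<bar>p * (quadrant (fst r, 1) z - quadrant (fst s, 1) z)\<bar> \<le> K * ?d (fst r, 1) (fst s, 1) z"
      "\<bar>q * (quadrant (1, snd r) z - quadrant (1, snd s) z)\<bar> \<le> K * ?d (1, snd r) (1, snd s) z"
      "\<bar>(p - p') * quadrant (fst s, 1) z\<bar> \<le> \<bar>p - p'\<bar> * 1" "\<bar>(q - q') * quadrant (1, snd s) z\<bar> \<le> \<bar>q - q'\<bar> * 1"
      unfolding abs_mult by (intro mult_right_mono mult_left_mono pq quadrant_bounds abs_ge_zero)+
    have "\<bar>a - b - c - d - e\<bar> \<le> \<bar>a\<bar> + (\<bar>b\<bar> + (\<bar>c\<bar> + (\<bar>d\<bar> + \<bar>e\<bar>)))" for a b c d e :: real by linarith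
    then show ?thesis unfolding split
      by (rule order_trans) (use b in \<open>intro add_mono order_refl; simp\<close>)
  qed
  have "(\<integral>z. \<bar>lin r z - lin s z\<bar> \<partial>\<nu>) \<le> (\<integral>z. ?d r s z + (K * ?d (fst r, 1) (fst s, 1) z + (K * ?d (1, snd r) (1, snd s) z + (\<bar>p - p'\<bar> + \<bar>q - q'\<bar>))) \<partial>\<nu>)"
    by (intro integral_mono pt integrable_abs Bochner_Integration.integrable_diff Bochner_Integration.integrable_add
        integrable_mult_right int lin_integrable r s \<nu>.integrable_const)
  also have "\<dots> = (\<integral>z. ?d r s z \<partial>\<nu>) + (K * (\<integral>z. ?d (fst r, 1) (fst s, 1) z \<partial>\<nu>) + (K * (\<integral>z. ?d (1, snd r) (1, snd s) z \<partial>\<nu>) + (\<bar>p - p'\<bar> + \<bar>q - q'\<bar>)))"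
    using int \<nu>.prob_space by simp
  also have "\<dots> \<le> (\<bar>fst r - fst s\<bar> + \<bar>snd r - snd s\<bar>) + (K * (\<bar>fst r - fst s\<bar> + \<bar>1 - 1\<bar>) + (K * (\<bar>1 - 1\<bar> + \<bar>snd r - snd s\<bar>) + (\<bar>p - p'\<bar> + \<bar>q - q'\<bar>)))"
    using rs integral_abs_quadrant_diff[of "fst r" "snd r" "fst s" "snd s"]
      integral_abs_quadrant_diff[of "fst r" 1 "fst s" 1] integral_abs_quadrant_diff[of 1 "snd r" 1 "snd s"]
    by (intro add_mono mult_left_mono K_nonneg order_refl) auto
  also have "\<dots> = (1 + K) * (\<bar>fst r - fst s\<bar> + \<bar>snd r - snd s\<bar>) + \<bar>p - p'\<bar> + \<bar>q - q'\<bar>"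
    by (simp add: algebra_simps)
  finally show ?thesis unfolding p_def p'_def q_def q'_def .
qed

lemma lin_proj_tendsto:
  assumes p: "p \<in> unit_box"
  shows "(\<lambda>m. \<integral>z. \<bar>lin p z - lin (proj m p) z\<bar> \<partial>\<nu>) \<longlonglongrightarrow> 0"
proof (rule tendsto_sandwich[OF _ _ tendsto_const])
  show "\<forall>\<^sub>F m in sequentially. 0 \<le> (\<integral>z. \<bar>lin p z - lin (proj m p) z\<bar> \<partial>\<nu>)" by simp
  let ?b = "\<lambda>q. (1 + K) * (\<bar>fst p - fst q\<bar> + \<bar>snd p - snd q\<bar>)
    + \<bar>partial1 C (fst p) (snd p) - partial1 C (fst q) (snd q)\<bar>
    + \<bar>partial2 C (fst p) (snd p) - partial2 C (fst q) (snd q)\<bar>"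
  show "\<forall>\<^sub>F m in sequentially. (\<integral>z. \<bar>lin p z - lin (proj m p) z\<bar> \<partial>\<nu>) \<le> ?b (proj m p)"
    using p proj_in_box integral_abs_lin_diff by (intro always_eventually allI) blast
  have sub: "q \<in> unit_square" if "q \<in> unit_box" for q using that by (auto simp: unit_box_def)
  have c: "continuous_on unit_square (\<lambda>q. partial1 C (fst q) (snd q))"
    "continuous_on unit_square (\<lambda>q. partial2 C (fst q) (snd q))"
    using partials by (auto simp: continuous_partials_def case_prod_beta')
  have t: "(\<lambda>m. f (proj m p)) \<longlonglongrightarrow> f p" if "continuous_on unit_square f" for f :: "real \<times> real \<Rightarrow> real"
    using sub[OF p] sub[OF proj_in_box[OF p]]
    by (intro continuous_on_tendsto_compose[OF that proj_tendsto]) auto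
  have "(\<lambda>m. ?b (proj m p)) \<longlonglongrightarrow> ?b p"
    by (intro tendsto_intros t c tendsto_fst[OF proj_tendsto] tendsto_snd[OF proj_tendsto])
  then show "(\<lambda>m. ?b (proj m p)) \<longlonglongrightarrow> 0" by simp
qed

text \<open>The square of an increment of \<open>asym\<close> is at most its uniform bound 4 + 8K
  times its absolute value, and the latter splits into a term at p and one at the reflected point.
  The root bounds the mean increment of the empirical process for every n.\<close>

definition modulus :: "nat \<Rightarrow> real \<times> real \<Rightarrow> real" where
  "modulus m p = sqrt ((4 + 8 * K) * ((\<integral>z. \<bar>lin p z - lin (proj m p) z\<bar> \<partial>\<nu>)
     + (\<integral>z. \<bar>lin (prod.swap p) z - lin (proj m (prod.swap p)) z\<bar> \<partial>\<nu>)))"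

lemma expectation_emp_asym_proj:
  assumes p: "p \<in> unit_box"
  shows "expectation (\<lambda>\<omega>. \<bar>emp (asym p) n \<omega> - emp (asym (proj m p)) n \<omega>\<bar>) \<le> modulus m p"
proof -
  let ?q = "proj m p"
  note q = proj_in_box[OF p, of m]
  let ?f = "\<lambda>z. asym p z - asym ?q z"
  have fm: "?f \<in> borel_measurable borel" by measurable
  have fb: "\<bar>?f z\<bar> \<le> 4 + 8 * K" for z
    using asym_bound[OF p, of z] asym_bound[OF q, of z] by linarith
  have int: "integrable \<nu> (asym p)" "integrable \<nu> (asym ?q)"
    by (rule \<nu>_integrable[OF asym_measurable asym_bound[OF p]], rule \<nu>_integrable[OF asym_measurable asym_bound[OF q]])
  have K4: "4 + 8 * K \<ge> 0" using K_nonneg by simp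
  have intl: "integrable \<nu> (\<lambda>z. \<bar>lin r z - lin s z\<bar>)" if "r \<in> unit_box" "s \<in> unit_box" for r s
    using that by (intro integrable_abs Bochner_Integration.integrable_diff lin_integrable)
  have "(\<integral>z. (?f z)\<^sup>2 \<partial>\<nu>) \<le> (\<integral>z. (4 + 8 * K) * (\<bar>lin p z - lin ?q z\<bar> + \<bar>lin (prod.swap p) z - lin (prod.swap ?q) z\<bar>) \<partial>\<nu>)"
  proof (rule integral_mono)
    show "integrable \<nu> (\<lambda>z. (?f z)\<^sup>2)"
    proof (rule \<nu>_integrable)
      show "\<bar>(?f z)\<^sup>2\<bar> \<le> (4 + 8 * K)\<^sup>2" for z
        unfolding abs_power2 using fb[of z] K4 by (metis abs_le_square_iff abs_of_nonneg)
    qed measurable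
    show "integrable \<nu> (\<lambda>z. (4 + 8 * K) * (\<bar>lin p z - lin ?q z\<bar> + \<bar>lin (prod.swap p) z - lin (prod.swap ?q) z\<bar>))"
      by (intro integrable_mult_right Bochner_Integration.integrable_add intl p q unit_box_swap)
    fix z
    have "\<bar>?f z\<bar> * \<bar>?f z\<bar> \<le> (4 + 8 * K) * (\<bar>lin p z - lin ?q z\<bar> + \<bar>lin (prod.swap p) z - lin (prod.swap ?q) z\<bar>)"
      by (intro mult_mono fb K4) (auto simp: asym_def)
    then show "(?f z)\<^sup>2 \<le> (4 + 8 * K) * (\<bar>lin p z - lin ?q z\<bar> + \<bar>lin (prod.swap p) z - lin (prod.swap ?q) z\<bar>)"
      by (simp add: power2_eq_square)
  qed
  also have "\<dots> = (4 + 8 * K) * ((\<integral>z. \<bar>lin p z - lin ?q z\<bar> \<partial>\<nu>) + (\<integral>z. \<bar>lin (prod.swap p) z - lin (prod.swap ?q) z\<bar> \<partial>\<nu>))"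
    using intl[OF p q] intl[OF unit_box_swap[OF p] unit_box_swap[OF q]] by simp
  finally have "sqrt (\<integral>z. (?f z)\<^sup>2 \<partial>\<nu>) \<le> modulus m p"
    unfolding modulus_def proj_swap by simp
  then show ?thesis
    using emp_abs(2)[OF fm fb, of n] by (simp add: emp_diff[OF int])
qed

lemma integral_abs_lin_le:
  assumes "r \<in> unit_box" "s \<in> unit_box"
  shows "(\<integral>z. \<bar>lin r z - lin s z\<bar> \<partial>\<nu>) \<le> 2 + 4 * K"
proof -
  have "(\<integral>z. \<bar>lin r z - lin s z\<bar> \<partial>\<nu>) \<le> (\<integral>z. 2 + 4 * K \<partial>\<nu>)"
  proof (rule integral_mono)
    show "integrable \<nu> (\<lambda>z. \<bar>lin r z - lin s z\<bar>)"
      using assms by (intro integrable_abs Bochner_Integration.integrable_diff lin_integrable)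
    show "\<bar>lin r z - lin s z\<bar> \<le> 2 + 4 * K" for z
      using lin_bound[OF assms(1), of z] lin_bound[OF assms(2), of z] by linarith
  qed simp
  then show ?thesis using \<nu>.prob_space by simp
qed

lemma modulus_measurable: "modulus m \<in> borel_measurable box_measure"
proof -
  have l: "(\<lambda>x. \<integral>z. \<bar>lin (a x) z - lin (b x) z\<bar> \<partial>\<nu>) \<in> borel_measurable box_measure"
    if a: "a \<in> measurable box_measure box_measure" and b: "b \<in> measurable box_measure box_measure" for a b
  proof (rule \<nu>.borel_measurable_lebesgue_integral)
    have s: "snd \<in> borel_measurable (box_measure \<Otimes>\<^sub>M \<nu>)" by measurable
    have "(\<lambda>y. \<bar>lin (a (fst y)) (snd y) - lin (b (fst y)) (snd y)\<bar>) \<in> borel_measurable (box_measure \<Otimes>\<^sub>M \<nu>)"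
      by (intro borel_measurable_abs borel_measurable_diff lin_measurable_joint
          measurable_compose[OF measurable_fst a] measurable_compose[OF measurable_fst b] s)
    then show "(\<lambda>(x, z). \<bar>lin (a x) z - lin (b x) z\<bar>) \<in> borel_measurable (box_measure \<Otimes>\<^sub>M \<nu>)"
      by (simp add: case_prod_beta')
  qed
  have id: "(\<lambda>p. p) \<in> measurable box_measure box_measure" by simp
  show ?thesis
    unfolding modulus_def[abs_def]
    by (intro borel_measurable_sqrt[THEN measurable_compose[rotated]] borel_measurable_times borel_measurable_add borel_measurable_const l id
       proj_measurable swap_box_measurable measurable_compose[OF swap_box_measurable proj_measurable])
qed

lemma modulus_bounds:
  assumes "p \<in> unit_box"
  shows "0 \<le> modulus m p" "modulus m p \<le> 4 + 8 * K"
proof -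
  show "0 \<le> modulus m p" unfolding modulus_def using K_nonneg by simp
  have "modulus m p \<le> sqrt ((4 + 8 * K) * ((2 + 4 * K) + (2 + 4 * K)))"
    unfolding modulus_def using K_nonneg
    by (intro real_sqrt_le_mono mult_left_mono add_mono integral_abs_lin_le assms proj_in_box unit_box_swap) auto
  also have "\<dots> = sqrt ((4 + 8 * K)\<^sup>2)" by (simp add: power2_eq_square algebra_simps)
  finally show "modulus m p \<le> 4 + 8 * K" using K_nonneg by simp
qed

lemma integral_modulus_tendsto: "(\<lambda>m. \<integral>p. modulus m p \<partial>box_measure) \<longlonglongrightarrow> 0"
proof -
  have "(\<lambda>m. \<integral>p. modulus m p \<partial>box_measure) \<longlonglongrightarrow> (\<integral>p. 0 \<partial>box_measure)"
  proof (rule integral_dominated_convergence[where w = "\<lambda>_. 4 + 8 * K"])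
    show "AE p in box_measure. (\<lambda>m. modulus m p) \<longlonglongrightarrow> 0"
    proof (intro AE_I2)
      fix p assume "p \<in> space box_measure"
      then have p: "p \<in> unit_box" by simp
      have "(\<lambda>m. modulus m p) \<longlonglongrightarrow> sqrt ((4 + 8 * K) * (0 + 0))"
        unfolding modulus_def by (intro tendsto_intros lin_proj_tendsto p unit_box_swap)
      then show "(\<lambda>m. modulus m p) \<longlonglongrightarrow> 0" by simp
    qed
    show "AE p in box_measure. norm (modulus m p) \<le> 4 + 8 * K" for m
      using modulus_bounds by (intro AE_I2) auto
  qed (auto intro: modulus_measurable)
  then show ?thesis by simp
qed

end

text \<open>Applied both to the Gaussian process and under \<nu>, so that equal covariances give
  equal variances term by term.\<close>

lemma integral_square_lincomb:
  fixes f :: "'i \<Rightarrow> 'b \<Rightarrow> real"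
  assumes "\<And>i j. i \<in> I \<Longrightarrow> j \<in> I \<Longrightarrow> integrable L (\<lambda>x. f i x * f j x)"
  shows "(\<integral>x. (\<Sum>i\<in>I. c i * f i x)\<^sup>2 \<partial>L) = (\<Sum>i\<in>I. \<Sum>j\<in>I. c i * c j * (\<integral>x. f i x * f j x \<partial>L))"
proof -
  have "(\<Sum>i\<in>I. c i * f i x)\<^sup>2 = (\<Sum>i\<in>I. \<Sum>j\<in>I. c i * c j * (f i x * f j x))" for x
    by (simp add: power2_eq_square sum_product mult_ac)
  then show ?thesis using assms by simp
qed

text \<open>Reindexing along the involution \<open>prod.swap\<close> moves the antisymmetrisation
  from the process to the coefficients.\<close>

lemma sum_swap_diff:
  fixes t f :: "real \<times> real \<Rightarrow> real"
  assumes "prod.swap ` F = F"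
  shows "(\<Sum>g\<in>F. t g * (f g - f (prod.swap g))) = (\<Sum>g\<in>F. (t g - t (prod.swap g)) * f g)"
proof -
  have "(\<Sum>g\<in>F. t (prod.swap g) * f g) = (\<Sum>g\<in>prod.swap ` F. t (prod.swap g) * f g)" using assms by simp
  also have "\<dots> = (\<Sum>g\<in>F. t g * f (prod.swap g))" by (subst sum.reindex) auto
  finally show ?thesis by (simp add: right_diff_distrib left_diff_distrib sum_subtractf)
qed

context copula_sample
begin

section \<open>Mean error of the discretisation\<close>

lemma expectation_remainder_measurable:
  assumes a: "a \<in> measurable box_measure box_measure"
  shows "(\<lambda>p. mean_remainder n (a p)) \<in> borel_measurable box_measure"
  unfolding mean_remainder_def
proof (rule borel_measurable_lebesgue_integral)
  let ?L = "box_measure \<Otimes>\<^sub>M M"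
  have a': "(\<lambda>x. a (fst x)) \<in> measurable ?L box_measure" by (rule measurable_compose[OF measurable_fst a])
  note [measurable] = measurable_compose[OF a' fst_box_measurable] measurable_compose[OF a' snd_box_measurable]
  \<comment> \<open>Writing the copula as the \<nu>-mean of a quadrant, as is possible on the
    square, makes it measurable by Fubini's theorem.\<close>
  have "(\<lambda>x. C (fst (a (fst x))) (snd (a (fst x)))) \<in> borel_measurable ?L"
  proof -
    have "(\<lambda>x. \<integral>z. quadrant (fst (a (fst x)), snd (a (fst x))) z \<partial>\<nu>) \<in> borel_measurable ?L"
    proof (rule \<nu>.borel_measurable_lebesgue_integral)
      note [measurable] = measurable_compose[OF measurable_fst measurable_compose[OF a' fst_box_measurable]]
        measurable_compose[OF measurable_fst measurable_compose[OF a' snd_box_measurable]]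
      have "(\<lambda>y. quadrant (fst (a (fst (fst y))), snd (a (fst (fst y)))) (snd y)) \<in> borel_measurable (?L \<Otimes>\<^sub>M \<nu>)"
        by measurable
      then show "(\<lambda>(x, z). quadrant (fst (a (fst x)), snd (a (fst x))) z) \<in> borel_measurable (?L \<Otimes>\<^sub>M \<nu>)"
        by (simp add: case_prod_beta')
    qed
    moreover have "(\<integral>z. quadrant (fst (a (fst x)), snd (a (fst x))) z \<partial>\<nu>) = C (fst (a (fst x))) (snd (a (fst x)))"
      if "x \<in> space ?L" for x
      using unit_box_in_square[of "a (fst x)"] measurable_space[OF a' that] by (intro integral_quadrant) auto
    ultimately show ?thesis by (subst measurable_cong[symmetric]) auto
  qed
  then have "(\<lambda>x. \<bar>remainder (a (fst x)) n (snd x)\<bar>) \<in> borel_measurable ?L"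
    unfolding remainder_def
    by (intro borel_measurable_abs borel_measurable_diff borel_measurable_times borel_measurable_const
      emp_lin_measurable_joint[OF a' measurable_snd] emp_copula_measurable_joint measurable_snd
      measurable_compose[OF a' fst_box_measurable] measurable_compose[OF a' snd_box_measurable])
  then show "(\<lambda>(p, \<omega>). \<bar>remainder (a p) n \<omega>\<bar>) \<in> borel_measurable ?L" by (simp add: case_prod_beta')
qed

text \<open>The difference of absolute values is at most the absolute value of the difference
  \<open>f\<close>, and Fubini's theorem lets the mean be taken at fixed p. There \<open>f\<close>
  splits into two remainders, which yield the term in n, and the increment of the linear part from p
  to its midpoint, which yields the term in m.\<close>

lemma expectation_discretisation:
  assumes sym: "\<And>u v. u \<in> {0..1} \<Longrightarrow> v \<in> {0..1} \<Longrightarrow> C u v = C v u"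
  defines "W \<equiv> \<lambda>n \<omega>. \<integral>p. \<bar>H p n \<omega>\<bar> \<partial>box_measure"
    and "D \<equiv> \<lambda>m n \<omega>. \<Sum>g\<in>mesh m. mesh_weight m g * \<bar>emp (asym g) n \<omega>\<bar>"
  shows "W n \<in> borel_measurable M" "D m n \<in> borel_measurable M"
    "integrable M (\<lambda>\<omega>. W n \<omega> - D m n \<omega>)"
    "expectation (\<lambda>\<omega>. \<bar>W n \<omega> - D m n \<omega>\<bar>) \<le>
      (\<integral>p. mean_remainder n p + mean_remainder n (prod.swap p) \<partial>box_measure)
      + (\<integral>p. modulus m p \<partial>box_measure)"
proof -
  interpret P: pair_prob_space M box_measure ..
  define f where "f \<omega> p = H p n \<omega> - emp (asym (proj m p)) n \<omega>" for \<omega> p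
  define B where "B = sqrt (real n) + 2 * (2 + 4 * K) * sqrt (real n)"
  have D_eq: "D m n \<omega> = (\<integral>p. \<bar>emp (asym (proj m p)) n \<omega>\<bar> \<partial>box_measure)" for \<omega>
    unfolding D_def by (rule integral_proj[symmetric])
  have H_m: "(\<lambda>x. H (a x) n (w x)) \<in> borel_measurable L"
    if "a \<in> measurable L box_measure" "w \<in> measurable L M" for a w and L :: "'c measure"
    using H_measurable_joint[OF measurable_compose[OF that(1) fst_box_measurable]
        measurable_compose[OF that(1) snd_box_measurable] that(2)] by simp
  have e_m: "(\<lambda>x. emp (asym (proj m (a x))) n (w x)) \<in> borel_measurable L"
    if "a \<in> measurable L box_measure" "w \<in> measurable L M" for a w and L :: "'c measure"
    by (intro emp_asym_measurable_joint measurable_compose[OF that(1) proj_measurable] that)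
  have Wm: "W n \<in> borel_measurable M"
    unfolding W_def
  proof (rule box.borel_measurable_lebesgue_integral)
    show "(\<lambda>(\<omega>, p). \<bar>H p n \<omega>\<bar>) \<in> borel_measurable (M \<Otimes>\<^sub>M box_measure)"
      using H_m[OF measurable_snd measurable_fst] by (simp add: case_prod_beta')
  qed
  have Dm: "D m n \<in> borel_measurable M"
    unfolding D_def
    by (intro borel_measurable_sum borel_measurable_times borel_measurable_const borel_measurable_abs emp_measurable asym_measurable)
  have fm: "case_prod f \<in> borel_measurable (M \<Otimes>\<^sub>M box_measure)"
    using borel_measurable_diff[OF H_m[OF measurable_snd measurable_fst] e_m[OF measurable_snd measurable_fst]]
    by (simp add: case_prod_beta' f_def[abs_def])
  have eb: "\<bar>emp (asym g) n \<omega>\<bar> \<le> 2 * (2 + 4 * K) * sqrt (real n)" if "g \<in> unit_box" for g \<omega>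
    by (intro emp_bound asym_measurable asym_bound that)
  have fb: "\<bar>f \<omega> p\<bar> \<le> B" if "p \<in> unit_box" for \<omega> p
    using H_bound[of p n \<omega>] eb[OF proj_in_box[OF that], of m \<omega>] unfolding f_def B_def by linarith
  have fint: "integrable (M \<Otimes>\<^sub>M box_measure) (\<lambda>x. \<bar>case_prod f x\<bar>)"
    using fb by (intro P.integrable_const_bound[of _ B] AE_I2 borel_measurable_abs fm)
      (auto simp: space_pair_measure)
  have id: "(\<lambda>p. p) \<in> measurable box_measure box_measure" by simp
  have WD: "\<bar>W n \<omega> - D m n \<omega>\<bar> \<le> (\<integral>p. \<bar>f \<omega> p\<bar> \<partial>box_measure)" if \<omega>: "\<omega> \<in> space M" for \<omega>
  proof -
    have c: "(\<lambda>_. \<omega>) \<in> measurable box_measure M" using \<omega> by simp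
    have 1: "integrable box_measure (\<lambda>p. \<bar>H p n \<omega>\<bar>)"
      using H_bound by (intro box.integrable_const_bound[of _ "sqrt (real n)"] AE_I2 borel_measurable_abs H_m[OF id c]) auto
    have 2: "integrable box_measure (\<lambda>p. \<bar>emp (asym (proj m p)) n \<omega>\<bar>)"
      using eb proj_in_box
      by (intro box.integrable_const_bound[of _ "2 * (2 + 4 * K) * sqrt (real n)"] AE_I2 borel_measurable_abs e_m[OF id c]) auto
    have 3: "integrable box_measure (\<lambda>p. \<bar>f \<omega> p\<bar>)"
      unfolding f_def using fb[unfolded f_def]
      by (intro box.integrable_const_bound[of _ B] AE_I2 borel_measurable_abs borel_measurable_diff e_m[OF id c] H_m[OF id c]) auto
    have "\<bar>W n \<omega> - D m n \<omega>\<bar> = \<bar>\<integral>p. \<bar>H p n \<omega>\<bar> - \<bar>emp (asym (proj m p)) n \<omega>\<bar> \<partial>box_measure\<bar>"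
      unfolding W_def D_eq using 1 2 by simp
    also have "\<dots> \<le> (\<integral>p. \<bar>\<bar>H p n \<omega>\<bar> - \<bar>emp (asym (proj m p)) n \<omega>\<bar>\<bar> \<partial>box_measure)"
      by (rule integral_abs_bound)
    also have "\<dots> \<le> (\<integral>p. \<bar>f \<omega> p\<bar> \<partial>box_measure)"
      by (rule integral_mono[OF integrable_abs[OF Bochner_Integration.integrable_diff[OF 1 2]] 3])
        (simp add: f_def)
    finally show ?thesis .
  qed
  have If: "integrable M (\<lambda>\<omega>. \<integral>p. \<bar>f \<omega> p\<bar> \<partial>box_measure)"
    using P.integrable_fst'[OF fint] by simp
  show "W n \<in> borel_measurable M" "D m n \<in> borel_measurable M" by fact+
  show Wint: "integrable M (\<lambda>\<omega>. W n \<omega> - D m n \<omega>)"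
    using WD by (intro Bochner_Integration.integrable_bound[OF If] borel_measurable_diff Wm Dm AE_I2)
      (auto intro: order_trans[OF _ abs_ge_self])
  let ?\<rho> = "\<lambda>p. mean_remainder n p + mean_remainder n (prod.swap p)"
  have rb: "integrable M (remainder p n)" "mean_remainder n p \<le> 2 * K + 4" if "p \<in> unit_box" for p
    using remainder_bound[of "fst p" "snd p" n] that by (auto simp: unit_box_def)
  have rho_int: "integrable box_measure ?\<rho>"
  proof (rule box.integrable_const_bound)
    show "AE p in box_measure. norm (?\<rho> p) \<le> (2 * K + 4) + (2 * K + 4)"
    proof (intro AE_I2)
      fix p assume "p \<in> space box_measure"
      then have p: "p \<in> unit_box" by simp
      have "?\<rho> p \<le> (2 * K + 4) + (2 * K + 4)" by (intro add_mono rb unit_box_swap p)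
      moreover have "0 \<le> ?\<rho> p" by (intro add_nonneg_nonneg mean_remainder_nonneg)
      ultimately show "norm (?\<rho> p) \<le> (2 * K + 4) + (2 * K + 4)" by simp
    qed
    show "?\<rho> \<in> borel_measurable box_measure"
      by (intro borel_measurable_add expectation_remainder_measurable id swap_box_measurable)
  qed
  have mod_int: "integrable box_measure (modulus m)"
    using modulus_bounds by (intro box.integrable_const_bound[of _ "4 + 8 * K"] AE_I2 modulus_measurable) auto
  \<comment> \<open>The symmetry of C enters here: the centrings at p and at the reflected point are
    equal and drop out.\<close>
  have Hdec: "f \<omega> p = (emp (asym p) n \<omega> - emp (asym (proj m p)) n \<omega>) + (remainder p n \<omega> - remainder (prod.swap p) n \<omega>)"
    if p: "p \<in> unit_box" for p \<omega>
  proof -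
    have "C (fst p) (snd p) = C (snd p) (fst p)" using unit_box_in_square[OF p] sym by auto
    then show ?thesis
      unfolding f_def H_def remainder_def emp_asym[OF p] by (simp add: algebra_simps)
  qed
  have Ef: "expectation (\<lambda>\<omega>. \<bar>f \<omega> p\<bar>) \<le> ?\<rho> p + modulus m p" if p: "p \<in> unit_box" for p
  proof -
    have i1: "integrable M (\<lambda>\<omega>. emp (asym p) n \<omega> - emp (asym (proj m p)) n \<omega>)"
      by (intro Bochner_Integration.integrable_diff emp_abs(1)[OF asym_measurable asym_bound] p proj_in_box)
    note i2 = rb(1)[OF p] and i3 = rb(1)[OF unit_box_swap[OF p]]
    have "expectation (\<lambda>\<omega>. \<bar>f \<omega> p\<bar>) \<le> expectation (\<lambda>\<omega>. \<bar>emp (asym p) n \<omega> - emp (asym (proj m p)) n \<omega>\<bar> + (\<bar>remainder p n \<omega>\<bar> + \<bar>remainder (prod.swap p) n \<omega>\<bar>))"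
      unfolding Hdec[OF p]
      by (intro integral_mono integrable_abs Bochner_Integration.integrable_add Bochner_Integration.integrable_diff[of M "remainder p n"] i1 i2 i3) linarith
    also have "\<dots> = expectation (\<lambda>\<omega>. \<bar>emp (asym p) n \<omega> - emp (asym (proj m p)) n \<omega>\<bar>) + ?\<rho> p"
      using integrable_abs[OF i1] integrable_abs[OF i2] integrable_abs[OF i3] unfolding mean_remainder_def
      by (subst Bochner_Integration.integral_add) auto
    also have "\<dots> \<le> modulus m p + ?\<rho> p" by (intro add_right_mono expectation_emp_asym_proj p)
    finally show ?thesis by simp
  qed
  have "expectation (\<lambda>\<omega>. \<bar>W n \<omega> - D m n \<omega>\<bar>) \<le> expectation (\<lambda>\<omega>. \<integral>p. \<bar>f \<omega> p\<bar> \<partial>box_measure)"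
    by (intro integral_mono integrable_abs Wint If WD)
  also have "\<dots> = (\<integral>p. expectation (\<lambda>\<omega>. \<bar>f \<omega> p\<bar>) \<partial>box_measure)"
    by (rule P.Fubini_integral[symmetric]) (use fint in \<open>simp add: case_prod_beta'\<close>)
  also have "\<dots> \<le> (\<integral>p. ?\<rho> p + modulus m p \<partial>box_measure)"
  proof (rule integral_mono)
    show "integrable box_measure (\<lambda>p. expectation (\<lambda>\<omega>. \<bar>f \<omega> p\<bar>))"
      using P.integrable_snd[of "\<lambda>\<omega> p. \<bar>f \<omega> p\<bar>"] fint by (simp add: case_prod_beta')
  qed (use Ef rho_int mod_int in auto)
  also have "\<dots> = (\<integral>p. ?\<rho> p \<partial>box_measure) + (\<integral>p. modulus m p \<partial>box_measure)"
    using rho_int mod_int by simp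
  finally show "expectation (\<lambda>\<omega>. \<bar>W n \<omega> - D m n \<omega>\<bar>) \<le> (\<integral>p. ?\<rho> p \<partial>box_measure) + (\<integral>p. modulus m p \<partial>box_measure)" .
qed

text \<open>Convergence is known at every point of the open box, and the uniform bound on the mean
  remainder dominates.\<close>

lemma integral_remainder_tendsto:
  "(\<lambda>n. \<integral>p. mean_remainder n p + mean_remainder n (prod.swap p) \<partial>box_measure) \<longlonglongrightarrow> 0"
proof -
  let ?\<rho> = "\<lambda>n p. mean_remainder n p + mean_remainder n (prod.swap p)"
  have t: "(\<lambda>n. mean_remainder n p) \<longlonglongrightarrow> 0"
    and rb: "mean_remainder n p \<le> 2 * K + 4" if "p \<in> unit_box" for p n
    using expectation_remainder_tendsto[of "fst p" "snd p"] remainder_bound(2)[of "fst p" "snd p" n] that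
    by (auto simp: unit_box_def)
  have "(\<lambda>n. \<integral>p. ?\<rho> n p \<partial>box_measure) \<longlonglongrightarrow> (\<integral>p. 0 \<partial>box_measure)"
  proof (rule integral_dominated_convergence[where w = "\<lambda>_. (2 * K + 4) + (2 * K + 4)"])
    show "AE p in box_measure. (\<lambda>n. ?\<rho> n p) \<longlonglongrightarrow> 0"
    proof (intro AE_I2)
      fix p assume "p \<in> space box_measure"
      then have "(\<lambda>n. ?\<rho> n p) \<longlonglongrightarrow> 0 + 0" by (intro tendsto_add t unit_box_swap) auto
      then show "(\<lambda>n. ?\<rho> n p) \<longlonglongrightarrow> 0" by simp
    qed
    show "AE p in box_measure. norm (?\<rho> n p) \<le> (2 * K + 4) + (2 * K + 4)" for n
    proof (intro AE_I2)
      fix p assume "p \<in> space box_measure"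
      then have "?\<rho> n p \<le> (2 * K + 4) + (2 * K + 4)" by (intro add_mono rb unit_box_swap) auto
      moreover have "0 \<le> ?\<rho> n p" by (intro add_nonneg_nonneg mean_remainder_nonneg)
      ultimately show "norm (?\<rho> n p) \<le> (2 * K + 4) + (2 * K + 4)" by simp
    qed
    show "(\<lambda>p. ?\<rho> n p) \<in> borel_measurable box_measure" for n
      by (intro borel_measurable_add expectation_remainder_measurable swap_box_measurable) simp
  qed simp_all
  then show ?thesis by simp
qed

section \<open>The limiting process\<close>

text \<open>A copy of the bridge among the square integrable functions of \<nu>: on the square these
  functions have the covariance of B.\<close>

definition bridge_fun :: "real \<times> real \<Rightarrow> real \<times> real \<Rightarrow> real" where
  "bridge_fun r z = quadrant r z - C (fst r) (snd r)"

lemma integral_bridge_fun: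
  assumes "r \<in> unit_square" "s \<in> unit_square"
  shows "integrable \<nu> (\<lambda>z. bridge_fun r z * bridge_fun s z)"
    "(\<integral>z. bridge_fun r z * bridge_fun s z \<partial>\<nu>) =
      C (min (fst r) (fst s)) (min (snd r) (snd s)) - C (fst r) (snd r) * C (fst s) (snd s)"
proof -
  have e: "bridge_fun r z * bridge_fun s z = quadrant (min (fst r) (fst s), min (snd r) (snd s)) z
     - C (fst s) (snd s) * quadrant r z - C (fst r) (snd r) * quadrant s z + C (fst r) (snd r) * C (fst s) (snd s)" for z
    unfolding bridge_fun_def quadrant_mult[symmetric] by (simp add: algebra_simps)
  show "integrable \<nu> (\<lambda>z. bridge_fun r z * bridge_fun s z)" unfolding e by simp
  have "\<nu>.expectation (quadrant r) = C (fst r) (snd r)" "\<nu>.expectation (quadrant s) = C (fst s) (snd s)"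
    using integral_quadrant[of "fst r" "snd r"] integral_quadrant[of "fst s" "snd s"] assms by auto
  then show "(\<integral>z. bridge_fun r z * bridge_fun s z \<partial>\<nu>) =
      C (min (fst r) (fst s)) (min (snd r) (snd s)) - C (fst r) (snd r) * C (fst s) (snd s)"
    unfolding e using integral_quadrant[of "min (fst r) (fst s)" "min (snd r) (snd s)"] assms \<nu>.prob_space
    by (simp add: mem_Times_iff min_def)
qed

text \<open>The three terms of the limit process, indexed by k < 3, so that a combination of its
  values becomes a combination of bridge values over pairs (g, k).\<close>

definition bridge_coeff :: "real \<times> real \<Rightarrow> nat \<Rightarrow> real" where
  "bridge_coeff g k = (if k = 0 then 1 else if k = 1 then - partial1 C (fst g) (snd g) else - partial2 C (fst g) (snd g))"

definition bridge_point :: "real \<times> real \<Rightarrow> nat \<Rightarrow> real \<times> real" where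
  "bridge_point g k = (if k = 0 then g else if k = 1 then (fst g, 1) else (1, snd g))"

lemma sum_bridge_coeff:
  "(\<Sum>k<3. bridge_coeff g k * F (bridge_point g k)) =
    F g - partial1 C (fst g) (snd g) * F (fst g, 1) - partial2 C (fst g) (snd g) * F (1, snd g)"
  by (simp add: numeral_3_eq_3 bridge_coeff_def bridge_point_def)

text \<open>The same three-term formula leads from \<open>bridge_fun\<close> to the centred
  \<open>lin\<close> as from the bridge to the limit process.\<close>

lemma lin_centred:
  assumes "g \<in> unit_box"
  shows "lin g z - (\<integral>z. lin g z \<partial>\<nu>) = (\<Sum>k<3. bridge_coeff g k * bridge_fun (bridge_point g k) z)"
proof -
  have int: "(\<integral>z. lin g z \<partial>\<nu>) = C (fst g) (snd g) - partial1 C (fst g) (snd g) * fst g - partial2 C (fst g) (snd g) * snd g"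
    using integral_quadrant[of "fst g" "snd g"] unit_box_in_square[OF assms]
    by (simp add: lin_def[abs_def] integral_quadrant margins)
  show ?thesis
    unfolding int sum_bridge_coeff[of g "\<lambda>r. bridge_fun r z"]
    using unit_box_in_square[OF assms] by (simp add: lin_def bridge_fun_def margins algebra_simps)
qed

text \<open>Both sides are quadratic forms with the same coefficients, one in the covariances of the
  bridge and one in those of \<open>bridge_fun\<close>, and these agree.\<close>

lemma limit_process_variance:
  fixes N :: "'b measure" and G :: "real \<times> real \<Rightarrow> 'b \<Rightarrow> real"
  assumes "prob_space N" and lim: "copula_limit_process N C G" and F: "finite F" "F \<subseteq> unit_box"
  shows "(\<integral>\<omega>. (\<Sum>g\<in>F. a g * G g \<omega>)\<^sup>2 \<partial>N) = (\<integral>z. (\<Sum>g\<in>F. a g * (lin g z - (\<integral>z. lin g z \<partial>\<nu>)))\<^sup>2 \<partial>\<nu>)"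
proof -
  interpret N: prob_space N by fact
  obtain B where B: "copula_bridge N C B" and GB: "\<forall>u\<in>{0..1}. \<forall>v\<in>{0..1}. AE \<omega> in N.
       G (u, v) \<omega> = B (u, v) \<omega> - partial1 C u v * B (u, 1) \<omega> - partial2 C u v * B (1, v) \<omega>"
    using lim unfolding copula_limit_process_def by blast
  have Bg: "centred_gaussian_process N unit_square B"
    and cov: "\<And>r s. r \<in> unit_square \<Longrightarrow> s \<in> unit_square \<Longrightarrow> integral\<^sup>L N (\<lambda>\<omega>. B r \<omega> * B s \<omega>)
        = C (min (fst r) (fst s)) (min (snd r) (snd s)) - C (fst r) (snd r) * C (fst s) (snd s)"
    using B unfolding copula_bridge_def by force+
  note Bsq = centred_gaussian_process_sq_integrable[OF \<open>prob_space N\<close> Bg]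
  have Bint: "integrable N (\<lambda>\<omega>. B r \<omega> * B s \<omega>)" if "r \<in> unit_square" "s \<in> unit_square" for r s
  proof (rule Bochner_Integration.integrable_bound)
    show "integrable N (\<lambda>\<omega>. (B r \<omega>)\<^sup>2 + (B s \<omega>)\<^sup>2)" using Bsq(2) that by auto
    show "(\<lambda>\<omega>. B r \<omega> * B s \<omega>) \<in> borel_measurable N" using Bsq(1) that by (intro borel_measurable_times)
    have "\<bar>x * y\<bar> \<le> x\<^sup>2 + y\<^sup>2" for x y :: real
    proof -
      have "2 * (\<bar>x\<bar> * \<bar>y\<bar>) \<le> x\<^sup>2 + y\<^sup>2"
        using sum_squares_bound[of "\<bar>x\<bar>" "\<bar>y\<bar>"] by (simp add: mult.assoc)
      moreover have "0 \<le> \<bar>x\<bar> * \<bar>y\<bar>" by simp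
      ultimately show ?thesis unfolding abs_mult by linarith
    qed
    then show "AE \<omega> in N. norm (B r \<omega> * B s \<omega>) \<le> norm ((B r \<omega>)\<^sup>2 + (B s \<omega>)\<^sup>2)" by simp
  qed
  have pts: "bridge_point g k \<in> unit_square" if "g \<in> F" for g k
    using unit_box_in_square[of g] F(2) that by (auto simp: bridge_point_def mem_Times_iff)
  \<comment> \<open>Pairs rather than points: elements of F with a common coordinate share a
    marginal point, and each occurrence carries its own coefficient.\<close>
  let ?I = "F \<times> {..<3::nat}"
  let ?c = "\<lambda>(g, k). a g * bridge_coeff g k" and ?r = "\<lambda>(g, k). bridge_point g k"
  have rI: "?r i \<in> unit_square" if "i \<in> ?I" for i
    using pts[of "fst i" "snd i"] that by (simp only: case_prod_beta' mem_Times_iff)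
  have expand: "(\<Sum>g\<in>F. a g * (\<Sum>k<3. bridge_coeff g k * f (bridge_point g k))) = (\<Sum>i\<in>?I. ?c i * f (?r i))" for f :: "real \<times> real \<Rightarrow> real"
    by (simp add: sum_distrib_left sum.cartesian_product mult_ac case_prod_beta')
  have ae: "AE \<omega> in N. \<forall>g\<in>F. G g \<omega> = (\<Sum>k<3. bridge_coeff g k * B (bridge_point g k) \<omega>)"
  proof (intro AE_finite_allI F)
    fix g assume "g \<in> F"
    then have "fst g \<in> {0..1}" "snd g \<in> {0..1}" using F(2) unit_box_in_square by blast+
    then show "AE \<omega> in N. G g \<omega> = (\<Sum>k<3. bridge_coeff g k * B (bridge_point g k) \<omega>)"
      using GB unfolding sum_bridge_coeff[where F = "\<lambda>r. B r _"] by force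
  qed
  have Gm: "G g \<in> borel_measurable N" if "g \<in> F" for g
  proof (rule centred_gaussian_process_sq_integrable(1)[OF \<open>prob_space N\<close>])
    show "centred_gaussian_process N unit_square G" using lim by (simp add: copula_limit_process_def)
    show "g \<in> unit_square" using F(2) that by (auto simp: unit_box_def)
  qed
  have "(\<integral>\<omega>. (\<Sum>g\<in>F. a g * G g \<omega>)\<^sup>2 \<partial>N) = (\<integral>\<omega>. (\<Sum>i\<in>?I. ?c i * B (?r i) \<omega>)\<^sup>2 \<partial>N)"
  proof (rule integral_cong_AE)
    show "(\<lambda>\<omega>. (\<Sum>g\<in>F. a g * G g \<omega>)\<^sup>2) \<in> borel_measurable N"
      using Gm by (intro borel_measurable_power borel_measurable_sum borel_measurable_times) auto
    show "(\<lambda>\<omega>. (\<Sum>i\<in>?I. ?c i * B (?r i) \<omega>)\<^sup>2) \<in> borel_measurable N"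
      by (intro borel_measurable_power borel_measurable_sum borel_measurable_times borel_measurable_const Bsq(1) rI)
    show "AE \<omega> in N. (\<Sum>g\<in>F. a g * G g \<omega>)\<^sup>2 = (\<Sum>i\<in>?I. ?c i * B (?r i) \<omega>)\<^sup>2"
      using ae
    proof eventually_elim
      case (elim \<omega>)
      then have "(\<Sum>g\<in>F. a g * G g \<omega>) = (\<Sum>g\<in>F. a g * (\<Sum>k<3. bridge_coeff g k * B (bridge_point g k) \<omega>))" by simp
      also have "\<dots> = (\<Sum>i\<in>?I. ?c i * B (?r i) \<omega>)" by (rule expand[of "\<lambda>r. B r \<omega>"])
      finally show ?case by simp
    qed
  qed
  also have "\<dots> = (\<Sum>i\<in>?I. \<Sum>j\<in>?I. ?c i * ?c j * (\<integral>\<omega>. B (?r i) \<omega> * B (?r j) \<omega> \<partial>N))"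
    by (intro integral_square_lincomb Bint rI)
  also have "\<dots> = (\<Sum>i\<in>?I. \<Sum>j\<in>?I. ?c i * ?c j * (\<integral>z. bridge_fun (?r i) z * bridge_fun (?r j) z \<partial>\<nu>))"
    by (intro sum.cong refl) (simp only: cov[OF rI rI] integral_bridge_fun(2)[OF rI rI])
  also have "\<dots> = (\<integral>z. (\<Sum>i\<in>?I. ?c i * bridge_fun (?r i) z)\<^sup>2 \<partial>\<nu>)"
    by (intro integral_square_lincomb[symmetric] integral_bridge_fun(1) rI)
  also have "\<dots> = (\<integral>z. (\<Sum>g\<in>F. a g * (lin g z - (\<integral>z. lin g z \<partial>\<nu>)))\<^sup>2 \<partial>\<nu>)"
  proof (intro Bochner_Integration.integral_cong refl)
    fix z
    have "(\<Sum>g\<in>F. a g * (lin g z - (\<integral>z. lin g z \<partial>\<nu>))) = (\<Sum>g\<in>F. a g * (\<Sum>k<3. bridge_coeff g k * bridge_fun (bridge_point g k) z))"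
      using F(2) by (intro sum.cong) (auto simp: lin_centred subset_iff)
    also have "\<dots> = (\<Sum>i\<in>?I. ?c i * bridge_fun (?r i) z)" by (rule expand[of "\<lambda>r. bridge_fun r z"])
    finally show "(\<Sum>i\<in>?I. ?c i * bridge_fun (?r i) z)\<^sup>2 = (\<Sum>g\<in>F. a g * (lin g z - (\<integral>z. lin g z \<partial>\<nu>)))\<^sup>2" by simp
  qed
  finally show ?thesis .
qed

text \<open>By linearity the combination is the empirical process at one bounded function, to which
  the one-dimensional central limit theorem applies; its variance is that of the Gaussian
  combination.\<close>

lemma emp_lin_char_tendsto:
  fixes N :: "'b measure" and G :: "real \<times> real \<Rightarrow> 'b \<Rightarrow> real"
  assumes "prob_space N" and lim: "copula_limit_process N C G" and F: "finite F" "F \<subseteq> unit_box"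
  shows "(\<lambda>n. \<integral>\<omega>. iexp (\<Sum>g\<in>F. a g * emp (lin g) n \<omega>) \<partial>M) \<longlonglongrightarrow> (\<integral>\<omega>. iexp (\<Sum>g\<in>F. a g * G g \<omega>) \<partial>N)"
proof -
  define f where "f z = (\<Sum>g\<in>F. a g * lin g z)" for z
  have li: "integrable \<nu> (lin g)" if "g \<in> F" for g using that F(2) by (intro lin_integrable) auto
  have fm: "f \<in> borel_measurable borel" unfolding f_def[abs_def] by measurable
  have fb: "\<bar>f z\<bar> \<le> (\<Sum>g\<in>F. \<bar>a g\<bar> * (1 + 2 * K))" for z
    unfolding f_def using F(2)
    by (intro order_trans[OF sum_abs] sum_mono) (auto simp: abs_mult intro!: mult_left_mono lin_bound)
  have femp: "emp f n \<omega> = (\<Sum>g\<in>F. a g * emp (lin g) n \<omega>)" for n \<omega>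
    unfolding f_def[abs_def] using li by (subst emp_sum) (auto simp: emp_scale)
  have "(\<integral>z. f z \<partial>\<nu>) = (\<Sum>g\<in>F. a g * (\<integral>z. lin g z \<partial>\<nu>))"
    unfolding f_def using li by simp
  then have fc: "f z - (\<integral>z. f z \<partial>\<nu>) = (\<Sum>g\<in>F. a g * (lin g z - (\<integral>z. lin g z \<partial>\<nu>)))" for z
    by (simp add: f_def sum_subtractf right_diff_distrib)
  have gauss: "centred_gaussian_process N unit_square G" using lim by (simp add: copula_limit_process_def)
  have "F \<subseteq> unit_square" using F(2) by (auto simp: unit_box_def)
  from centred_gaussian_process_char[OF \<open>prob_space N\<close> gauss F(1) this, of a]
  have "(\<integral>\<omega>. iexp (\<Sum>g\<in>F. a g * G g \<omega>) \<partial>N) = exp (- (complex_of_real (\<integral>z. (f z - (\<integral>z. f z \<partial>\<nu>))\<^sup>2 \<partial>\<nu>) / 2))"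
    unfolding limit_process_variance[OF assms] fc by (simp add: exp_of_real[symmetric])
  with emp_char[OF fm fb] show ?thesis unfolding femp by simp
qed

lemma mesh_char_tendsto:
  fixes N :: "'b measure" and G :: "real \<times> real \<Rightarrow> 'b \<Rightarrow> real"
  assumes N: "prob_space N" and lim: "copula_limit_process N C G"
  shows "(\<lambda>n. \<integral>\<omega>. iexp (t * (\<Sum>g\<in>mesh m. mesh_weight m g * \<bar>emp (asym g) n \<omega>\<bar>)) \<partial>M)
    \<longlonglongrightarrow> (\<integral>\<omega>. iexp (t * (\<Sum>g\<in>mesh m. mesh_weight m g * \<bar>G g \<omega> - G (prod.swap g) \<omega>\<bar>)) \<partial>N)"
proof -
  interpret N: prob_space N by fact
  have gauss: "centred_gaussian_process N unit_square G" using lim by (simp add: copula_limit_process_def)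
  note Gs = centred_gaussian_process_sq_integrable[OF N gauss]
  have sq: "g \<in> unit_square" "prod.swap g \<in> unit_square" "g \<in> unit_box" "prod.swap g \<in> unit_box" if "g \<in> mesh m" for g
    using mesh_subset[of m] that by (auto simp: unit_box_def)
  define Y where "Y g \<omega> = G g \<omega> - G (prod.swap g) \<omega>" for g \<omega>
  have Ym: "Y g \<in> borel_measurable N" if "g \<in> mesh m" for g
    unfolding Y_def[abs_def] using Gs(1) sq[OF that] by (intro borel_measurable_diff) auto
  have Y2: "integrable N (\<lambda>\<omega>. (Y g \<omega>)\<^sup>2)" if "g \<in> mesh m" for g
  proof (rule Bochner_Integration.integrable_bound)
    show "integrable N (\<lambda>\<omega>. 2 * (G g \<omega>)\<^sup>2 + 2 * (G (prod.swap g) \<omega>)\<^sup>2)" using Gs(2) sq[OF that] by auto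
    show "(\<lambda>\<omega>. (Y g \<omega>)\<^sup>2) \<in> borel_measurable N" using Ym[OF that] by (intro borel_measurable_power)
    have "(x - y)\<^sup>2 \<le> 2 * x\<^sup>2 + 2 * y\<^sup>2" for x y :: real
    proof -
      have "0 \<le> (x + y)\<^sup>2" by simp
      then show ?thesis by (simp add: power2_eq_square algebra_simps)
    qed
    then show "AE \<omega> in N. norm ((Y g \<omega>)\<^sup>2) \<le> norm (2 * (G g \<omega>)\<^sup>2 + 2 * (G (prod.swap g) \<omega>)\<^sup>2)"
      by (simp add: Y_def)
  qed
  \<comment> \<open>One constant for both families: the first summand bounds the sample side for
    every n, the sum bounds each Gaussian second moment.\<close>
  define K' where "K' = (2 + 4 * K)\<^sup>2 + (\<Sum>g\<in>mesh m. \<integral>\<omega>. (Y g \<omega>)\<^sup>2 \<partial>N)"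
  have Ynn: "0 \<le> (\<integral>\<omega>. (Y g \<omega>)\<^sup>2 \<partial>N)" for g by simp
  have Y2': "(\<integral>\<omega>. (Y g \<omega>)\<^sup>2 \<partial>N) \<le> K'" if "g \<in> mesh m" for g
    unfolding K'_def using member_le_sum[OF that, of "\<lambda>g. \<integral>\<omega>. (Y g \<omega>)\<^sup>2 \<partial>N"] Ynn by (simp add: add_increasing)
  have X2: "expectation (\<lambda>\<omega>. (emp (asym g) n \<omega>)\<^sup>2) \<le> K'" if "g \<in> mesh m" for g n
  proof -
    note b = asym_bound[OF sq(3)[OF that]]
    have "(\<integral>z. (asym g z)\<^sup>2 \<partial>\<nu>) \<le> (\<integral>z. (2 + 4 * K)\<^sup>2 \<partial>\<nu>)"
    proof (rule integral_mono)
      have le: "(asym g z)\<^sup>2 \<le> (2 + 4 * K)\<^sup>2" for z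
        using b[of z] K_nonneg by (metis abs_ge_zero abs_of_nonneg abs_le_square_iff order_trans)
      then show "asym g z ^ 2 \<le> (2 + 4 * K)\<^sup>2" for z .
      show "integrable \<nu> (\<lambda>z. (asym g z)\<^sup>2)"
        by (rule \<nu>_integrable[of _ "(2 + 4 * K)\<^sup>2"]) (use le in auto)
    qed simp
    also have "\<dots> = (2 + 4 * K)\<^sup>2" using \<nu>.prob_space by simp
    also have "\<dots> \<le> K'" unfolding K'_def using Ynn by (simp add: sum_nonneg)
    finally show ?thesis using emp_square(2)[OF asym_measurable b, of n] by linarith
  qed
  have "(\<lambda>n. \<integral>\<omega>. iexp (\<Sum>g\<in>mesh m. (t * mesh_weight m g) * \<bar>emp (asym g) n \<omega>\<bar>) \<partial>M)
    \<longlonglongrightarrow> (\<integral>\<omega>. iexp (\<Sum>g\<in>mesh m. (t * mesh_weight m g) * \<bar>Y g \<omega>\<bar>) \<partial>N)"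
  proof (rule tendsto_char_sum_abs[OF prob_space_axioms N finite_mesh, where K = K'])
    fix s :: "real \<times> real \<Rightarrow> real"
    \<comment> \<open>Antisymmetrised coefficients turn both sides into combinations of
      undifferenced values, whose characteristic functions are known to converge.\<close>
    have 1: "(\<Sum>g\<in>mesh m. s g * emp (asym g) n \<omega>) = (\<Sum>g\<in>mesh m. (s g - s (prod.swap g)) * emp (lin g) n \<omega>)" for n \<omega>
      using sq by (subst sum_swap_diff[OF mesh_swap, symmetric]) (simp add: emp_asym cong: sum.cong)
    have 2: "(\<Sum>g\<in>mesh m. s g * Y g \<omega>) = (\<Sum>g\<in>mesh m. (s g - s (prod.swap g)) * G g \<omega>)" for \<omega>
      unfolding Y_def by (rule sum_swap_diff[OF mesh_swap])
    show "(\<lambda>n. \<integral>\<omega>. iexp (\<Sum>g\<in>mesh m. s g * emp (asym g) n \<omega>) \<partial>M) \<longlonglongrightarrow> (\<integral>\<omega>. iexp (\<Sum>g\<in>mesh m. s g * Y g \<omega>) \<partial>N)"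
      unfolding 1 2 by (rule emp_lin_char_tendsto[OF N lim finite_mesh mesh_subset])
  next
    show "\<And>n g. g \<in> mesh m \<Longrightarrow> emp (asym g) n \<in> borel_measurable M"
      by (intro emp_measurable asym_measurable)
    show "\<And>n g. g \<in> mesh m \<Longrightarrow> integrable M (\<lambda>\<omega>. (emp (asym g) n \<omega>)\<^sup>2)"
      by (rule emp_square(1)[OF asym_measurable asym_bound[OF sq(3)]])
  qed (use Ym Y2 Y2' X2 in auto)
  then show ?thesis by (simp add: Y_def sum_distrib_left mult.assoc)
qed

end

section \<open>Convergence for samples with uniform margins\<close>

lemma L1_asymmetry_emp_copula:
  "sqrt (real n) * L1_asymmetry (emp_copula n x y) =
    (\<integral>p. \<bar>sqrt (real n) * (emp_copula n x y (fst p) (snd p) - emp_copula n x y (snd p) (fst p))\<bar> \<partial>box_measure)"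
proof -
  have fs: "(fst :: real \<times> real \<Rightarrow> real) \<in> borel_measurable borel" "(snd :: real \<times> real \<Rightarrow> real) \<in> borel_measurable borel"
    by (intro borel_measurable_continuous_onI continuous_intros)+
  have "closed unit_square" by (intro closed_Times) auto
  then have "unit_square \<in> sets borel" by simp
  then have "(\<lambda>p. indicator unit_square p * \<bar>emp_copula n x y (fst p) (snd p) - emp_copula n x y (snd p) (fst p)\<bar>) \<in> borel_measurable borel"
    by (intro borel_measurable_times borel_measurable_indicator borel_measurable_abs borel_measurable_diff
        emp_copula_measurable borel_measurable_const fs)
  from L1_asymmetry_eq_box[OF this] show ?thesis
    by (simp add: abs_mult)
qed

text \<open>A statement about a single path: when it is continuous, the weighted sums are Riemann
  sums of its asymmetry integral.\<close>

lemma limit_functional_eq: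
  assumes "continuous_on unit_square (\<lambda>p. G p \<omega>)"
  shows "(\<lambda>m. \<Sum>g\<in>mesh m. mesh_weight m g * \<bar>G g \<omega> - G (prod.swap g) \<omega>\<bar>) \<longlonglongrightarrow> limit_functional G \<omega>"
proof -
  have "continuous_on unit_square (\<lambda>p. G (prod.swap p) \<omega>)"
    unfolding prod.swap_def
    by (rule continuous_on_compose2[OF assms]) (auto intro!: continuous_intros)
  then have c: "continuous_on unit_square (\<lambda>p. \<bar>G p \<omega> - G (prod.swap p) \<omega>\<bar>)"
    by (intro continuous_intros assms)
  have "closed unit_square" by (intro closed_Times) auto
  then have "unit_square \<in> sets borel" by simp
  from borel_measurable_continuous_on_indicator[OF this c]
  have "(\<lambda>p. indicator unit_square p * \<bar>G (fst p, snd p) \<omega> - G (snd p, fst p) \<omega>\<bar>) \<in> borel_measurable borel"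
    by (simp add: prod.swap_def)
  from L1_asymmetry_eq_box[OF this] integral_proj_tendsto[OF c]
  show ?thesis by (simp add: limit_functional_def prod.swap_def)
qed

text \<open>The preimages of a Borel set under f and g differ by a null set, which the completion
  makes measurable.\<close>

lemma borel_measurable_completion_AE_eq:
  fixes f g :: "'b \<Rightarrow> real"
  assumes "f \<in> borel_measurable N" "AE \<omega> in N. f \<omega> = g \<omega>"
  shows "g \<in> borel_measurable (completion N)"
proof (rule measurableI)
  fix S :: "real set" assume S: "S \<in> sets borel"
  show "g -` S \<inter> space (completion N) \<in> sets (completion N)"
  proof (rule completion.in_sets_AE)
    show "f -` S \<inter> space (completion N) \<in> sets (completion N)"
      using measurable_sets[OF assms(1) S] by simp
    have "AE \<omega> in N. \<omega> \<in> f -` S \<inter> space (completion N) \<longleftrightarrow> \<omega> \<in> g -` S \<inter> space (completion N)"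
      using assms(2) by eventually_elim auto
    then show "AE \<omega> in completion N. \<omega> \<in> f -` S \<inter> space (completion N) \<longleftrightarrow> \<omega> \<in> g -` S \<inter> space (completion N)"
      by (rule AE_completion)
  qed auto
qed simp

context copula_sample
begin

text \<open>Measurability is recorded along with the limit because the laws of the original and the
  transformed statistic are later identified through almost sure equality.\<close>

lemma asymmetry_converges:
  fixes N :: "'b measure" and G :: "real \<times> real \<Rightarrow> 'b \<Rightarrow> real"
  assumes sym: "\<And>u v. u \<in> {0..1} \<Longrightarrow> v \<in> {0..1} \<Longrightarrow> C u v = C v u"
    and N: "prob_space N" and lim: "copula_limit_process N C G"
  shows "(\<lambda>\<omega>. sqrt (real n) * L1_asymmetry (emp_cop n \<omega>)) \<in> borel_measurable M"
    "converges_in_distribution M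
      (\<lambda>n \<omega>. sqrt (real n) * L1_asymmetry (emp_cop n \<omega>)) N (limit_functional G)"
proof -
  interpret N: prob_space N by fact
  interpret CN: prob_space "completion N" by (rule N.prob_space_completion)
  define W where "W n \<omega> = (\<integral>p. \<bar>H p n \<omega>\<bar> \<partial>box_measure)" for n \<omega>
  define D where "D m n \<omega> = (\<Sum>g\<in>mesh m. mesh_weight m g * \<bar>emp (asym g) n \<omega>\<bar>)" for m n \<omega>
  define E where "E m \<omega> = (\<Sum>g\<in>mesh m. mesh_weight m g * \<bar>G g \<omega> - G (prod.swap g) \<omega>\<bar>)" for m \<omega>
  define L where "L = limit_functional G"
  have W_eq: "(\<lambda>n \<omega>. sqrt (real n) * L1_asymmetry (emp_cop n \<omega>)) = W"
    unfolding L1_asymmetry_emp_copula W_def H_def by (intro ext) simp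
  note disc = expectation_discretisation[OF sym, folded W_def D_def]
  have Wm: "W n \<in> borel_measurable M" for n
    unfolding W_def[abs_def] by (rule expectation_discretisation(1)[OF sym])
  have Dm: "D m n \<in> borel_measurable M" for m n
    unfolding D_def[abs_def] by (rule expectation_discretisation(2)[OF sym])
  show "(\<lambda>\<omega>. sqrt (real n) * L1_asymmetry (emp_cop n \<omega>)) \<in> borel_measurable M"
    using Wm[of n] unfolding W_eq[symmetric] .
  have gauss: "centred_gaussian_process N unit_square G"
    and paths: "AE \<omega> in N. continuous_on unit_square (\<lambda>p. G p \<omega>)"
    using lim by (auto simp: copula_limit_process_def)
  have Em: "E m \<in> borel_measurable N" for m
  proof -
    have "G g \<in> borel_measurable N" "G (prod.swap g) \<in> borel_measurable N" if "g \<in> mesh m" for g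
      using mesh_subset[of m] that
      by (auto intro!: centred_gaussian_process_sq_integrable(1)[OF N gauss] simp: unit_box_def)
    then show ?thesis
      unfolding E_def[abs_def] by (intro borel_measurable_sum borel_measurable_times borel_measurable_abs borel_measurable_diff) auto
  qed
  have EL: "AE \<omega> in N. (\<lambda>m. E m \<omega>) \<longlonglongrightarrow> L \<omega>"
    using paths by eventually_elim (auto simp: E_def L_def intro: limit_functional_eq)
  \<comment> \<open>A version of the limit functional measurable for \<open>N\<close> itself: a
    limit of measurable Riemann sums, equal to L wherever the path is continuous.\<close>
  define L' where "L' \<omega> = lim (\<lambda>m. E m \<omega>)" for \<omega>
  have L'm: "L' \<in> borel_measurable N" unfolding L'_def[abs_def] by (rule borel_measurable_lim_metric[OF Em])
  have LL: "AE \<omega> in N. L' \<omega> = L \<omega>" using EL by eventually_elim (simp add: L'_def limI)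
  have Lm: "L \<in> borel_measurable (completion N)" by (rule borel_measurable_completion_AE_eq[OF L'm LL])
  have iexp_m: "(\<lambda>x. iexp (t * x)) \<in> borel_measurable borel" for t :: real
    by (intro borel_measurable_continuous_onI continuous_intros)
  have char_L: "(\<integral>\<omega>. iexp (t * L \<omega>) \<partial>completion N) = (\<integral>\<omega>. iexp (t * L' \<omega>) \<partial>N)" for t
  proof -
    have "(\<integral>\<omega>. iexp (t * L \<omega>) \<partial>completion N) = (\<integral>\<omega>. iexp (t * L' \<omega>) \<partial>completion N)"
      using AE_completion[OF LL] measurable_compose[OF Lm iexp_m, of t]
        measurable_compose[OF measurable_completion[OF L'm] iexp_m, of t]
      by (intro integral_cong_AE) auto
    also have "\<dots> = (\<integral>\<omega>. iexp (t * L' \<omega>) \<partial>N)"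
      by (rule integral_completion[OF measurable_compose[OF L'm iexp_m]])
    finally show ?thesis .
  qed
  have E_lim: "(\<lambda>m. \<integral>\<omega>. iexp (t * E m \<omega>) \<partial>N) \<longlonglongrightarrow> (\<integral>\<omega>. iexp (t * L' \<omega>) \<partial>N)" for t
  proof (rule integral_dominated_convergence[where w = "\<lambda>_. 1"])
    show "AE \<omega> in N. (\<lambda>m. iexp (t * E m \<omega>)) \<longlonglongrightarrow> iexp (t * L' \<omega>)"
      using EL LL by eventually_elim (intro tendsto_intros, simp)
    show "(\<lambda>\<omega>. iexp (t * L' \<omega>)) \<in> borel_measurable N" by (rule measurable_compose[OF L'm iexp_m])
    show "(\<lambda>\<omega>. iexp (t * E m \<omega>)) \<in> borel_measurable N" for m by (rule measurable_compose[OF Em iexp_m])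
  qed auto
  define \<rho> where "\<rho> n = (\<integral>p. mean_remainder n p + mean_remainder n (prod.swap p) \<partial>box_measure)" for n
  define \<mu> where "\<mu> m = (\<integral>p. modulus m p \<partial>box_measure)" for m
  have \<rho>: "\<rho> \<longlonglongrightarrow> 0" unfolding \<rho>_def[abs_def] by (rule integral_remainder_tendsto)
  have \<mu>: "\<mu> \<longlonglongrightarrow> 0" unfolding \<mu>_def[abs_def] by (rule integral_modulus_tendsto)
  have WD: "norm ((\<integral>\<omega>. iexp (t * W n \<omega>) \<partial>M) - (\<integral>\<omega>. iexp (t * D m n \<omega>) \<partial>M)) \<le> \<bar>t\<bar> * (\<rho> n + \<mu> m)" for t n m
  proof -
    have i: "integrable M (\<lambda>\<omega>. iexp (t * W n \<omega>))" "integrable M (\<lambda>\<omega>. iexp (t * D m n \<omega>))"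
      using Wm Dm by (auto simp del: of_real_mult intro!: integrable_iexp_real borel_measurable_times)
    have "norm ((\<integral>\<omega>. iexp (t * W n \<omega>) \<partial>M) - (\<integral>\<omega>. iexp (t * D m n \<omega>) \<partial>M)) = norm (\<integral>\<omega>. iexp (t * W n \<omega>) - iexp (t * D m n \<omega>) \<partial>M)"
      using i by simp
    also have "\<dots> \<le> (\<integral>\<omega>. norm (iexp (t * W n \<omega>) - iexp (t * D m n \<omega>)) \<partial>M)" by (rule integral_norm_bound)
    also have "\<dots> \<le> (\<integral>\<omega>. \<bar>t\<bar> * \<bar>W n \<omega> - D m n \<omega>\<bar> \<partial>M)"
    proof (rule integral_mono)
      show "integrable M (\<lambda>\<omega>. norm (iexp (t * W n \<omega>) - iexp (t * D m n \<omega>)))"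
        by (intro integrable_norm Bochner_Integration.integrable_diff i)
      show "integrable M (\<lambda>\<omega>. \<bar>t\<bar> * \<bar>W n \<omega> - D m n \<omega>\<bar>)"
        by (intro integrable_mult_right integrable_abs disc(3))
      show "norm (iexp (t * W n \<omega>) - iexp (t * D m n \<omega>)) \<le> \<bar>t\<bar> * \<bar>W n \<omega> - D m n \<omega>\<bar>" for \<omega>
        using norm_iexp_diff_le[of "t * W n \<omega>" "t * D m n \<omega>"] by (simp only: right_diff_distrib[symmetric] abs_mult)
    qed
    also have "\<dots> = \<bar>t\<bar> * expectation (\<lambda>\<omega>. \<bar>W n \<omega> - D m n \<omega>\<bar>)" by simp
    also have "\<dots> \<le> \<bar>t\<bar> * (\<rho> n + \<mu> m)"
      unfolding \<rho>_def \<mu>_def by (intro mult_left_mono disc(4)) auto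
    finally show ?thesis .
  qed
  have main: "(\<lambda>n. \<integral>\<omega>. iexp (t * W n \<omega>) \<partial>M) \<longlonglongrightarrow> (\<integral>\<omega>. iexp (t * L' \<omega>) \<partial>N)" for t
  proof (rule LIMSEQ_I)
    fix r :: real assume "r > 0"
    have "(\<lambda>m. \<bar>t\<bar> * \<mu> m) \<longlonglongrightarrow> 0" using tendsto_mult_left[OF \<mu>, of "\<bar>t\<bar>"] by simp
    then have "\<forall>\<^sub>F m in sequentially. \<bar>t\<bar> * \<mu> m < r / 4" using \<open>r > 0\<close> by (intro order_tendstoD) auto
    moreover have "\<forall>\<^sub>F m in sequentially. dist (\<integral>\<omega>. iexp (t * E m \<omega>) \<partial>N) (\<integral>\<omega>. iexp (t * L' \<omega>) \<partial>N) < r / 4"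
      using \<open>r > 0\<close> by (intro tendstoD[OF E_lim]) simp
    ultimately have "\<forall>\<^sub>F m in sequentially. \<bar>t\<bar> * \<mu> m < r / 4 \<and> dist (\<integral>\<omega>. iexp (t * E m \<omega>) \<partial>N) (\<integral>\<omega>. iexp (t * L' \<omega>) \<partial>N) < r / 4"
      by eventually_elim simp
    then have "\<exists>m. \<bar>t\<bar> * \<mu> m < r / 4 \<and> dist (\<integral>\<omega>. iexp (t * E m \<omega>) \<partial>N) (\<integral>\<omega>. iexp (t * L' \<omega>) \<partial>N) < r / 4"
      by (rule eventually_happens'[OF sequentially_bot])
    then obtain m where m: "\<bar>t\<bar> * \<mu> m < r / 4" "norm ((\<integral>\<omega>. iexp (t * E m \<omega>) \<partial>N) - (\<integral>\<omega>. iexp (t * L' \<omega>) \<partial>N)) < r / 4"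
      unfolding dist_norm by blast
    \<comment> \<open>With m fixed, the mesh statistics converge and \<rho> n tends to 0, while the
      bound by \<mu> m persists for every n.\<close>
    have "(\<lambda>n. \<integral>\<omega>. iexp (t * D m n \<omega>) \<partial>M) \<longlonglongrightarrow> (\<integral>\<omega>. iexp (t * E m \<omega>) \<partial>N)"
      unfolding D_def E_def by (rule mesh_char_tendsto[OF N lim])
    then have "\<forall>\<^sub>F n in sequentially. dist (\<integral>\<omega>. iexp (t * D m n \<omega>) \<partial>M) (\<integral>\<omega>. iexp (t * E m \<omega>) \<partial>N) < r / 4"
      using \<open>r > 0\<close> by (intro tendstoD) auto
    moreover have "(\<lambda>n. \<bar>t\<bar> * \<rho> n) \<longlonglongrightarrow> 0" using tendsto_mult_left[OF \<rho>, of "\<bar>t\<bar>"] by simp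
    then have "\<forall>\<^sub>F n in sequentially. \<bar>t\<bar> * \<rho> n < r / 4" using \<open>r > 0\<close> by (intro order_tendstoD) auto
    ultimately have "\<forall>\<^sub>F n in sequentially. norm ((\<integral>\<omega>. iexp (t * W n \<omega>) \<partial>M) - (\<integral>\<omega>. iexp (t * L' \<omega>) \<partial>N)) < r"
    proof eventually_elim
      case (elim n)
      let ?w = "\<integral>\<omega>. iexp (t * W n \<omega>) \<partial>M" and ?d = "\<integral>\<omega>. iexp (t * D m n \<omega>) \<partial>M"
        and ?e = "\<integral>\<omega>. iexp (t * E m \<omega>) \<partial>N" and ?l = "\<integral>\<omega>. iexp (t * L' \<omega>) \<partial>N"
      have "norm (?w - ?l) = norm ((?w - ?d) + (?d - ?e) + (?e - ?l))" by simp
      also have "\<dots> \<le> norm (?w - ?d) + norm (?d - ?e) + norm (?e - ?l)"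
        by (meson add_right_mono norm_triangle_ineq order_trans)
      also have "\<dots> < r"
        using WD[of t n m] elim m unfolding distrib_left dist_norm by linarith
      finally show ?case .
    qed
    then show "\<exists>n0. \<forall>n\<ge>n0. norm ((\<integral>\<omega>. iexp (t * W n \<omega>) \<partial>M) - (\<integral>\<omega>. iexp (t * L' \<omega>) \<partial>N)) < r"
      by (simp add: eventually_sequentially)
  qed
  have "weak_conv_m (\<lambda>n. distr M borel (W n)) (distr (completion N) borel L)"
  proof (rule levy_continuity)
    show "real_distribution (distr M borel (W n))" for n by (rule real_distribution_distr[OF Wm])
    show "real_distribution (distr (completion N) borel L)" by (rule CN.real_distribution_distr[OF Lm])
    show "(\<lambda>n. char (distr M borel (W n)) t) \<longlonglongrightarrow> char (distr (completion N) borel L) t" for t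
      unfolding char_def using main[of t]
      by (simp add: integral_distr[OF Wm iexp_m[of t], simplified] integral_distr[OF Lm iexp_m[of t], simplified] char_L[simplified])
  qed
  then show "converges_in_distribution M
      (\<lambda>n \<omega>. sqrt (real n) * L1_asymmetry (emp_cop n \<omega>)) N (limit_functional G)"
    unfolding W_eq converges_in_distribution_def L_def .
qed

end

section \<open>Reduction to uniform margins\<close>

text \<open>A uniform margin puts no mass above 1, so a rectangle with one side {..1} agrees almost
  everywhere with a half plane, whose measure is given by the other margin.\<close>

lemma copula_margins:
  assumes "copula C" "a \<in> {0..1}"
  shows "C a 1 = a" "C 1 a = a"
proof -
  obtain \<mu> where \<mu>: "prob_space \<mu>" and s: "sets \<mu> = sets borel"
    and d: "distr \<mu> borel fst = uniform_measure lborel {0..1}" "distr \<mu> borel snd = uniform_measure lborel {0..1}"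
    and C: "\<And>u v. u \<in> {0..1} \<Longrightarrow> v \<in> {0..1} \<Longrightarrow> C u v = measure \<mu> ({..u} \<times> {..v})"
    using assms(1) unfolding copula_def by blast
  interpret \<mu>: prob_space \<mu> by fact
  have sp: "space \<mu> = UNIV" using sets_eq_imp_space_eq[OF s] by simp
  have fs: "fst \<in> borel_measurable \<mu>" "snd \<in> borel_measurable \<mu>"
    by (simp_all cong: measurable_cong_sets[OF s refl])
      (intro borel_measurable_continuous_onI continuous_intros)+
  have unif: "measure (uniform_measure lborel {0..1}) {..c} = c" if "c \<in> {0..1}" for c :: real
  proof -
    have "measure (uniform_measure lborel {0..1}) {..c} = measure lborel ({0..1} \<inter> {..c}) / measure lborel {0..1 :: real}"
      by (intro measure_uniform_measure) auto
    moreover have "{0..1} \<inter> {..c} = {0..c}" using that by auto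
    ultimately show ?thesis using that by simp
  qed
  have m: "measure \<mu> (h -` {..c}) = c"
    if "h \<in> borel_measurable \<mu>" "distr \<mu> borel h = uniform_measure lborel {0..1}" "c \<in> {0..1}" for h and c :: real
    using unif[OF that(3)] measure_distr[OF that(1), of "{..c}"] that(2) sp by simp
  have one: "AE z in \<mu>. h z \<le> 1"
    if h: "h \<in> borel_measurable \<mu>" "distr \<mu> borel h = uniform_measure lborel {0..1}" for h :: "real \<times> real \<Rightarrow> real"
  proof -
    have "AE x in distr \<mu> borel h. x \<le> 1"
      unfolding h(2) by (intro AE_uniform_measureI) auto
    then show ?thesis using h(1) by (subst (asm) AE_distr_iff) auto
  qed
  have "{..a} \<times> {..1} \<in> sets \<mu>" "{..1} \<times> {..a} \<in> sets \<mu>"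
    unfolding s by (auto intro!: borel_closed closed_Times)
  moreover have "fst -` {..a} \<in> sets \<mu>" "snd -` {..a} \<in> sets \<mu>"
    using measurable_sets[OF fs(1), of "{..a}"] measurable_sets[OF fs(2), of "{..a}"] sp by auto
  ultimately have "measure \<mu> ({..a} \<times> {..1}) = measure \<mu> (fst -` {..a})" "measure \<mu> ({..1} \<times> {..a}) = measure \<mu> (snd -` {..a})"
    using one[OF fs(1) d(1)] one[OF fs(2) d(2)] by (auto intro!: \<mu>.finite_measure_eq_AE elim!: AE_mp)
  then show "C a 1 = a" "C 1 a = a"
    using C assms(2) m[OF fs(1) d(1) assms(2)] m[OF fs(2) d(2) assms(2)] by auto
qed

text \<open>A continuous distribution function may be flat, so x is the right end of the level: the
  supremum of a closed set, nonempty and bounded above because 0 < u < 1. The intermediate value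
  theorem shows that u is attained.\<close>

lemma (in real_distribution) cdf_continuous_level:
  assumes cont: "continuous_on UNIV (cdf M)" and "0 < u" "u < 1"
  obtains x where "cdf M x = u" "{y. cdf M y \<le> u} = {..x}"
proof -
  have "\<forall>\<^sub>F x in at_top. u < cdf M x" using cdf_lim_at_top_prob \<open>u < 1\<close> by (rule order_tendstoD)
  then obtain b where b: "u < cdf M b" by (meson eventually_happens trivial_limit_at_top_linorder)
  have "\<forall>\<^sub>F x in at_bot. cdf M x < u" using cdf_lim_at_bot \<open>0 < u\<close> by (rule order_tendstoD)
  then obtain a where a: "cdf M a < u" by (meson eventually_happens trivial_limit_at_bot_linorder)
  let ?S = "{y. cdf M y \<le> u}"
  have ne: "?S \<noteq> {}" using a by (auto intro: less_imp_le)
  have bd: "y \<le> b" if "y \<in> ?S" for y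
    using that b cdf_nondecreasing[of b y] by (cases "y \<le> b") auto
  then have bdd: "bdd_above ?S" by (intro bdd_aboveI[of _ b])
  have "closed ?S" using cont by (intro closed_Collect_le) (auto intro: continuous_intros)
  then have x: "Sup ?S \<in> ?S" using closed_contains_Sup[OF ne bdd] by simp
  have S: "?S = {..Sup ?S}"
  proof
    show "?S \<subseteq> {..Sup ?S}" using cSup_upper[OF _ bdd] by auto
    show "{..Sup ?S} \<subseteq> ?S"
    proof
      fix y assume "y \<in> {..Sup ?S}"
      then have "cdf M y \<le> cdf M (Sup ?S)" by (intro cdf_nondecreasing) simp
      then show "y \<in> ?S" using x by simp
    qed
  qed
  have "a \<le> b" using bd[of a] a by auto
  obtain c where "cdf M c = u"
    using IVT'[of "cdf M" a u b] a b \<open>a \<le> b\<close> continuous_on_subset[OF cont] by force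
  then have "c \<le> Sup ?S" using cSup_upper[OF _ bdd, of c] by simp
  then have "cdf M (Sup ?S) = u" using cdf_nondecreasing[of c "Sup ?S"] \<open>cdf M c = u\<close> x by auto
  then show ?thesis using that S by blast
qed

lemma copula_zero:
  assumes "copula C" "b \<in> {0..1}"
  shows "C 0 b = 0" "C b 0 = 0"
proof -
  obtain \<mu> where \<mu>: "prob_space \<mu>" and s: "sets \<mu> = sets borel"
    and C: "\<And>u v. u \<in> {0..1} \<Longrightarrow> v \<in> {0..1} \<Longrightarrow> C u v = measure \<mu> ({..u} \<times> {..v})"
    using assms(1) unfolding copula_def by blast
  interpret \<mu>: prob_space \<mu> by fact
  have "{..0} \<times> {..1} \<in> sets \<mu>" "{..1} \<times> {..0} \<in> sets \<mu>"
    unfolding s by (auto intro!: borel_closed closed_Times)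
  then have "measure \<mu> ({..0} \<times> {..b}) \<le> measure \<mu> ({..0} \<times> {..1})"
    "measure \<mu> ({..b} \<times> {..0}) \<le> measure \<mu> ({..1} \<times> {..0})"
    using assms(2) by (auto intro!: \<mu>.finite_measure_mono)
  then show "C 0 b = 0" "C b 0 = 0"
    using C assms copula_margins[OF assms(1), of 0] by (auto simp: measure_le_0_iff)
qed

text \<open>For interior a and b the transformed event is a quadrant of (X, Y), and the copula
  identity applies at its corner. At level 0 or 1 there need be no such corner, and the boundary
  values of the copula take over.\<close>

lemma (in prob_space) copula_of_probability_transform:
  fixes X Y :: "'a \<Rightarrow> real"
  defines "F \<equiv> cdf (distr M borel X)" and "G \<equiv> cdf (distr M borel Y)"
  assumes X [measurable]: "X \<in> borel_measurable M" and Y [measurable]: "Y \<in> borel_measurable M"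
    and cont: "continuous_on UNIV F" "continuous_on UNIV G"
    and C: "copula_of M X Y C" and ab: "a \<in> {0..1}" "b \<in> {0..1}"
  shows "prob {\<omega> \<in> space M. F (X \<omega>) \<le> a \<and> G (Y \<omega>) \<le> b} = C a b"
proof -
  interpret DX: real_distribution "distr M borel X" by (rule real_distribution_distr) (rule X)
  interpret DY: real_distribution "distr M borel Y" by (rule real_distribution_distr) (rule Y)
  have cop: "copula C" and CXY: "\<And>x y. prob {\<omega> \<in> space M. X \<omega> \<le> x \<and> Y \<omega> \<le> y} = C (F x) (G y)"
    using C by (auto simp: copula_of_def F_def G_def)
  have F1: "F x \<le> 1" "G x \<le> 1" for x
    using DX.cdf_bounded_prob DY.cdf_bounded_prob by (auto simp: F_def G_def)
  have [measurable]: "F \<in> borel_measurable borel" "G \<in> borel_measurable borel"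
    using cont by (auto intro: borel_measurable_continuous_onI)
  have margin: "prob {\<omega> \<in> space M. H (W \<omega>) \<le> c} = c"
    if W [measurable]: "W \<in> borel_measurable M" and H: "H = cdf (distr M borel W)" "continuous_on UNIV H" and c: "0 < c" "c < 1" for W H and c :: real
  proof -
    interpret DW: real_distribution "distr M borel W" by (rule real_distribution_distr) (rule W)
    obtain x where x: "H x = c" "{y. H y \<le> c} = {..x}"
      using DW.cdf_continuous_level[of c] H c by metis
    have "{\<omega> \<in> space M. H (W \<omega>) \<le> c} = W -` {..x} \<inter> space M" using x(2) by auto
    then show ?thesis using x(1) measure_distr[OF W, of "{..x}"] by (simp add: H(1) cdf_def)
  qed
  \<comment> \<open>The event at level 0 is contained in the events at small positive levels;
    \<open>min e (1/2)\<close> stays below 1, where \<open>margin\<close> applies.\<close>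
  have zero: "prob {\<omega> \<in> space M. P \<omega> \<and> H (W \<omega>) \<le> 0} = 0"
    if W [measurable]: "W \<in> borel_measurable M" and H: "H = cdf (distr M borel W)" "continuous_on UNIV H" for W H P
  proof -
    have [measurable]: "H \<in> borel_measurable borel" using H(2) by (rule borel_measurable_continuous_onI)
    have "prob {\<omega> \<in> space M. P \<omega> \<and> H (W \<omega>) \<le> 0} \<le> 0"
    proof (rule field_le_epsilon)
      fix e :: real assume "e > 0"
      have "prob {\<omega> \<in> space M. P \<omega> \<and> H (W \<omega>) \<le> 0} \<le> prob {\<omega> \<in> space M. H (W \<omega>) \<le> min e (1/2)}"
        using \<open>e > 0\<close> by (intro finite_measure_mono) auto
      also have "\<dots> \<le> 0 + e" using \<open>e > 0\<close> by (subst margin[OF W H]) auto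
      finally show "prob {\<omega> \<in> space M. P \<omega> \<and> H (W \<omega>) \<le> 0} \<le> 0 + e" .
    qed
    then show ?thesis by (simp only: measure_le_0_iff)
  qed
  consider "a = 0" | "b = 0" | "a = 1" "0 < b" | "b = 1" "0 < a" | "0 < a" "a < 1" "0 < b" "b < 1"
    using ab by force
  then show ?thesis
  proof cases
    case 1
    then show ?thesis
      using zero[OF X F_def[THEN meta_eq_to_obj_eq] cont(1), of "\<lambda>\<omega>. G (Y \<omega>) \<le> b"] copula_zero[OF cop ab(2)]
      by (simp add: conj_commute)
  next
    case 2
    then show ?thesis
      using zero[OF Y G_def[THEN meta_eq_to_obj_eq] cont(2), of "\<lambda>\<omega>. F (X \<omega>) \<le> a"] copula_zero[OF cop ab(1)]
      by simp
  next
    case 3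
    show ?thesis
    proof (cases "b = 1")
      case True
      then show ?thesis using 3 F1 copula_margins[OF cop, of 1] prob_space by simp
    next
      case False
      then show ?thesis
        using 3 ab F1 copula_margins[OF cop ab(2)] margin[OF Y G_def[THEN meta_eq_to_obj_eq] cont(2), of b] by simp
    qed
  next
    case 4
    show ?thesis
    proof (cases "a = 1")
      case True
      then show ?thesis using 4 F1 copula_margins[OF cop, of 1] prob_space by simp
    next
      case False
      then show ?thesis
        using 4 ab F1 copula_margins[OF cop ab(1)] margin[OF X F_def[THEN meta_eq_to_obj_eq] cont(1), of a] by simp
    qed
  next
    case 5
    obtain x where x: "F x = a" "{z. F z \<le> a} = {..x}"
      using DX.cdf_continuous_level[of a] cont(1) 5 unfolding F_def by metis
    obtain y where y: "G y = b" "{z. G z \<le> b} = {..y}"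
      using DY.cdf_continuous_level[of b] cont(2) 5 unfolding G_def by metis
    have "F z \<le> a \<longleftrightarrow> z \<le> x" "G z \<le> b \<longleftrightarrow> z \<le> y" for z using x(2) y(2) by auto
    then show ?thesis using CXY[of x y] x(1) y(1) by simp
  qed
qed

text \<open>A nondecreasing map can alter the order only by creating ties. These are excluded on the
  transformed sample, where their absence is known almost surely.\<close>

lemma rank_mono_transform:
  assumes "mono f" "inj_on (\<lambda>i. f (x i)) {1..n}" "i \<in> {1..n}"
  shows "rank n (\<lambda>i. f (x i)) i = rank n x i"
proof -
  have "f (x j) \<le> f (x i) \<longleftrightarrow> x j \<le> x i" if "j \<in> {1..n}" for j
  proof
    assume le: "f (x j) \<le> f (x i)"
    show "x j \<le> x i"
    proof (rule ccontr)
      assume "\<not> x j \<le> x i"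
      then have "f (x i) = f (x j)" using monoD[OF assms(1), of "x i" "x j"] le by simp
      then have "i = j" using assms that by (auto dest: inj_onD)
      then show False using \<open>\<not> x j \<le> x i\<close> by simp
    qed
  qed (rule monoD[OF assms(1)])
  then show ?thesis unfolding rank_def by (intro arg_cong[where f = card]) auto
qed

theorem theorem9:
  fixes M :: "'a measure" and X Y :: "'a \<Rightarrow> real" and Xs Ys :: "nat \<Rightarrow> 'a \<Rightarrow> real"
    and C :: "real \<Rightarrow> real \<Rightarrow> real"
    and N :: "'b measure" and G :: "real \<times> real \<Rightarrow> 'b \<Rightarrow> real"
  assumes "prob_space M"
    and "X \<in> borel_measurable M" and "Y \<in> borel_measurable M"
    and "prob_space.indep_vars M (\<lambda>_. borel) (\<lambda>i \<omega>. (Xs i \<omega>, Ys i \<omega>)) {1..}"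
    and "\<And>i. i \<ge> 1 \<Longrightarrow>
      distr M borel (\<lambda>\<omega>. (Xs i \<omega>, Ys i \<omega>)) = distr M borel (\<lambda>\<omega>. (X \<omega>, Y \<omega>))"
    and "continuous_on UNIV (cdf (distr M borel X))"
    and "continuous_on UNIV (cdf (distr M borel Y))"
    and "copula_of M X Y C"
    and "\<And>u v. u \<in> {0..1} \<Longrightarrow> v \<in> {0..1} \<Longrightarrow> C u v = copula_transpose C u v"
    and "continuous_partials C"
    and "prob_space N" and "copula_limit_process N C G"
  defines "T \<equiv> \<lambda>n \<omega>. test_statistic n (\<lambda>i. Xs i \<omega>) (\<lambda>i. Ys i \<omega>)"
  shows "(\<forall>n \<omega>. T n \<omega> / sqrt (real n) =
            sqrt (real n) * L1_asymmetry (emp_copula n (\<lambda>i. Xs i \<omega>) (\<lambda>i. Ys i \<omega>))) \<and>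
         converges_in_distribution M (\<lambda>n \<omega>. T n \<omega> / sqrt (real n)) N (limit_functional G)"
proof -
  interpret M: prob_space M by fact
  define F1 where "F1 = cdf (distr M borel X)"
  define F2 where "F2 = cdf (distr M borel Y)"
  interpret DX: real_distribution "distr M borel X" by (rule M.real_distribution_distr) fact
  interpret DY: real_distribution "distr M borel Y" by (rule M.real_distribution_distr) fact
  have mono: "mono F1" "mono F2"
    unfolding F1_def F2_def by (auto intro!: monoI DX.cdf_nondecreasing DY.cdf_nondecreasing)
  have unit: "F1 x \<in> {0..1}" "F2 x \<in> {0..1}" for x
    by (auto simp: F1_def F2_def DX.cdf_nonneg DX.cdf_bounded_prob DY.cdf_nonneg DY.cdf_bounded_prob)
  define \<phi> where "\<phi> z = (F1 (fst z), F2 (snd z))" for z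
  have \<phi>: "\<phi> \<in> borel_measurable borel"
    unfolding \<phi>_def[abs_def] F1_def F2_def
    by (intro borel_measurable_continuous_onI continuous_intros
        continuous_on_compose2[OF assms(6)] continuous_on_compose2[OF assms(7)]) auto
  have XYs: "(\<lambda>\<omega>. (Xs i \<omega>, Ys i \<omega>)) \<in> borel_measurable M" if "i \<ge> 1" for i
    using assms(4) that by (auto simp: M.indep_vars_def)
  have fs: "(fst :: real \<times> real \<Rightarrow> real) \<in> borel_measurable borel" "(snd :: real \<times> real \<Rightarrow> real) \<in> borel_measurable borel"
    by (intro borel_measurable_continuous_onI continuous_intros)+
  have Xs: "Xs i \<in> borel_measurable M" and Ys: "Ys i \<in> borel_measurable M" if "i \<ge> 1" for i
    using measurable_compose[OF XYs[OF that] fs(1)] measurable_compose[OF XYs[OF that] fs(2)] by simp_all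
  have XY: "(\<lambda>\<omega>. (X \<omega>, Y \<omega>)) \<in> borel_measurable M"
    using assms(2,3) by (simp add: borel_prod[symmetric])
  have cop: "copula C" using assms(8) by (simp add: copula_of_def)
  define U where "U i \<omega> = F1 (Xs i \<omega>)" for i \<omega>
  define V where "V i \<omega> = F2 (Ys i \<omega>)" for i \<omega>
  have UV_law: "distr M borel (\<lambda>\<omega>. (U i \<omega>, V i \<omega>)) = distr M borel (\<lambda>\<omega>. (F1 (X \<omega>), F2 (Y \<omega>)))" if "i \<ge> 1" for i
  proof -
    have "distr M borel (\<lambda>\<omega>. (U i \<omega>, V i \<omega>)) = distr (distr M borel (\<lambda>\<omega>. (Xs i \<omega>, Ys i \<omega>))) borel \<phi>"
      by (subst distr_distr[OF \<phi> XYs[OF that]]) (simp add: comp_def \<phi>_def U_def V_def)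
    also have "\<dots> = distr (distr M borel (\<lambda>\<omega>. (X \<omega>, Y \<omega>))) borel \<phi>"
      using assms(5)[OF that] by simp
    also have "\<dots> = distr M borel (\<lambda>\<omega>. (F1 (X \<omega>), F2 (Y \<omega>)))"
      by (subst distr_distr[OF \<phi> XY]) (simp add: comp_def \<phi>_def)
    finally show ?thesis .
  qed
  have UV: "(\<lambda>\<omega>. (U i \<omega>, V i \<omega>)) \<in> borel_measurable M" if "i \<ge> 1" for i
    using measurable_compose[OF XYs[OF that] \<phi>] by (simp add: \<phi>_def U_def V_def)
  have FXY: "(\<lambda>\<omega>. (F1 (X \<omega>), F2 (Y \<omega>))) \<in> borel_measurable M"
    using measurable_compose[OF XY \<phi>] by (simp add: \<phi>_def)
  interpret S: copula_sample M U V C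
  proof
    have "M.indep_vars (\<lambda>_. borel) (\<lambda>i \<omega>. \<phi> (Xs i \<omega>, Ys i \<omega>)) {1..}"
      by (rule M.indep_vars_compose2[OF assms(4)]) (rule \<phi>)
    then show "M.indep_vars (\<lambda>_. borel) (\<lambda>i \<omega>. (U i \<omega>, V i \<omega>)) {1..}"
      by (simp add: \<phi>_def U_def V_def)
    show "distr M borel (\<lambda>\<omega>. (U i \<omega>, V i \<omega>)) = distr M borel (\<lambda>\<omega>. (U 1 \<omega>, V 1 \<omega>))" if "i \<ge> 1" for i
      using UV_law[OF that] UV_law[of 1] by simp
    \<comment> \<open>The common law carries the claim from the first observation to (X, Y), the
      vector to which the copula belongs.\<close>
    show "M.prob {\<omega> \<in> space M. U 1 \<omega> \<le> a \<and> V 1 \<omega> \<le> b} = C a b" if "a \<in> {0..1}" "b \<in> {0..1}" for a b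
    proof -
      have S: "{..a} \<times> {..b} \<in> sets borel" by (auto intro!: borel_closed closed_Times)
      have "M.prob {\<omega> \<in> space M. U 1 \<omega> \<le> a \<and> V 1 \<omega> \<le> b} = measure (distr M borel (\<lambda>\<omega>. (U 1 \<omega>, V 1 \<omega>))) ({..a} \<times> {..b})"
        by (subst measure_distr[OF UV S]) (auto intro!: arg_cong[where f = M.prob])
      also have "\<dots> = M.prob {\<omega> \<in> space M. F1 (X \<omega>) \<le> a \<and> F2 (Y \<omega>) \<le> b}"
        unfolding UV_law[OF order_refl]
        by (subst measure_distr[OF FXY S]) (auto intro!: arg_cong[where f = M.prob])
      also have "\<dots> = C a b"
        unfolding F1_def F2_def
        by (rule M.copula_of_probability_transform[OF assms(2,3,6,7,8) that])
      finally show ?thesis .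
    qed
  qed (use unit copula_margins[OF cop] assms(10) in \<open>auto simp: U_def V_def\<close>)
  \<comment> \<open>With the convention for division by 0 the identity includes n = 0.\<close>
  have T_eq: "T n \<omega> / sqrt (real n) = sqrt (real n) * L1_asymmetry (emp_copula n (\<lambda>i. Xs i \<omega>) (\<lambda>i. Ys i \<omega>))" for n \<omega>
    unfolding T_def test_statistic_def
    using real_div_sqrt[of "real n"] by (metis of_nat_0_le_iff times_divide_eq_left)
  \<comment> \<open>Deducing equality of laws from almost sure equality requires both statistics to
    be measurable on \<open>M\<close>.\<close>
  have T_meas: "(\<lambda>\<omega>. T n \<omega> / sqrt (real n)) \<in> borel_measurable M" for n
    unfolding T_eq L1_asymmetry_emp_copula
  proof (rule box.borel_measurable_lebesgue_integral)
    have p: "(\<lambda>x. fst (snd x)) \<in> borel_measurable (M \<Otimes>\<^sub>M box_measure)" "(\<lambda>x. snd (snd x)) \<in> borel_measurable (M \<Otimes>\<^sub>M box_measure)"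
      by (rule measurable_compose[OF measurable_snd fst_box_measurable], rule measurable_compose[OF measurable_snd snd_box_measurable])
    have "(\<lambda>x. \<bar>sqrt (real n) * (emp_copula n (\<lambda>i. Xs i (fst x)) (\<lambda>i. Ys i (fst x)) (fst (snd x)) (snd (snd x))
        - emp_copula n (\<lambda>i. Xs i (fst x)) (\<lambda>i. Ys i (fst x)) (snd (snd x)) (fst (snd x)))\<bar>) \<in> borel_measurable (M \<Otimes>\<^sub>M box_measure)"
      by (intro borel_measurable_abs borel_measurable_times borel_measurable_diff borel_measurable_const p
         emp_copula_measurable measurable_compose[OF measurable_fst Xs] measurable_compose[OF measurable_fst Ys])
    then show "(\<lambda>(\<omega>, p). \<bar>sqrt (real n) * (emp_copula n (\<lambda>i. Xs i \<omega>) (\<lambda>i. Ys i \<omega>) (fst p) (snd p)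
        - emp_copula n (\<lambda>i. Xs i \<omega>) (\<lambda>i. Ys i \<omega>) (snd p) (fst p))\<bar>) \<in> borel_measurable (M \<Otimes>\<^sub>M box_measure)"
      by (simp add: case_prod_beta')
  qed
  have sym: "C u v = C v u" if "u \<in> {0..1}" "v \<in> {0..1}" for u v
    using assms(9)[OF that] by (simp add: copula_transpose_def)
  note conv = S.asymmetry_converges[OF sym \<open>prob_space N\<close> \<open>copula_limit_process N C G\<close>]
  have "AE \<omega> in M. T n \<omega> / sqrt (real n) = sqrt (real n) * L1_asymmetry (emp_copula n (\<lambda>i. U i \<omega>) (\<lambda>i. V i \<omega>))" for n
    using S.AE_distinct[of n]
  proof eventually_elim
    case (elim \<omega>)
    then have "pseudo_obs n (\<lambda>i. U i \<omega>) i = pseudo_obs n (\<lambda>i. Xs i \<omega>) i"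
      "pseudo_obs n (\<lambda>i. V i \<omega>) i = pseudo_obs n (\<lambda>i. Ys i \<omega>) i" if "i \<in> {1..n}" for i
      using rank_mono_transform[OF mono(1), of "\<lambda>i. Xs i \<omega>" n i] rank_mono_transform[OF mono(2), of "\<lambda>i. Ys i \<omega>" n i] that
      by (simp_all add: pseudo_obs_def U_def V_def)
    then have "emp_copula n (\<lambda>i. U i \<omega>) (\<lambda>i. V i \<omega>) = emp_copula n (\<lambda>i. Xs i \<omega>) (\<lambda>i. Ys i \<omega>)"
      unfolding emp_copula_def by (intro ext arg_cong2[where f = "(*)"] refl sum.cong) auto
    then show ?case unfolding T_eq by simp
  qed
  then have "distr M borel (\<lambda>\<omega>. T n \<omega> / sqrt (real n))
      = distr M borel (\<lambda>\<omega>. sqrt (real n) * L1_asymmetry (emp_copula n (\<lambda>i. U i \<omega>) (\<lambda>i. V i \<omega>)))" for n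
    using T_meas conv(1) by (intro distr_cong_AE) auto
  then have "converges_in_distribution M (\<lambda>n \<omega>. T n \<omega> / sqrt (real n)) N (limit_functional G)"
    using conv(2) unfolding converges_in_distribution_def by simp
  then show ?thesis using T_eq by blast
qed

end
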